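(* Let $G$ be a finite abelian $p$-group and let $\triangleleft$ be a right action of $C_p$ on $G$ by group automorphisms. If $p$ is odd, or if $p=2$ and either the action of $C_2$ is trivial or $G$ is an elementary abelian $2$-group, then there exists a $C_p$-isomorphism (an isomorphism of $\mathbb{Z}C_p$-modules) $$H^2_c(\triangleleft)\;\simeq\; H^2(C_p,\widehat G)\times H^2_N(G,\Bbbk^{\times}).$$
   Context: $\Bbbk$ is an algebraically closed field of characteristic $0$, $p$ is a prime, $C_p$ is the cyclic group of order $p$ with a fixed generator $t$. The action $\triangleleft$ induces a left action $\bullet$ of $C_p$ on functions on $G$, $G\times G$, $C_p\times G$ and $C_p\times G\times G$ with values in $\Bbbk^\times$: $x$ acts by replacing every argument $a\in G$ by $a\triangleleft x$ and leaving arguments in $C_p$ unchanged, e.g. $(x\bullet s)(a,b)=s(a\triangleleft x,b\triangleleft x)$ and $(x\bullet\tau)(y,a,b)=\tau(y,a\triangleleft x,b\triangleleft x)$. All cochains are normalized (value $1$ if some argument is the identity). $Z^2_c(\triangleleft)$ is the group (pointwise multiplication) of functions $\tau:C_p\times G\times G\to\Bbbk^\times$ such that for all $x,y\in C_p$, $a,b,c\in G$: $\tau(x,a,bc)\tau(x,b,c)=\tau(x,ab,c)\tau(x,a,b)$ and $\tau(xy,a,b)=\tau(x,a,b)\,\tau(y,a\triangleleft x,b\triangleleft x)$. $B^2_c(\triangleleft)$ is the subgroup of all $\delta_G\eta$, $(\delta_G\eta)(x,a,b)=\eta(x,a)\eta(x,b)\eta(x,ab)^{-1}$, where $\eta:C_p\times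 G\to\Bbbk^\times$ is normalized with $\eta(xy,a)=\eta(x,a)\eta(y,a\triangleleft x)$. $H^2_c(\triangleleft)=H^2_c(\Bbbk C_p,\Bbbk^G,\triangleleft):=Z^2_c(\triangleleft)/B^2_c(\triangleleft)$, a $C_p$-module via $\bullet$. $\widehat G=\mathrm{Hom}(G,\Bbbk^\times)$ with $C_p$-action $(x\bullet\chi)(a)=\chi(a\triangleleft x)$; $H^2(C_p,\widehat G)$ is the ordinary second cohomology group with respect to this action. $H^2(G,\Bbbk^\times)$ is the second cohomology (Schur multiplier) with trivial action of $G$ on $\Bbbk^\times$, with the $C_p$-action induced by $\bullet$. For a (multiplicatively written) $\mathbb{Z}C_p$-module $M$ let $N:M\to M$, $N(m)=\prod_{i=0}^{p-1}t^i\bullet m$; then $H^2_N(G,\Bbbk^\times)$ denotes the kernel of $N$ in $H^2(G,\Bbbk^\times)$. *)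

theory Defs
  imports "HOL-Algebra.Algebra" "HOL-Algebra.Algebraic_Closure_Type" "HOL-Algebra.Product_Groups"
    "HOL-Computational_Algebra.Polynomial"
begin

abbreviation unit_group :: "'k::field monoid" where
  "unit_group \<equiv> mult_of ring_of_type_algebra"

text \<open>Groups of functions are subgroups of powers of the coefficient group, so cochains are
  extensional functions (\<open>undefined\<close> outside the product of the carriers).\<close>

abbreviation fun_group :: "'i set \<Rightarrow> ('m, 'r) monoid_scheme \<Rightarrow> ('i \<Rightarrow> 'm) monoid" where
  "fun_group I M \<equiv> product_group I (\<lambda>_. M)"

text \<open>A right action is written \<open>act a x\<close> for \<open>a \<triangleleft> x\<close>.\<close>

definition right_aut_action ::
    "('c, 'r) monoid_scheme \<Rightarrow> ('g, 's) monoid_scheme \<Rightarrow> ('g \<Rightarrow> 'c \<Rightarrow> 'g) \<Rightarrow> bool" where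
  "right_aut_action C G act \<longleftrightarrow>
     (\<forall>x\<in>carrier C. (\<lambda>a. act a x) \<in> iso G G) \<and>
     (\<forall>a\<in>carrier G. act a \<one>\<^bsub>C\<^esub> = a) \<and>
     (\<forall>x\<in>carrier C. \<forall>y\<in>carrier C. \<forall>a\<in>carrier G. act a (x \<otimes>\<^bsub>C\<^esub> y) = act (act a x) y)"

text \<open>A module over \<open>C\<close> is given by a commutative group and a left action \<open>C \<Rightarrow> M \<Rightarrow> M\<close>.\<close>

definition module_isomorphic ::
    "('c, 'r) monoid_scheme \<Rightarrow> ('m, 's) monoid_scheme \<Rightarrow> ('c \<Rightarrow> 'm \<Rightarrow> 'm) \<Rightarrow>
     ('n, 'u) monoid_scheme \<Rightarrow> ('c \<Rightarrow> 'n \<Rightarrow> 'n) \<Rightarrow> bool" where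
  "module_isomorphic C M \<alpha> N \<beta> \<longleftrightarrow>
     (\<exists>h\<in>iso M N. \<forall>x\<in>carrier C. \<forall>m\<in>carrier M. h (\<alpha> x m) = \<beta> x (h m))"

text \<open>The action induced on a quotient: for an automorphism \<open>\<phi>\<close> preserving the subgroup \<open>B\<close>,
  the image of the coset \<open>B f\<close> under \<open>\<phi>\<close> is the coset \<open>B (\<phi> f)\<close>.\<close>

definition coset_act :: "('c \<Rightarrow> 'm \<Rightarrow> 'm) \<Rightarrow> 'c \<Rightarrow> 'm set \<Rightarrow> 'm set" where
  "coset_act \<alpha> x S = \<alpha> x ` S"

definition prod_act :: "('c \<Rightarrow> 'm \<Rightarrow> 'm) \<Rightarrow> ('c \<Rightarrow> 'n \<Rightarrow> 'n) \<Rightarrow> 'c \<Rightarrow> 'm \<times> 'n \<Rightarrow> 'm \<times> 'n" where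
  "prod_act \<alpha> \<beta> x = map_prod (\<alpha> x) (\<beta> x)"

text \<open>For \<open>C\<close> cyclic with generator \<open>t\<close>.\<close>

definition norm_map ::
    "('c, 'r) monoid_scheme \<Rightarrow> 'c \<Rightarrow> ('m, 's) monoid_scheme \<Rightarrow> ('c \<Rightarrow> 'm \<Rightarrow> 'm) \<Rightarrow> 'm \<Rightarrow> 'm" where
  "norm_map C t M \<alpha> m = (\<Otimes>\<^bsub>M\<^esub>i\<in>{..<Coset.order C}. \<alpha> (t [^]\<^bsub>C\<^esub> i) m)"


subsection \<open>Second cohomology of a group \<open>C\<close> in a module \<open>(M, \<alpha>)\<close>, by normalized cochains\<close>

definition Z2 ::
    "('c, 'r) monoid_scheme \<Rightarrow> ('m, 's) monoid_scheme \<Rightarrow> ('c \<Rightarrow> 'm \<Rightarrow> 'm) \<Rightarrow> ('c \<times> 'c \<Rightarrow> 'm) set" where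
  "Z2 C M \<alpha> = {f \<in> carrier (fun_group (carrier C \<times> carrier C) M).
     (\<forall>x\<in>carrier C. f (\<one>\<^bsub>C\<^esub>, x) = \<one>\<^bsub>M\<^esub> \<and> f (x, \<one>\<^bsub>C\<^esub>) = \<one>\<^bsub>M\<^esub>) \<and>
     (\<forall>x\<in>carrier C. \<forall>y\<in>carrier C. \<forall>z\<in>carrier C.
        \<alpha> x (f (y, z)) \<otimes>\<^bsub>M\<^esub> f (x, y \<otimes>\<^bsub>C\<^esub> z) = f (x \<otimes>\<^bsub>C\<^esub> y, z) \<otimes>\<^bsub>M\<^esub> f (x, y))}"

definition B2 ::
    "('c, 'r) monoid_scheme \<Rightarrow> ('m, 's) monoid_scheme \<Rightarrow> ('c \<Rightarrow> 'm \<Rightarrow> 'm) \<Rightarrow> ('c \<times> 'c \<Rightarrow> 'm) set" where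
  "B2 C M \<alpha> =
     {\<lambda>(x, y)\<in>carrier C \<times> carrier C. \<alpha> x (g y) \<otimes>\<^bsub>M\<^esub> g x \<otimes>\<^bsub>M\<^esub> inv\<^bsub>M\<^esub> g (x \<otimes>\<^bsub>C\<^esub> y) | g.
        g \<in> carrier (fun_group (carrier C) M) \<and> g \<one>\<^bsub>C\<^esub> = \<one>\<^bsub>M\<^esub>}"

definition H2 ::
    "('c, 'r) monoid_scheme \<Rightarrow> ('m, 's) monoid_scheme \<Rightarrow> ('c \<Rightarrow> 'm \<Rightarrow> 'm) \<Rightarrow>
     ('c \<times> 'c \<Rightarrow> 'm) set monoid" where
  "H2 C M \<alpha> = (fun_group (carrier C \<times> carrier C) M)\<lparr>carrier := Z2 C M \<alpha>\<rparr> Mod B2 C M \<alpha>"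

text \<open>The action on \<open>H2 C M \<alpha>\<close> through the coefficients, for commutative \<open>C\<close>.\<close>

definition H2_coeff_act ::
    "('c, 'r) monoid_scheme \<Rightarrow> ('c \<Rightarrow> 'm \<Rightarrow> 'm) \<Rightarrow> 'c \<Rightarrow> ('c \<times> 'c \<Rightarrow> 'm) set \<Rightarrow> ('c \<times> 'c \<Rightarrow> 'm) set" where
  "H2_coeff_act C \<alpha> = coset_act (\<lambda>x f. \<lambda>(y, z)\<in>carrier C \<times> carrier C. \<alpha> x (f (y, z)))"


subsection \<open>The character group \<open>Hom(G, A)\<close>\<close>

definition dual_group ::
    "('g, 'r) monoid_scheme \<Rightarrow> ('k, 's) monoid_scheme \<Rightarrow> ('g \<Rightarrow> 'k) monoid" where
  "dual_group G A = (fun_group (carrier G) A)\<lparr>carrier := hom G A \<inter> extensional (carrier G)\<rparr>"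

definition dual_act ::
    "('g, 'r) monoid_scheme \<Rightarrow> ('g \<Rightarrow> 'c \<Rightarrow> 'g) \<Rightarrow> 'c \<Rightarrow> ('g \<Rightarrow> 'k) \<Rightarrow> ('g \<Rightarrow> 'k)" where
  "dual_act G act x \<chi> = (\<lambda>a\<in>carrier G. \<chi> (act a x))"


subsection \<open>\<open>H\<^sup>2(G, A)\<close> with trivial action of \<open>G\<close> on \<open>A\<close>, and the kernel of the norm on it\<close>

definition multiplier ::
    "('g, 'r) monoid_scheme \<Rightarrow> ('k, 's) monoid_scheme \<Rightarrow> ('g \<times> 'g \<Rightarrow> 'k) set monoid" where
  "multiplier G A = H2 G A (\<lambda>_ u. u)"

definition multiplier_act ::
    "('g, 'r) monoid_scheme \<Rightarrow> ('g \<Rightarrow> 'c \<Rightarrow> 'g) \<Rightarrow> 'c \<Rightarrow> ('g \<times> 'g \<Rightarrow> 'k) set \<Rightarrow> ('g \<times> 'g \<Rightarrow> 'k) set" where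
  "multiplier_act G act =
     coset_act (\<lambda>x s. \<lambda>(a, b)\<in>carrier G \<times> carrier G. s (act a x, act b x))"

definition norm_kernel_multiplier ::
    "('c, 'q) monoid_scheme \<Rightarrow> 'c \<Rightarrow> ('g, 'r) monoid_scheme \<Rightarrow> ('g \<Rightarrow> 'c \<Rightarrow> 'g) \<Rightarrow>
     ('k, 's) monoid_scheme \<Rightarrow> ('g \<times> 'g \<Rightarrow> 'k) set monoid" where
  "norm_kernel_multiplier C t G act A = (multiplier G A)
     \<lparr>carrier := kernel (multiplier G A) (multiplier G A)
        (norm_map C t (multiplier G A) (multiplier_act G act))\<rparr>"


subsection \<open>The group \<open>H\<^sup>2\<^sub>c(\<triangleleft>)\<close>\<close>

definition Z2c ::
    "('c, 'q) monoid_scheme \<Rightarrow> ('g, 'r) monoid_scheme \<Rightarrow> ('g \<Rightarrow> 'c \<Rightarrow> 'g) \<Rightarrow>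
     ('k, 's) monoid_scheme \<Rightarrow> ('c \<times> 'g \<times> 'g \<Rightarrow> 'k) set" where
  "Z2c C G act A = {\<tau> \<in> carrier (fun_group (carrier C \<times> carrier G \<times> carrier G) A).
     (\<forall>a\<in>carrier G. \<forall>b\<in>carrier G. \<tau> (\<one>\<^bsub>C\<^esub>, a, b) = \<one>\<^bsub>A\<^esub>) \<and>
     (\<forall>x\<in>carrier C. \<forall>a\<in>carrier G. \<tau> (x, \<one>\<^bsub>G\<^esub>, a) = \<one>\<^bsub>A\<^esub> \<and> \<tau> (x, a, \<one>\<^bsub>G\<^esub>) = \<one>\<^bsub>A\<^esub>) \<and>
     (\<forall>x\<in>carrier C. \<forall>a\<in>carrier G. \<forall>b\<in>carrier G. \<forall>c\<in>carrier G.
        \<tau> (x, a, b \<otimes>\<^bsub>G\<^esub> c) \<otimes>\<^bsub>A\<^esub> \<tau> (x, b, c) = \<tau> (x, a \<otimes>\<^bsub>G\<^esub> b, c) \<otimes>\<^bsub>A\<^esub> \<tau> (x, a, b)) \<and>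
     (\<forall>x\<in>carrier C. \<forall>y\<in>carrier C. \<forall>a\<in>carrier G. \<forall>b\<in>carrier G.
        \<tau> (x \<otimes>\<^bsub>C\<^esub> y, a, b) = \<tau> (x, a, b) \<otimes>\<^bsub>A\<^esub> \<tau> (y, act a x, act b x))}"

definition B2c ::
    "('c, 'q) monoid_scheme \<Rightarrow> ('g, 'r) monoid_scheme \<Rightarrow> ('g \<Rightarrow> 'c \<Rightarrow> 'g) \<Rightarrow>
     ('k, 's) monoid_scheme \<Rightarrow> ('c \<times> 'g \<times> 'g \<Rightarrow> 'k) set" where
  "B2c C G act A =
     {\<lambda>(x, a, b)\<in>carrier C \<times> carrier G \<times> carrier G.
        \<eta> (x, a) \<otimes>\<^bsub>A\<^esub> \<eta> (x, b) \<otimes>\<^bsub>A\<^esub> inv\<^bsub>A\<^esub> \<eta> (x, a \<otimes>\<^bsub>G\<^esub> b) | \<eta>.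
      \<eta> \<in> carrier (fun_group (carrier C \<times> carrier G) A) \<and>
      (\<forall>a\<in>carrier G. \<eta> (\<one>\<^bsub>C\<^esub>, a) = \<one>\<^bsub>A\<^esub>) \<and>
      (\<forall>x\<in>carrier C. \<eta> (x, \<one>\<^bsub>G\<^esub>) = \<one>\<^bsub>A\<^esub>) \<and>
      (\<forall>x\<in>carrier C. \<forall>y\<in>carrier C. \<forall>a\<in>carrier G.
         \<eta> (x \<otimes>\<^bsub>C\<^esub> y, a) = \<eta> (x, a) \<otimes>\<^bsub>A\<^esub> \<eta> (y, act a x))}"

definition H2c ::
    "('c, 'q) monoid_scheme \<Rightarrow> ('g, 'r) monoid_scheme \<Rightarrow> ('g \<Rightarrow> 'c \<Rightarrow> 'g) \<Rightarrow>
     ('k, 's) monoid_scheme \<Rightarrow> ('c \<times> 'g \<times> 'g \<Rightarrow> 'k) set monoid" where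
  "H2c C G act A =
     (fun_group (carrier C \<times> carrier G \<times> carrier G) A)\<lparr>carrier := Z2c C G act A\<rparr> Mod B2c C G act A"

definition H2c_act ::
    "('c, 'q) monoid_scheme \<Rightarrow> ('g, 'r) monoid_scheme \<Rightarrow> ('g \<Rightarrow> 'c \<Rightarrow> 'g) \<Rightarrow>
     'c \<Rightarrow> ('c \<times> 'g \<times> 'g \<Rightarrow> 'k) set \<Rightarrow> ('c \<times> 'g \<times> 'g \<Rightarrow> 'k) set" where
  "H2c_act C G act = coset_act (\<lambda>x \<tau>. \<lambda>(y, a, b)\<in>carrier C \<times> carrier G \<times> carrier G.
     \<tau> (y, act a x, act b x))"

end

(* A cocycle tau in Z^2_c is determined by its value at t, a 2-cocycle s of G with N s = 1. Sending
   tau to the class of s defines a homomorphism onto H^2_N(G, K^x), and its kernel consists of the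
   tau = delta_G eta for arbitrary cochains eta; then delta_C eta is a 2-cocycle of C_p with values
   in the dual of G, and eta |-> delta_C eta identifies the kernel modulo B^2_c with
   H^2(C_p, Hom(G, K^x)), because H^2(C_p, Map(G, K^x)) = 0.

   Surjectivity onto H^2_N and the elementary abelian case rest on one device: for a symmetric
   cocycle S on G the twisted product E of K^x and G is commutative, and K^x is a divisible subgroup,
   so any subgroup U0 of E that meets K^x trivially extends to a complement of K^x. A complement is
   a trivialization of S, and the choice of U0 (such as the image of t - 1) imposes symmetry on it.

   For odd p, half of the alternating bicharacter of a cocycle is an equivariant section. For p = 2,
   t acts on H^2_c by inversion and H^2_c has exponent 2, so any vector space complement is stable. *)
theory Submission
  imports Defs
begin

section \<open>Complements of subgroups\<close>

text \<open>The splitting is constructed with cocycles, not with classes. Let V be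
  \<open>fibrewise_B2c\<close>, the kernel of the map to H^2_N. It is enough to find a
  \<open>C\<close>-stable subgroup U of Z^2_c with U V = Z^2_c and U \<inter> V = B^2_c; modulo
  B^2_c it becomes an equivariant complement. The two outer terms are computed for every cyclic
  \<open>C\<close> and every finite abelian \<open>G\<close>; the hypotheses on p and
  \<open>G\<close> enter only in the construction of U. H^2(C_p, Map(G, K^x)) vanishes because H^2
  of a cyclic group is invariants modulo norms, and an invariant function is the norm of a pointwise
  p-th root of itself. The same roots are used for surjectivity: a class in H^2_N gives N s = S with
  S only a coboundary. To correct s so that its norm is exactly 1, S has to be trivialized by a
  t-invariant function. For p = 2 the squares have to lie in B^2_c and not merely in V. This asks
  for a trivialization \<eta> of the square of \<tau>(t) with \<eta> (t . \<eta>) = 1. The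
  obstruction consists of the values S(a, t a) with a (t a) = 1, and in an elementary abelian
  2-group such elements are fixed by t.\<close>

lemma (in comm_group) complement_exists:
  assumes V: "subgroup V G" and U0: "subgroup U0 G"
    and step: "\<And>U. \<lbrakk>subgroup U G; U0 \<subseteq> U; U \<inter> V \<subseteq> U0; U <#> V \<noteq> carrier G\<rbrakk> \<Longrightarrow>
       \<exists>e\<in>carrier G - (U <#> V). \<forall>k::int. e [^] k \<in> U <#> V \<longrightarrow> e [^] k \<in> U"
  obtains U where "subgroup U G" "U0 \<subseteq> U" "U \<inter> V \<subseteq> U0" "U <#> V = carrier G"
proof -
  \<comment> \<open>The bound \<open>U \<inter> V \<subseteq> U0\<close>, in place of a trivial
    intersection, lets one maximality argument serve both for splitting an extension and for
    complements modulo a subgroup \<open>U0\<close> of \<open>V\<close> such as B^2_c.\<close>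
  define F where "F = {U. subgroup U G \<and> U0 \<subseteq> U \<and> U \<inter> V \<subseteq> U0}"
  have "F \<noteq> {}" using U0 by (auto simp: F_def)
  moreover have "\<Union>\<C> \<in> F" if ne: "\<C> \<noteq> {}" and ch: "subset.chain F \<C>" for \<C>
  proof -
    have inF: "U \<in> F" if "U \<in> \<C>" for U using ch that by (auto simp: subset.chain_def)
    have "subgroup (\<Union>\<C>) G"
    proof (rule subgroupI)
      show "\<Union>\<C> \<subseteq> carrier G" using inF subgroup.subset by (fastforce simp: F_def)
      obtain S where "S \<in> \<C>" using ne by blast
      then show "\<Union>\<C> \<noteq> {}" using inF[of S] subgroup.one_closed[of S G] by (auto simp: F_def)
      show "inv a \<in> \<Union>\<C>" if a: "a \<in> \<Union>\<C>" for a
      proof -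
        obtain S where "a \<in> S" "S \<in> \<C>" using a by (rule UnionE)
        then show ?thesis using inF[of S] subgroup.m_inv_closed[of S G a] by (auto simp: F_def)
      qed
      show "a \<otimes> b \<in> \<Union>\<C>" if ab: "a \<in> \<Union>\<C>" "b \<in> \<Union>\<C>" for a b
      proof -
        obtain S Y where SY: "S \<in> \<C>" "Y \<in> \<C>" "a \<in> S" "b \<in> Y" using ab by blast
        then have "S \<subseteq> Y \<or> Y \<subseteq> S" using ch by (auto simp: subset.chain_def)
        then obtain Z where "Z \<in> \<C>" "a \<in> Z" "b \<in> Z" using SY by blast
        then show ?thesis using inF[of Z] subgroup.m_closed[of Z G a b] by (auto simp: F_def)
      qed
    qed
    then show ?thesis using ne inF by (fastforce simp: F_def)
  qed
  ultimately obtain U where U: "U \<in> F" and max: "\<And>S. S \<in> F \<Longrightarrow> U \<subseteq> S \<Longrightarrow> S = U"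
    using subset_Zorn_nonempty[of F] by metis
  then have sU: "subgroup U G" "U0 \<subseteq> U" "U \<inter> V \<subseteq> U0" by (auto simp: F_def)
  have "U <#> V = carrier G"
  proof (rule ccontr)
    assume "U <#> V \<noteq> carrier G"
    then obtain e where e: "e \<in> carrier G" "e \<notin> U <#> V"
      and pow: "\<And>k::int. e [^] k \<in> U <#> V \<Longrightarrow> e [^] k \<in> U"
      using step[OF sU] by blast
    \<comment> \<open>Adjoining \<open>e\<close> does not enlarge the intersection with
      \<open>V\<close>: if u e^k lies in \<open>V\<close>, then e^k lies in U V, hence in
      \<open>U\<close> by the choice of \<open>e\<close>, and the element was already in
      \<open>U\<close>.\<close>
    define W where "W = U <#> generate G {e}"
    have W: "subgroup W G" unfolding W_def
      using mult_subgroups[OF sU(1) generate_is_subgroup] e by simp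
    have UV: "u \<otimes> v \<in> U <#> V" if "u \<in> U" "v \<in> V" for u v
      using that by (auto simp: set_mult_def)
    have uinV: "u \<in> U <#> V" if "u \<in> U" for u
      using UV[OF that subgroup.one_closed[OF V]] that subgroup.mem_carrier[OF sU(1)] by simp
    have UW: "U \<subseteq> W"
    proof
      fix u assume "u \<in> U"
      then show "u \<in> W" using generate.one[of G "{e}"] subgroup.mem_carrier[OF sU(1), of u]
        by (force simp: W_def set_mult_def)
    qed
    have eW: "e \<in> W" using generate.incl[of e "{e}" G] subgroup.one_closed[OF sU(1)] e
      by (force simp: W_def set_mult_def)
    have "W \<inter> V \<subseteq> U0"
    proof
      fix w assume w: "w \<in> W \<inter> V"
      then obtain u k where u: "u \<in> U" and wk: "w = u \<otimes> e [^] (k::int)"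
        using generate_pow[OF e(1)] by (auto simp: W_def set_mult_def)
      have uc: "u \<in> carrier G" using u subgroup.mem_carrier[OF sU(1)] by blast
      have "e [^] k = inv u \<otimes> w" using uc e wk by (simp add: m_assoc[symmetric])
      also have "\<dots> \<in> U <#> V" using w u subgroup.m_inv_closed[OF sU(1)] UV by blast
      finally have "e [^] k \<in> U" by (rule pow)
      then have "w \<in> U" using wk u subgroup.m_closed[OF sU(1)] by simp
      then show "w \<in> U0" using w sU by blast
    qed
    then have "W \<in> F" using W UW sU by (auto simp: F_def)
    then have "W = U" using max UW by blast
    then show False using eW uinV e by blast
  qed
  with sU that show thesis by blast
qed

text \<open>If e^n = u a is the first power of \<open>e\<close> in U V, dividing \<open>e\<close> by
  an n-th root of \<open>a\<close> taken in \<open>V\<close> gives an element with n-th power in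
  \<open>U\<close> itself. Its powers that fall into U V are powers of that one, so it can be
  adjoined to \<open>U\<close>.\<close>

lemma (in comm_group) divisible_complement:
  assumes V: "subgroup V G" and U0: "subgroup U0 G" and int: "U0 \<inter> V = {\<one>}"
    and div: "\<And>a n. a \<in> V \<Longrightarrow> n > 0 \<Longrightarrow> \<exists>b\<in>V. b [^] (n::nat) = a"
    and tors: "\<And>e. e \<in> carrier G \<Longrightarrow> \<exists>n>0. e [^] (n::nat) \<in> V"
  obtains U where "subgroup U G" "U0 \<subseteq> U" "U \<inter> V = {\<one>}" "U <#> V = carrier G"
proof -
  have "\<exists>e\<in>carrier G - (U <#> V). \<forall>k::int. e [^] k \<in> U <#> V \<longrightarrow> e [^] k \<in> U"
    if U: "subgroup U G" "U0 \<subseteq> U" "U \<inter> V \<subseteq> U0" "U <#> V \<noteq> carrier G" for U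
  proof -
    have UVs: "subgroup (U <#> V) G" by (rule mult_subgroups[OF U(1) V])
    have vUV: "v \<in> U <#> V" if "v \<in> V" for v
      using that subgroup.one_closed[OF U(1)] subgroup.mem_carrier[OF V that]
      by (force simp: set_mult_def)
    obtain e where e: "e \<in> carrier G" "e \<notin> U <#> V"
      using U(4) subgroup.subset[OF UVs] by blast
    \<comment> \<open>The order of \<open>e\<close> modulo U V, finite because \<open>tors\<close>
      puts a positive power of \<open>e\<close> into \<open>V\<close>.\<close>
    define n where "n = (LEAST n. n > 0 \<and> e [^] (n::nat) \<in> U <#> V)"
    have ex: "\<exists>n. n > 0 \<and> e [^] (n::nat) \<in> U <#> V" using tors[OF e(1)] vUV by blast
    have n: "n > 0" "e [^] n \<in> U <#> V" unfolding n_def using LeastI_ex[OF ex] by auto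
    have least: "n \<le> m" if "m > 0" "e [^] m \<in> U <#> V" for m
      unfolding n_def using that by (intro Least_le) auto
    have dvd: "int n dvd k" if k: "e [^] k \<in> U <#> V" for k :: int
    proof -
      define r where "r = k mod int n"
      have r: "0 \<le> r" "r < int n" using n by (auto simp: r_def)
      have "e [^] k = (e [^] int n) [^] (k div int n) \<otimes> e [^] r"
        using e by (simp add: int_pow_pow int_pow_mult[symmetric] r_def del: int_pow_int)
      moreover define y where "y = (e [^] int n) [^] (k div int n)"
      moreover have "y \<in> U <#> V"
        unfolding y_def using n(2) UVs subgroup_int_pow_closed by (metis int_pow_int)
      ultimately have "inv y \<otimes> e [^] k = e [^] r" "inv y \<in> U <#> V"
        using e subgroup.mem_carrier[OF UVs, of y] subgroup.m_inv_closed[OF UVs, of y]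
        by (auto simp: m_assoc[symmetric])
      then have "e [^] r \<in> U <#> V" using k subgroup.m_closed[OF UVs] by metis
      then have "e [^] nat r \<in> U <#> V" using r by (metis int_pow_int nat_0_le)
      then have "nat r = 0" using least[of "nat r"] r by (metis gr0I nat_less_iff not_less)
      then show ?thesis using r by (simp add: r_def mod_eq_0_iff_dvd)
    qed
    obtain u a where u: "u \<in> U" and a: "a \<in> V" and ua: "e [^] n = u \<otimes> a"
      using n(2) by (auto simp: set_mult_def)
    obtain b where b: "b \<in> V" "b [^] n = a" using div[OF a n(1)] by blast
    have bc: "b \<in> carrier G" and uc: "u \<in> carrier G"
      using b u subgroup.mem_carrier[OF V] subgroup.mem_carrier[OF U(1)] by auto
    define e' where "e' = e \<otimes> inv b"
    have e'c: "e' \<in> carrier G" using e bc by (simp add: e'_def)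
    have ee': "e = e' \<otimes> b" using e bc by (simp add: e'_def m_assoc)
    have e'n: "e' [^] n = u"
      using e bc b ua uc subgroup.mem_carrier[OF V a]
      by (simp add: e'_def nat_pow_distrib nat_pow_inv m_assoc)
    have "e' \<notin> U <#> V" using e vUV[OF b(1)] subgroup.m_closed[OF UVs] ee' by metis
    moreover have "e' [^] k \<in> U" if k: "e' [^] k \<in> U <#> V" for k :: int
    proof -
      have "e [^] k = e' [^] k \<otimes> b [^] k" using ee' e'c bc by (simp add: int_pow_distrib)
      moreover have "b [^] k \<in> U <#> V" using vUV b(1) subgroup_int_pow_closed[OF V] by blast
      ultimately have "e [^] k \<in> U <#> V" using k subgroup.m_closed[OF UVs] by metis
      then obtain q where "k = int n * q" using dvd by blast
      then have "e' [^] k = (e' [^] int n) [^] q" using e'c by (simp add: int_pow_pow del: int_pow_int)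
      then show ?thesis using u subgroup_int_pow_closed[OF U(1), of u q] e'n by (simp add: int_pow_int)
    qed
    ultimately show ?thesis using e'c by (intro bexI[of _ e']) simp_all
  qed
  then obtain U where U: "subgroup U G" "U0 \<subseteq> U" "U \<inter> V \<subseteq> U0" "U <#> V = carrier G"
    using complement_exists[OF V U0] by blast
  moreover have "U \<inter> V = {\<one>}"
    using U int subgroup.one_closed[OF U(1)] subgroup.one_closed[OF V] by blast
  ultimately show thesis using that by blast
qed

text \<open>Modulo \<open>U0\<close> the group is a vector space over F_2. Any \<open>e\<close>
  outside U V can be adjoined: its even powers lie in \<open>U\<close>, and an odd power in U V
  would put \<open>e\<close> itself there.\<close>

lemma (in comm_group) exponent_two_complement:
  assumes V: "subgroup V G" and U0: "subgroup U0 G"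
    and sq: "\<And>e. e \<in> carrier G \<Longrightarrow> e \<otimes> e \<in> U0"
  obtains U where "subgroup U G" "U0 \<subseteq> U" "U \<inter> V \<subseteq> U0" "U <#> V = carrier G"
proof -
  have "\<exists>e\<in>carrier G - (U <#> V). \<forall>k::int. e [^] k \<in> U <#> V \<longrightarrow> e [^] k \<in> U"
    if U: "subgroup U G" "U0 \<subseteq> U" "U \<inter> V \<subseteq> U0" "U <#> V \<noteq> carrier G" for U
  proof -
    have UVs: "subgroup (U <#> V) G" by (rule mult_subgroups[OF U(1) V])
    have uUV: "u \<in> U <#> V" if "u \<in> U" for u
      using that subgroup.one_closed[OF V] subgroup.mem_carrier[OF U(1) that]
      by (force simp: set_mult_def)
    obtain e where e: "e \<in> carrier G" "e \<notin> U <#> V"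
      using U(4) subgroup.subset[OF UVs] by blast
    have even: "e [^] (2 * q) \<in> U" for q :: int
    proof -
      have "e [^] (2::int) = e \<otimes> e" using e int_pow_mult[of e 1 1] by simp
      then have "e [^] (2::int) \<in> U" using sq[OF e(1)] U(2) by auto
      then show ?thesis using subgroup_int_pow_closed[OF U(1)] e by (metis int_pow_pow)
    qed
    have "e [^] k \<in> U" if k: "e [^] k \<in> U <#> V" for k :: int
    proof (cases "even k")
      case True then show ?thesis using even by (metis evenE)
    next
      case False
      then obtain q where q: "k = 2 * q + 1" by (metis oddE)
      then have "e = inv (e [^] (2 * q)) \<otimes> e [^] k"
        using e by (simp add: int_pow_mult m_assoc[symmetric])
      then have "e \<in> U <#> V"
        using k uUV[OF even[of q]] subgroup.m_closed[OF UVs] subgroup.m_inv_closed[OF UVs] by metis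
      then show ?thesis using e by blast
    qed
    with e show ?thesis by (intro bexI[of _ e]) simp_all
  qed
  then show thesis using complement_exists[OF V U0] that by blast
qed

text \<open>On \<open>V\<close> the map \<open>d\<close> is a homomorphism with kernel U \<inter> V.
  Since U V is everything, it extends to \<open>M\<close> by being trivial on \<open>U\<close>;
  paired with \<pi>, the extension has kernel U \<inter> V. The second factor is the image of \<pi>
  because the restriction to t reaches only the norm kernel inside the multiplier.\<close>

lemma module_isomorphic_split:
  fixes M :: "('m, 'r) monoid_scheme" and P :: "('n, 's) monoid_scheme"
    and Q :: "('o, 'u) monoid_scheme"
  assumes M: "comm_group M" and P: "group P" and Q: "group Q"
    and V: "subgroup V M" and U: "subgroup U M" and UV: "U <#>\<^bsub>M\<^esub> V = carrier M"
    and \<pi>: "\<pi> \<in> hom M P" "\<And>m. m \<in> carrier M \<Longrightarrow> \<pi> m = \<one>\<^bsub>P\<^esub> \<longleftrightarrow> m \<in> V"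
    and d: "\<And>v w. v \<in> V \<Longrightarrow> w \<in> V \<Longrightarrow> d (v \<otimes>\<^bsub>M\<^esub> w) = d v \<otimes>\<^bsub>Q\<^esub> d w" "d ` V = carrier Q"
      "\<And>v. v \<in> V \<Longrightarrow> d v = \<one>\<^bsub>Q\<^esub> \<longleftrightarrow> v \<in> U"
    and act: "\<And>x m. x \<in> carrier C \<Longrightarrow> m \<in> carrier M \<Longrightarrow> \<alpha> x m \<in> carrier M"
      "\<And>x m m'. x \<in> carrier C \<Longrightarrow> m \<in> carrier M \<Longrightarrow> m' \<in> carrier M \<Longrightarrow>
         \<alpha> x (m \<otimes>\<^bsub>M\<^esub> m') = \<alpha> x m \<otimes>\<^bsub>M\<^esub> \<alpha> x m'"
      "\<And>x u. x \<in> carrier C \<Longrightarrow> u \<in> U \<Longrightarrow> \<alpha> x u \<in> U"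
      "\<And>x m. x \<in> carrier C \<Longrightarrow> m \<in> carrier M \<Longrightarrow> \<pi> (\<alpha> x m) = \<gamma> x (\<pi> m)"
      "\<And>x v. x \<in> carrier C \<Longrightarrow> v \<in> V \<Longrightarrow> \<alpha> x v \<in> V"
      "\<And>x v. x \<in> carrier C \<Longrightarrow> v \<in> V \<Longrightarrow> d (\<alpha> x v) = \<beta> x (d v)"
  shows "module_isomorphic C (M Mod (U \<inter> V)) (coset_act \<alpha>)
    (Q \<times>\<times> P\<lparr>carrier := \<pi> ` carrier M\<rparr>) (prod_act \<beta> \<gamma>)"
proof -
  interpret M: comm_group M by fact
  interpret Q: group Q by fact
  interpret \<pi>: group_hom M P \<pi>
    using \<pi>(1) P M.is_group by (simp add: group_hom_def group_hom_axioms_def)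
  define P' where "P' = P\<lparr>carrier := \<pi> ` carrier M\<rparr>"
  have "subgroup (\<pi> ` carrier M) P"
    using \<pi>.subgroup_img_is_subgroup[OF M.subgroup_self] .
  then interpret P': group P' unfolding P'_def by (rule subgroup.subgroup_is_group[OF _ P])
  have Vc: "v \<in> carrier M" if "v \<in> V" for v using subgroup.mem_carrier[OF V that] .
  have Uc: "u \<in> carrier M" if "u \<in> U" for u using subgroup.mem_carrier[OF U that] .
  have dc: "d v \<in> carrier Q" if "v \<in> V" for v using d(2) that by blast
  \<comment> \<open>Two decompositions of one element differ by w = v v'^-1 = u^-1 u', which lies in
    U \<inter> V and is killed by \<open>d\<close>. Hence \<open>d\<close> of the
    \<open>V\<close>-part is well defined.\<close>
  have dU: "d v = d v'" if "u \<in> U" "u' \<in> U" "v \<in> V" "v' \<in> V" "u \<otimes>\<^bsub>M\<^esub> v = u' \<otimes>\<^bsub>M\<^esub> v'" for u u' v v'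
  proof -
    note c = Uc[OF that(1)] Uc[OF that(2)] Vc[OF that(3)] Vc[OF that(4)]
    define w where "w = v \<otimes>\<^bsub>M\<^esub> inv\<^bsub>M\<^esub> v'"
    have wV: "w \<in> V" unfolding w_def
      using that subgroup.m_closed[OF V] subgroup.m_inv_closed[OF V] by blast
    have "w = inv\<^bsub>M\<^esub> u \<otimes>\<^bsub>M\<^esub> (u \<otimes>\<^bsub>M\<^esub> v) \<otimes>\<^bsub>M\<^esub> inv\<^bsub>M\<^esub> v'"
      using c by (simp add: w_def M.m_assoc[symmetric])
    also have "\<dots> = inv\<^bsub>M\<^esub> u \<otimes>\<^bsub>M\<^esub> u'" unfolding that(5) using c by (simp add: M.m_assoc)
    finally have wU: "w \<in> U" using that subgroup.m_closed[OF U] subgroup.m_inv_closed[OF U] by simp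
    have "v = w \<otimes>\<^bsub>M\<^esub> v'" using c by (simp add: w_def M.m_assoc)
    then have "d v = d w \<otimes>\<^bsub>Q\<^esub> d v'" using d(1) wV that by simp
    also have "d w = \<one>\<^bsub>Q\<^esub>" using d(3) wV wU by blast
    finally show ?thesis using dc that by simp
  qed
  have "\<exists>v. \<exists>u\<in>U. v \<in> V \<and> m = u \<otimes>\<^bsub>M\<^esub> v" if "m \<in> carrier M" for m
    using that unfolding UV[symmetric] set_mult_def by blast
  then obtain vv where vv: "\<And>m. m \<in> carrier M \<Longrightarrow> \<exists>u\<in>U. vv m \<in> V \<and> m = u \<otimes>\<^bsub>M\<^esub> vv m"
    by metis
  define \<Phi> where "\<Phi> = (\<lambda>m. (d (vv m), \<pi> m))"
  have \<Phi>: "\<Phi> (u \<otimes>\<^bsub>M\<^esub> v) = (d v, \<pi> u)" if "u \<in> U" "v \<in> V" for u v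
  proof -
    note c = Uc[OF that(1)] Vc[OF that(2)]
    obtain u' where "u' \<in> U" "vv (u \<otimes>\<^bsub>M\<^esub> v) \<in> V" "u \<otimes>\<^bsub>M\<^esub> v = u' \<otimes>\<^bsub>M\<^esub> vv (u \<otimes>\<^bsub>M\<^esub> v)"
      using vv[of "u \<otimes>\<^bsub>M\<^esub> v"] c by auto
    then have "d (vv (u \<otimes>\<^bsub>M\<^esub> v)) = d v" using dU that by metis
    moreover have "\<pi> v = \<one>\<^bsub>P\<^esub>" using \<pi>(2) c that by blast
    ultimately show ?thesis using c by (simp add: \<Phi>_def)
  qed
  have split: "\<exists>u\<in>U. \<exists>v\<in>V. m = u \<otimes>\<^bsub>M\<^esub> v" if "m \<in> carrier M" for m using vv[OF that] by blast
  have hom: "\<Phi> \<in> hom M (Q \<times>\<times> P')"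
  proof (rule homI)
    fix m assume m: "m \<in> carrier M"
    then show "\<Phi> m \<in> carrier (Q \<times>\<times> P')" using vv[OF m] dc by (auto simp: \<Phi>_def P'_def)
  next
    fix m m' assume "m \<in> carrier M" "m' \<in> carrier M"
    then obtain u v u' v' where *: "u \<in> U" "v \<in> V" "m = u \<otimes>\<^bsub>M\<^esub> v" "u' \<in> U" "v' \<in> V" "m' = u' \<otimes>\<^bsub>M\<^esub> v'"
      using split by metis
    have "m \<otimes>\<^bsub>M\<^esub> m' = (u \<otimes>\<^bsub>M\<^esub> u') \<otimes>\<^bsub>M\<^esub> (v \<otimes>\<^bsub>M\<^esub> v')"
      using * Uc Vc by (simp add: M.m_ac)
    then show "\<Phi> (m \<otimes>\<^bsub>M\<^esub> m') = \<Phi> m \<otimes>\<^bsub>Q \<times>\<times> P'\<^esub> \<Phi> m'"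
      using * \<Phi> subgroup.m_closed[OF U] subgroup.m_closed[OF V] d(1) Uc by (simp add: P'_def)
  qed
  then interpret \<Phi>: group_hom M "Q \<times>\<times> P'" \<Phi>
    using M.is_group DirProd_group[OF Q.is_group P'.is_group]
    by (simp add: group_hom_def group_hom_axioms_def)
  have "kernel M (Q \<times>\<times> P') \<Phi> = U \<inter> V"
  proof (intro equalityI subsetI)
    fix m assume "m \<in> kernel M (Q \<times>\<times> P') \<Phi>"
    then have m: "m \<in> carrier M" "d (vv m) = \<one>\<^bsub>Q\<^esub>" "\<pi> m = \<one>\<^bsub>P\<^esub>" by (auto simp: kernel_def \<Phi>_def P'_def)
    then show "m \<in> U \<inter> V"
      using vv[OF m(1)] d(3) \<pi>(2) subgroup.m_closed[OF U] by fastforce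
  next
    fix m assume m: "m \<in> U \<inter> V"
    then have "\<Phi> (\<one>\<^bsub>M\<^esub> \<otimes>\<^bsub>M\<^esub> m) = (d m, \<pi> \<one>\<^bsub>M\<^esub>)"
      using \<Phi> subgroup.one_closed[OF U] by blast
    then show "m \<in> kernel M (Q \<times>\<times> P') \<Phi>"
      using m d(3) Uc by (simp add: kernel_def P'_def)
  qed
  moreover have "\<Phi> ` carrier M = carrier (Q \<times>\<times> P')"
  proof (intro equalityI subsetI)
    fix z assume "z \<in> \<Phi> ` carrier M" then show "z \<in> carrier (Q \<times>\<times> P')" using \<Phi>.hom_closed by blast
  next
    fix z assume "z \<in> carrier (Q \<times>\<times> P')"
    then obtain q m where "z = (q, \<pi> m)" "q \<in> carrier Q" "m \<in> carrier M"
      by (auto simp: P'_def)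
    then obtain v where z: "z = (d v, \<pi> m)" "v \<in> V" "m \<in> carrier M"
      using d(2) by blast
    \<comment> \<open>Since \<pi> sees only the \<open>U\<close>-part of m, the
      \<open>V\<close>-part can be exchanged for one with the prescribed value of
      \<open>d\<close>.\<close>
    obtain u v' where uv: "u \<in> U" "v' \<in> V" "m = u \<otimes>\<^bsub>M\<^esub> v'" using split z by blast
    have "\<pi> v' = \<one>\<^bsub>P\<^esub>" using \<pi>(2) Vc uv by blast
    then have "z = \<Phi> (u \<otimes>\<^bsub>M\<^esub> v)" using z uv Uc Vc \<Phi> by simp
    then show "z \<in> \<Phi> ` carrier M" using uv z Uc Vc by blast
  qed
  ultimately have iso: "(\<lambda>S. the_elem (\<Phi> ` S)) \<in> iso (M Mod (U \<inter> V)) (Q \<times>\<times> P')"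
    using \<Phi>.FactGroup_iso_set by simp
  have eqv: "\<Phi> (\<alpha> x m) = prod_act \<beta> \<gamma> x (\<Phi> m)" if x: "x \<in> carrier C" and m: "m \<in> carrier M" for x m
  proof -
    obtain u v where uv: "u \<in> U" "v \<in> V" "m = u \<otimes>\<^bsub>M\<^esub> v" using split m by blast
    then show ?thesis using x act Uc Vc \<Phi> by (simp add: prod_act_def)
  qed
  \<comment> \<open>The map on the quotient takes \<open>the_elem\<close> of the image of a coset,
    so this image has to be a singleton.\<close>
  have sing: "\<exists>m\<in>carrier M. S = U \<inter> V #>\<^bsub>M\<^esub> m \<and> \<Phi> ` S = {\<Phi> m}"
    if S: "S \<in> carrier (M Mod (U \<inter> V))" for S
  proof -
    obtain m where m: "m \<in> carrier M" "S = U \<inter> V #>\<^bsub>M\<^esub> m"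
      using S by (auto simp: FactGroup_def RCOSETS_def)
    have "\<Phi> (k \<otimes>\<^bsub>M\<^esub> m) = \<Phi> m" if "k \<in> U \<inter> V" for k
    proof -
      have "\<Phi> k = \<one>\<^bsub>Q \<times>\<times> P'\<^esub>"
        using that \<open>kernel M (Q \<times>\<times> P') \<Phi> = U \<inter> V\<close> by (auto simp: kernel_def)
      then show ?thesis using that m Uc \<Phi>.hom_mult[of k m] \<Phi>.hom_closed[of m]
         \<Phi>.H.l_one[of "\<Phi> m"] by auto
    qed
    moreover have "m \<in> S" using m M.rcos_self[OF m(1)] M.subgroups_Inter_pair[OF U V] by auto
    ultimately have "\<Phi> ` S = {\<Phi> m}" using m by (auto simp: r_coset_def)
    then show ?thesis using m by blast
  qed
  have "the_elem (\<Phi> ` coset_act \<alpha> x S) = prod_act \<beta> \<gamma> x (the_elem (\<Phi> ` S))"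
    if x: "x \<in> carrier C" and S: "S \<in> carrier (M Mod (U \<inter> V))" for x S
  proof -
    obtain m where m: "m \<in> carrier M" "S = U \<inter> V #>\<^bsub>M\<^esub> m" "\<Phi> ` S = {\<Phi> m}" using sing[OF S] by blast
    have Xc: "S \<subseteq> carrier M" using m Uc by (auto simp: r_coset_def)
    have "\<Phi> ` coset_act \<alpha> x S = prod_act \<beta> \<gamma> x ` (\<Phi> ` S)"
      unfolding coset_act_def image_image using eqv[OF x] Xc by (intro image_cong) auto
    then show ?thesis using m(3) by simp
  qed
  then show ?thesis using iso unfolding module_isomorphic_def P'_def
    by (intro bexI[of _ "\<lambda>S. the_elem (\<Phi> ` S)"]) simp_all
qed

section \<open>Cohomology in degree two\<close>

lemma comm_group_fun_group:
  assumes "comm_group M"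
  shows "comm_group (fun_group I M)"
proof -
  interpret M: comm_group M by fact
  have "group (fun_group I M)" by (simp add: M.is_group)
  then show ?thesis
    by (rule group.group_comm_groupI) (auto simp: PiE_iff M.m_comm intro!: restrict_ext)
qed

lemma (in group) subgroup_of_comm_group:
  assumes "comm_group G" "subgroup H G"
  shows "comm_group (G\<lparr>carrier := H\<rparr>)"
proof -
  interpret G: comm_group G by fact
  have "group (G\<lparr>carrier := H\<rparr>)" using subgroup.subgroup_is_group[OF assms(2) is_group] .
  then show ?thesis
    by (rule group.group_comm_groupI)
      (use subgroup.mem_carrier[OF assms(2)] in \<open>auto simp: G.m_comm\<close>)
qed

text \<open>The equality \<phi>(B) = B, rather than an inclusion, makes the image of a coset a whole
  coset. This matters because \<open>coset_act\<close> is defined by images of sets.\<close>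

lemma (in group) image_r_coset:
  assumes "\<phi> \<in> hom G G" "\<phi> ` B = B" "B \<subseteq> carrier G" "s \<in> carrier G"
  shows "\<phi> ` (B #> s) = B #> \<phi> s"
proof -
  have "\<phi> ` (B #> s) = (\<lambda>b. \<phi> b \<otimes> \<phi> s) ` B"
    unfolding r_coset_def using assms by (force simp: hom_mult image_UN)
  also have "\<dots> = (\<lambda>b. b \<otimes> \<phi> s) ` (\<phi> ` B)" by (simp add: image_image)
  finally show ?thesis unfolding assms(2) by (auto simp: r_coset_def)
qed

locale group_module = C: group C + M: comm_group M
  for C :: "('c, 'r) monoid_scheme" (structure) and M :: "('m, 's) monoid_scheme" (structure) +
  fixes \<alpha> :: "'c \<Rightarrow> 'm \<Rightarrow> 'm"
  assumes act_hom: "x \<in> carrier C \<Longrightarrow> \<alpha> x \<in> hom M M"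
    and act_mult: "\<lbrakk>x \<in> carrier C; y \<in> carrier C; m \<in> carrier M\<rbrakk> \<Longrightarrow>
      \<alpha> (x \<otimes>\<^bsub>C\<^esub> y) m = \<alpha> x (\<alpha> y m)"
    and act_unit: "m \<in> carrier M \<Longrightarrow> \<alpha> \<one>\<^bsub>C\<^esub> m = m"
begin

lemma act_closed: "x \<in> carrier C \<Longrightarrow> m \<in> carrier M \<Longrightarrow> \<alpha> x m \<in> carrier M"
  using act_hom by (rule hom_in_carrier)

lemma act_distrib: "\<lbrakk>x \<in> carrier C; m \<in> carrier M; n \<in> carrier M\<rbrakk> \<Longrightarrow>
    \<alpha> x (m \<otimes>\<^bsub>M\<^esub> n) = \<alpha> x m \<otimes>\<^bsub>M\<^esub> \<alpha> x n"
  by (rule hom_mult[OF act_hom])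

lemma act_one: "x \<in> carrier C \<Longrightarrow> \<alpha> x \<one>\<^bsub>M\<^esub> = \<one>\<^bsub>M\<^esub>"
  by (rule hom_one[OF act_hom M.is_group M.is_group])

lemma act_inv: "x \<in> carrier C \<Longrightarrow> m \<in> carrier M \<Longrightarrow> \<alpha> x (inv\<^bsub>M\<^esub> m) = inv\<^bsub>M\<^esub> \<alpha> x m"
  using group_hom.hom_inv[of M M "\<alpha> x" m] act_hom[of x] M.is_group
  by (simp add: group_hom_def group_hom_axioms_def)

lemmas act_simps = act_closed act_distrib act_one act_inv

abbreviation "cochains2 \<equiv> fun_group (carrier C \<times> carrier C) M"

lemma interchange: "\<lbrakk>a \<in> carrier M; b \<in> carrier M; c \<in> carrier M; d \<in> carrier M\<rbrakk> \<Longrightarrow>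
    (a \<otimes>\<^bsub>M\<^esub> b) \<otimes>\<^bsub>M\<^esub> (c \<otimes>\<^bsub>M\<^esub> d) = (a \<otimes>\<^bsub>M\<^esub> c) \<otimes>\<^bsub>M\<^esub> (b \<otimes>\<^bsub>M\<^esub> d)"
  by (simp add: M.m_ac)

lemma subgroup_Z2: "subgroup (Z2 C M \<alpha>) cochains2"
proof (rule group.subgroupI)
  show "group cochains2" by (simp add: M.is_group)
  show "Z2 C M \<alpha> \<subseteq> carrier cochains2" by (auto simp: Z2_def)
  have "(\<lambda>i\<in>carrier C \<times> carrier C. \<one>\<^bsub>M\<^esub>) \<in> Z2 C M \<alpha>" by (auto simp: Z2_def act_simps)
  then show "Z2 C M \<alpha> \<noteq> {}" by blast
next
  fix f assume f: "f \<in> Z2 C M \<alpha>"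
  then have fc: "f (x, y) \<in> carrier M" if "x \<in> carrier C" "y \<in> carrier C" for x y
    using that by (auto simp: Z2_def)
  have "inv\<^bsub>cochains2\<^esub> f = (\<lambda>i\<in>carrier C \<times> carrier C. inv\<^bsub>M\<^esub> f i)"
    using f by (simp add: Z2_def M.is_group)
  then show "inv\<^bsub>cochains2\<^esub> f \<in> Z2 C M \<alpha>"
    using f fc by (auto simp: Z2_def act_simps M.inv_mult[symmetric])
next
  fix f g assume f: "f \<in> Z2 C M \<alpha>" and g: "g \<in> Z2 C M \<alpha>"
  have fc: "f (x, y) \<in> carrier M" "g (x, y) \<in> carrier M" if "x \<in> carrier C" "y \<in> carrier C" for x y
    using f g that by (auto simp: Z2_def)
  show "f \<otimes>\<^bsub>cochains2\<^esub> g \<in> Z2 C M \<alpha>"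
  proof -
    have "\<alpha> x (f (y, z) \<otimes>\<^bsub>M\<^esub> g (y, z)) \<otimes>\<^bsub>M\<^esub> (f (x, y \<otimes>\<^bsub>C\<^esub> z) \<otimes>\<^bsub>M\<^esub> g (x, y \<otimes>\<^bsub>C\<^esub> z)) =
        (f (x \<otimes>\<^bsub>C\<^esub> y, z) \<otimes>\<^bsub>M\<^esub> g (x \<otimes>\<^bsub>C\<^esub> y, z)) \<otimes>\<^bsub>M\<^esub> (f (x, y) \<otimes>\<^bsub>M\<^esub> g (x, y))"
      if c: "x \<in> carrier C" "y \<in> carrier C" "z \<in> carrier C" for x y z
    proof -
      have "\<alpha> x (f (y, z)) \<otimes>\<^bsub>M\<^esub> f (x, y \<otimes>\<^bsub>C\<^esub> z) = f (x \<otimes>\<^bsub>C\<^esub> y, z) \<otimes>\<^bsub>M\<^esub> f (x, y)"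
        "\<alpha> x (g (y, z)) \<otimes>\<^bsub>M\<^esub> g (x, y \<otimes>\<^bsub>C\<^esub> z) = g (x \<otimes>\<^bsub>C\<^esub> y, z) \<otimes>\<^bsub>M\<^esub> g (x, y)"
        using f g c by (auto simp: Z2_def)
      then show ?thesis using c fc
        interchange[of "\<alpha> x (f (y, z))" "\<alpha> x (g (y, z))" "f (x, y \<otimes>\<^bsub>C\<^esub> z)" "g (x, y \<otimes>\<^bsub>C\<^esub> z)"]
        interchange[of "f (x \<otimes>\<^bsub>C\<^esub> y, z)" "g (x \<otimes>\<^bsub>C\<^esub> y, z)" "f (x, y)" "g (x, y)"]
        by (simp add: act_simps)
    qed
    then show ?thesis using f g fc by (auto simp: Z2_def restrict_PiE_iff)
  qed
qed

lemma subgroup_B2: "subgroup (B2 C M \<alpha>) cochains2"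
proof (rule group.subgroupI)
  let ?d = "\<lambda>g. \<lambda>(x, y)\<in>carrier C \<times> carrier C. \<alpha> x (g y) \<otimes>\<^bsub>M\<^esub> g x \<otimes>\<^bsub>M\<^esub> inv\<^bsub>M\<^esub> g (x \<otimes>\<^bsub>C\<^esub> y)"
  have B2I: "?d g \<in> B2 C M \<alpha>"
    if "g \<in> carrier (fun_group (carrier C) M)" "g \<one>\<^bsub>C\<^esub> = \<one>\<^bsub>M\<^esub>" for g
    using that by (auto simp: B2_def)
  show "group cochains2" by (simp add: M.is_group)
  show "B2 C M \<alpha> \<subseteq> carrier cochains2"
  proof
    fix f assume "f \<in> B2 C M \<alpha>"
    then obtain g where g: "f = ?d g" "g \<in> carrier (fun_group (carrier C) M)" by (auto simp: B2_def)
    then have "g x \<in> carrier M" if "x \<in> carrier C" for x using that by auto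
    then show "f \<in> carrier cochains2" by (auto simp: g(1) act_simps restrict_PiE_iff)
  qed
  show "B2 C M \<alpha> \<noteq> {}" using B2I[of "\<lambda>x\<in>carrier C. \<one>\<^bsub>M\<^esub>"] by auto
  fix f assume "f \<in> B2 C M \<alpha>"
  then obtain g where g: "f = ?d g" "g \<in> carrier (fun_group (carrier C) M)" "g \<one>\<^bsub>C\<^esub> = \<one>\<^bsub>M\<^esub>"
    by (auto simp: B2_def)
  then have gc: "g x \<in> carrier M" if "x \<in> carrier C" for x using that by auto
  have "f \<in> carrier cochains2" using gc by (auto simp: g(1) act_simps restrict_PiE_iff)
  then have "inv\<^bsub>cochains2\<^esub> f = (\<lambda>i\<in>carrier C \<times> carrier C. inv\<^bsub>M\<^esub> f i)"
    by (simp add: M.is_group)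
  also have "\<dots> = ?d (\<lambda>x\<in>carrier C. inv\<^bsub>M\<^esub> g x)"
    using gc by (auto simp: fun_eq_iff g(1) act_simps M.inv_mult)
  also have "\<dots> \<in> B2 C M \<alpha>" using g(3) gc by (intro B2I) (auto simp: restrict_PiE_iff)
  finally show "inv\<^bsub>cochains2\<^esub> f \<in> B2 C M \<alpha>" .
  fix f' assume "f' \<in> B2 C M \<alpha>"
  then obtain g' where g': "f' = ?d g'" "g' \<in> carrier (fun_group (carrier C) M)" "g' \<one>\<^bsub>C\<^esub> = \<one>\<^bsub>M\<^esub>"
    by (auto simp: B2_def)
  then have gc': "g' x \<in> carrier M" if "x \<in> carrier C" for x using that by auto
  have "f \<otimes>\<^bsub>cochains2\<^esub> f' = ?d (\<lambda>x\<in>carrier C. g x \<otimes>\<^bsub>M\<^esub> g' x)"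
    using gc gc' by (auto simp: fun_eq_iff g(1) g'(1) act_simps M.inv_mult M.m_ac)
  also have "\<dots> \<in> B2 C M \<alpha>" using g(3) g'(3) gc gc' by (intro B2I) (auto simp: restrict_PiE_iff)
  finally show "f \<otimes>\<^bsub>cochains2\<^esub> f' \<in> B2 C M \<alpha>" .
qed

lemma B2_subset_Z2: "B2 C M \<alpha> \<subseteq> Z2 C M \<alpha>"
proof
  fix f assume f: "f \<in> B2 C M \<alpha>"
  then obtain g where g: "f = (\<lambda>(x, y)\<in>carrier C \<times> carrier C. \<alpha> x (g y) \<otimes>\<^bsub>M\<^esub> g x \<otimes>\<^bsub>M\<^esub> inv\<^bsub>M\<^esub> g (x \<otimes>\<^bsub>C\<^esub> y))"
      "g \<in> carrier (fun_group (carrier C) M)" "g \<one>\<^bsub>C\<^esub> = \<one>\<^bsub>M\<^esub>"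
    by (auto simp: B2_def)
  then have gc: "g x \<in> carrier M" if "x \<in> carrier C" for x using that by auto
  have one: "\<alpha> \<one>\<^bsub>C\<^esub> (g x) \<otimes>\<^bsub>M\<^esub> inv\<^bsub>M\<^esub> g x = \<one>\<^bsub>M\<^esub>" if "x \<in> carrier C" for x
    using that gc by (simp add: act_unit)
  \<comment> \<open>Dictionary: u = xy.g(z), v = x.g(y), w = x.g(yz), a = g(x), h = g(xyz), k =
    g(xy). The left side loses w, the right side loses k.\<close>
  have cancel: "(u \<otimes>\<^bsub>M\<^esub> v \<otimes>\<^bsub>M\<^esub> inv\<^bsub>M\<^esub> w) \<otimes>\<^bsub>M\<^esub> (w \<otimes>\<^bsub>M\<^esub> a \<otimes>\<^bsub>M\<^esub> inv\<^bsub>M\<^esub> h) =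
      (u \<otimes>\<^bsub>M\<^esub> k \<otimes>\<^bsub>M\<^esub> inv\<^bsub>M\<^esub> h) \<otimes>\<^bsub>M\<^esub> (v \<otimes>\<^bsub>M\<^esub> a \<otimes>\<^bsub>M\<^esub> inv\<^bsub>M\<^esub> k)"
    if "u \<in> carrier M" "v \<in> carrier M" "w \<in> carrier M" "a \<in> carrier M" "h \<in> carrier M" "k \<in> carrier M"
    for u v w a h k
  proof -
    have "(u \<otimes>\<^bsub>M\<^esub> v \<otimes>\<^bsub>M\<^esub> w') \<otimes>\<^bsub>M\<^esub> (w \<otimes>\<^bsub>M\<^esub> a \<otimes>\<^bsub>M\<^esub> h') = (u \<otimes>\<^bsub>M\<^esub> v \<otimes>\<^bsub>M\<^esub> a \<otimes>\<^bsub>M\<^esub> h') \<otimes>\<^bsub>M\<^esub> (w \<otimes>\<^bsub>M\<^esub> w')"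
      "(u \<otimes>\<^bsub>M\<^esub> k \<otimes>\<^bsub>M\<^esub> h') \<otimes>\<^bsub>M\<^esub> (v \<otimes>\<^bsub>M\<^esub> a \<otimes>\<^bsub>M\<^esub> k') = (u \<otimes>\<^bsub>M\<^esub> v \<otimes>\<^bsub>M\<^esub> a \<otimes>\<^bsub>M\<^esub> h') \<otimes>\<^bsub>M\<^esub> (k \<otimes>\<^bsub>M\<^esub> k')"
      if "w' \<in> carrier M" "h' \<in> carrier M" "k' \<in> carrier M" for w' h' k'
      using that \<open>u \<in> _\<close> \<open>v \<in> _\<close> \<open>w \<in> _\<close> \<open>a \<in> _\<close> \<open>k \<in> _\<close> by (simp_all add: M.m_ac)
    from this[of "inv\<^bsub>M\<^esub> w" "inv\<^bsub>M\<^esub> h" "inv\<^bsub>M\<^esub> k"] show ?thesis using that by simp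
  qed
  have "\<alpha> x (f (y, z)) \<otimes>\<^bsub>M\<^esub> f (x, y \<otimes>\<^bsub>C\<^esub> z) = f (x \<otimes>\<^bsub>C\<^esub> y, z) \<otimes>\<^bsub>M\<^esub> f (x, y)"
    if c: "x \<in> carrier C" "y \<in> carrier C" "z \<in> carrier C" for x y z
    using c gc cancel[of "\<alpha> x (\<alpha> y (g z))" "\<alpha> x (g y)" "\<alpha> x (g (y \<otimes>\<^bsub>C\<^esub> z))" "g x"
        "g (x \<otimes>\<^bsub>C\<^esub> (y \<otimes>\<^bsub>C\<^esub> z))" "g (x \<otimes>\<^bsub>C\<^esub> y)"]
    by (simp add: g(1) act_simps act_mult C.m_assoc)
  moreover have "f (x, \<one>\<^bsub>C\<^esub>) = \<one>\<^bsub>M\<^esub>" "f (\<one>\<^bsub>C\<^esub>, x) = \<one>\<^bsub>M\<^esub>" if "x \<in> carrier C" for x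
    using that gc g(3) by (simp_all add: g(1) act_simps act_unit)
  ultimately show "f \<in> Z2 C M \<alpha>"
    using subsetD[OF subgroup.subset[OF subgroup_B2] f] by (simp add: Z2_def)
qed

abbreviation "cocycle_group \<equiv> cochains2\<lparr>carrier := Z2 C M \<alpha>\<rparr>"

lemma comm_group_cocycles: "comm_group cocycle_group"
  using group.subgroup_of_comm_group[OF _ comm_group_fun_group[OF M.comm_group_axioms] subgroup_Z2]
  by (simp add: M.is_group)

lemma subgroup_B2_cocycles: "subgroup (B2 C M \<alpha>) cocycle_group"
  using group.subgroup_incl[OF _ subgroup_B2 subgroup_Z2 B2_subset_Z2] by (simp add: M.is_group)

lemma normal_B2: "B2 C M \<alpha> \<lhd> cocycle_group"
  using comm_group.subgroup_imp_normal[OF comm_group_cocycles subgroup_B2_cocycles] .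

lemma comm_group_H2: "comm_group (H2 C M \<alpha>)"
  unfolding H2_def using comm_group.abelian_FactGroup[OF comm_group_cocycles subgroup_B2_cocycles] .

definition cls :: "('c \<times> 'c \<Rightarrow> 'm) \<Rightarrow> ('c \<times> 'c \<Rightarrow> 'm) set" where
  "cls f = B2 C M \<alpha> #>\<^bsub>cocycle_group\<^esub> f"

lemma cls_hom: "cls \<in> hom cocycle_group (H2 C M \<alpha>)"
  unfolding H2_def cls_def using normal.r_coset_hom_Mod[OF normal_B2] .

lemma cls_mult: "f \<in> Z2 C M \<alpha> \<Longrightarrow> g \<in> Z2 C M \<alpha> \<Longrightarrow>
    cls (f \<otimes>\<^bsub>cochains2\<^esub> g) = cls f \<otimes>\<^bsub>H2 C M \<alpha>\<^esub> cls g"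
  using hom_mult[OF cls_hom, of f g] by simp

lemma carrier_H2: "carrier (H2 C M \<alpha>) = cls ` Z2 C M \<alpha>"
  by (auto simp: H2_def FactGroup_def RCOSETS_def cls_def)

lemma cls_eq_one_iff: "f \<in> Z2 C M \<alpha> \<Longrightarrow> cls f = \<one>\<^bsub>H2 C M \<alpha>\<^esub> \<longleftrightarrow> f \<in> B2 C M \<alpha>"
proof -
  assume f: "f \<in> Z2 C M \<alpha>"
  interpret Z: comm_group cocycle_group by (rule comm_group_cocycles)
  have "cls f = B2 C M \<alpha> \<longleftrightarrow> f \<in> B2 C M \<alpha>"
    unfolding cls_def
    using Z.coset_join1[of "B2 C M \<alpha>" f] Z.coset_join2[of f "B2 C M \<alpha>"]
      subgroup_B2_cocycles f B2_subset_Z2 by auto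
  then show ?thesis by (simp add: H2_def FactGroup_def)
qed

lemma image_cls:
  assumes "\<phi> \<in> hom cocycle_group cocycle_group" "\<phi> ` B2 C M \<alpha> = B2 C M \<alpha>" "f \<in> Z2 C M \<alpha>"
  shows "\<phi> ` cls f = cls (\<phi> f)"
  unfolding cls_def
  using group.image_r_coset[OF comm_group.axioms(2)[OF comm_group_cocycles] assms(1,2)] assms(3)
    B2_subset_Z2 by auto

end

section \<open>Trivializations of symmetric cocycles\<close>

text \<open>The extension of \<open>G\<close> by the units with factor set \<open>S\<close>. A
  section g \<mapsto> (\<zeta> g, g) is a homomorphism if and only if \<zeta>(gh) = \<zeta>(g)
  \<zeta>(h) S(g, h), so that 1/\<zeta> is a trivialization of \<open>S\<close>.\<close>

definition twisted_product :: "('g, 'r) monoid_scheme \<Rightarrow> ('g \<Rightarrow> 'g \<Rightarrow> 'k::field) \<Rightarrow> ('k \<times> 'g) monoid" where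
  "twisted_product G S = \<lparr>carrier = (UNIV - {0}) \<times> carrier G,
     monoid.mult = (\<lambda>(c, g) (d, h). (c * d * S g h, g \<otimes>\<^bsub>G\<^esub> h)), one = (1, \<one>\<^bsub>G\<^esub>)\<rparr>"

locale symmetric_cocycle = comm_group G for G (structure) +
  fixes S :: "'a \<Rightarrow> 'a \<Rightarrow> 'k::alg_closed_field"
  assumes fin: "finite (carrier G)"
    and nonzero: "a \<in> carrier G \<Longrightarrow> b \<in> carrier G \<Longrightarrow> S a b \<noteq> 0"
    and unit: "a \<in> carrier G \<Longrightarrow> S \<one> a = 1"
    and sym: "a \<in> carrier G \<Longrightarrow> b \<in> carrier G \<Longrightarrow> S a b = S b a"
    and cocycle: "\<lbrakk>a \<in> carrier G; b \<in> carrier G; c \<in> carrier G\<rbrakk> \<Longrightarrow>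
      S b c * S a (b \<otimes> c) = S (a \<otimes> b) c * S a b"
begin

abbreviation "E \<equiv> twisted_product G S"

lemma carrier_E: "carrier E = (UNIV - {0}) \<times> carrier G"
  and mult_E: "(c, g) \<otimes>\<^bsub>E\<^esub> (d, h) = (c * d * S g h, g \<otimes> h)"
  and one_E: "\<one>\<^bsub>E\<^esub> = (1, \<one>)"
  by (simp_all add: twisted_product_def)

lemma unit': "a \<in> carrier G \<Longrightarrow> S a \<one> = 1"
  using sym[of a \<one>] unit by simp

lemma comm_group_E: "comm_group E"
proof (rule comm_groupI)
  fix x y z assume xyz: "x \<in> carrier E" "y \<in> carrier E" "z \<in> carrier E"
  obtain c g d h e k where "x = (c, g)" "y = (d, h)" "z = (e, k)"
    by (metis prod.exhaust)
  with xyz have *: "x = (c, g)" "y = (d, h)" "z = (e, k)"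
    "g \<in> carrier G" "h \<in> carrier G" "k \<in> carrier G" by (auto simp: carrier_E)
  have "c * d * S g h * e * S (g \<otimes> h) k = c * (d * e * S h k) * S g (h \<otimes> k)"
    using cocycle[of g h k] * by (simp add: mult.assoc mult.left_commute mult.commute)
  then show "x \<otimes>\<^bsub>E\<^esub> y \<otimes>\<^bsub>E\<^esub> z = x \<otimes>\<^bsub>E\<^esub> (y \<otimes>\<^bsub>E\<^esub> z)"
    using * by (simp add: mult_E m_assoc)
next
  fix x assume "x \<in> carrier E"
  then obtain c g where *: "x = (c, g)" "c \<noteq> 0" "g \<in> carrier G" by (auto simp: carrier_E)
  then have "(1 / (c * S (inv g) g), inv g) \<in> carrier E"
    "(1 / (c * S (inv g) g), inv g) \<otimes>\<^bsub>E\<^esub> x = \<one>\<^bsub>E\<^esub>"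
    using nonzero by (auto simp: carrier_E mult_E one_E)
  then show "\<exists>y\<in>carrier E. y \<otimes>\<^bsub>E\<^esub> x = \<one>\<^bsub>E\<^esub>" by blast
qed (use nonzero in \<open>auto simp: carrier_E mult_E one_E unit unit' sym m_comm\<close>)

sublocale E: comm_group E by (rule comm_group_E)

lemma snd_hom: "snd \<in> hom E G"
  by (auto simp: hom_def carrier_E mult_E)

text \<open>A complement \<open>U\<close> of the units projects bijectively onto \<open>G\<close>,
  so it is the graph of a function \<zeta>, and closure under multiplication makes \<zeta>
  multiplicative up to \<open>S\<close>. The inclusion of \<open>U0\<close> in \<open>U\<close>
  prescribes \<zeta> on the projection of \<open>U0\<close>.\<close>

lemma ex_trivialization:
  assumes U0: "subgroup U0 E" and int: "\<And>c. (c, \<one>) \<in> U0 \<Longrightarrow> c = 1"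
  shows "\<exists>\<zeta>. (\<forall>a\<in>carrier G. \<zeta> a \<noteq> 0) \<and> \<zeta> \<one> = 1 \<and>
    (\<forall>a\<in>carrier G. \<forall>b\<in>carrier G. \<zeta> (a \<otimes> b) = \<zeta> a * \<zeta> b * S a b) \<and>
    (\<forall>c g. (c, g) \<in> U0 \<longrightarrow> \<zeta> g = c)"
proof -
  define V where "V = (UNIV - {0::'k}) \<times> {\<one>}"
  interpret snd: group_hom E G snd
    using snd_hom by unfold_locales
  have "kernel E G snd = V" by (auto simp: kernel_def V_def carrier_E)
  then have V: "subgroup V E" using snd.subgroup_kernel by simp
  have pow: "(b, \<one>) [^]\<^bsub>E\<^esub> (n::nat) = (b ^ n, \<one>)" for b n
    by (induction n) (simp_all add: one_E mult_E unit)
  have div: "\<exists>b\<in>V. b [^]\<^bsub>E\<^esub> n = a" if a: "a \<in> V" and "n > 0" for a and n :: nat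
  proof -
    obtain c where c: "a = (c, \<one>)" "c \<noteq> 0" using a by (auto simp: V_def)
    obtain b where b: "b ^ n = c" using nth_root_exists[OF \<open>n > 0\<close>] by blast
    then have "(b, \<one>) \<in> V" using c \<open>n > 0\<close> by (auto simp: V_def)
    then show ?thesis using pow[of b n] b c by blast
  qed
  have tors: "\<exists>n>0. e [^]\<^bsub>E\<^esub> (n::nat) \<in> V" if e: "e \<in> carrier E" for e
  proof -
    have "snd (e [^]\<^bsub>E\<^esub> Coset.order G) = snd e [^] Coset.order G"
      using e by (rule snd.hom_nat_pow)
    also have "\<dots> = \<one>" using e by (intro pow_order_eq_1) (auto simp: carrier_E)
    finally have "e [^]\<^bsub>E\<^esub> Coset.order G \<in> V"
      using E.nat_pow_closed[OF e, of "Coset.order G"] by (auto simp: V_def carrier_E mem_Times_iff)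
    moreover have "Coset.order G > 0" using fin by (simp add: order_gt_0_iff_finite)
    ultimately show ?thesis by blast
  qed
  have "U0 \<inter> V = {\<one>\<^bsub>E\<^esub>}"
    using int subgroup.one_closed[OF U0] subgroup.one_closed[OF V] by (auto simp: V_def one_E)
  then obtain U where U: "subgroup U E" "U0 \<subseteq> U" "U \<inter> V = {\<one>\<^bsub>E\<^esub>}" "U <#>\<^bsub>E\<^esub> V = carrier E"
    using E.divisible_complement[OF V U0 _ div tors] by blast
  have ex: "\<exists>c. (c, g) \<in> U" if g: "g \<in> carrier G" for g
  proof -
    have "(1, g) \<in> U <#>\<^bsub>E\<^esub> V" using U(4) g by (simp add: carrier_E)
    then obtain c h v where u: "(c, h) \<in> U" and v: "(v, \<one>) \<in> V" and eq: "(1, g) = (c, h) \<otimes>\<^bsub>E\<^esub> (v, \<one>)"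
      by (auto simp: set_mult_def V_def)
    have "h \<in> carrier G" using subgroup.mem_carrier[OF U(1) u] by (simp add: carrier_E)
    then have "h = g" using eq by (simp add: mult_E)
    then show ?thesis using u by blast
  qed
  \<comment> \<open>Two elements of \<open>U\<close> over the same g have a quotient over the
    identity, that is, in U \<inter> V.\<close>
  have uniq: "c = d" if c: "(c, g) \<in> U" and d: "(d, g) \<in> U" for c d g
  proof -
    have cd: "(c, g) \<in> carrier E" "(d, g) \<in> carrier E" using c d subgroup.mem_carrier[OF U(1)] by auto
    let ?q = "(c, g) \<otimes>\<^bsub>E\<^esub> inv\<^bsub>E\<^esub> (d, g)"
    have qU: "?q \<in> U" using c d subgroup.m_closed[OF U(1)] subgroup.m_inv_closed[OF U(1)] by blast
    have "snd ?q = snd (c, g) \<otimes> inv snd (d, g)"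
      using cd by (simp only: snd.hom_mult snd.hom_inv E.inv_closed)
    then have "snd ?q = \<one>" using cd by (simp add: carrier_E)
    moreover have "?q \<in> carrier E" using cd by (simp only: E.m_closed E.inv_closed)
    ultimately have "?q \<in> V" by (cases ?q) (simp add: V_def carrier_E)
    then have "?q = \<one>\<^bsub>E\<^esub>" using U(3) qU by blast
    then have "(c, g) = (d, g)" using cd by (metis E.inv_closed E.inv_equality E.inv_inv)
    then show ?thesis by simp
  qed
  define \<zeta> where "\<zeta> g = (THE c. (c, g) \<in> U)" for g
  have \<zeta>_eq: "\<zeta> g = c" if "(c, g) \<in> U" for c g
    unfolding \<zeta>_def using that uniq by blast
  have \<zeta>_mem: "(\<zeta> g, g) \<in> U" if "g \<in> carrier G" for g using ex[OF that] \<zeta>_eq by blast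
  show ?thesis
  proof (intro exI[of _ \<zeta>] conjI ballI allI impI)
    show "\<zeta> a \<noteq> 0" if "a \<in> carrier G" for a
      using subgroup.mem_carrier[OF U(1) \<zeta>_mem[OF that]] by (simp add: carrier_E)
    show "\<zeta> \<one> = 1" using subgroup.one_closed[OF U(1)] by (intro \<zeta>_eq) (simp add: one_E)
    show "\<zeta> (a \<otimes> b) = \<zeta> a * \<zeta> b * S a b" if "a \<in> carrier G" "b \<in> carrier G" for a b
      using subgroup.m_closed[OF U(1) \<zeta>_mem[OF that(1)] \<zeta>_mem[OF that(2)]]
      by (intro \<zeta>_eq) (simp add: mult_E)
    show "\<zeta> g = c" if "(c, g) \<in> U0" for c g using that U(2) by (intro \<zeta>_eq) blast
  qed
qed

text \<open>The case of trivial \<open>U0\<close>: Ext(G, K^x) vanishes because K^x is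
  divisible.\<close>

lemma trivialization:
  obtains \<eta> where "\<And>a. a \<in> carrier G \<Longrightarrow> \<eta> a \<noteq> 0" "\<eta> \<one> = 1"
    "\<And>a b. a \<in> carrier G \<Longrightarrow> b \<in> carrier G \<Longrightarrow> S a b = \<eta> a * \<eta> b / \<eta> (a \<otimes> b)"
proof -
  obtain \<zeta> where \<zeta>: "\<forall>a\<in>carrier G. \<zeta> a \<noteq> 0" "\<zeta> \<one> = 1"
    "\<forall>a\<in>carrier G. \<forall>b\<in>carrier G. \<zeta> (a \<otimes> b) = \<zeta> a * \<zeta> b * S a b"
    using ex_trivialization[OF E.triv_subgroup] by (auto simp: one_E)
  then show thesis
    by (intro that[of "\<lambda>a. 1 / \<zeta> a"]) (use nonzero in simp_all)
qed

text \<open>Invariance of \<open>S\<close> lets \<open>T\<close> lift to the endomorphism \<phi>(c,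
  g) = (c, T g) of \<open>E\<close>. A complement containing the image of \<psi> = \<phi> - 1 is
  stable under \<phi>, and stability of the graph of \<zeta> is \<open>T\<close>-invariance of
  \<zeta>.\<close>

lemma invariant_trivialization:
  assumes T: "T \<in> hom G G"
    and inv: "\<And>a b. a \<in> carrier G \<Longrightarrow> b \<in> carrier G \<Longrightarrow> S (T a) (T b) = S a b"
  obtains \<eta> where "\<And>a. a \<in> carrier G \<Longrightarrow> \<eta> a \<noteq> 0" "\<eta> \<one> = 1"
    "\<And>a b. a \<in> carrier G \<Longrightarrow> b \<in> carrier G \<Longrightarrow> S a b = \<eta> a * \<eta> b / \<eta> (a \<otimes> b)"
    "\<And>a. a \<in> carrier G \<Longrightarrow> \<eta> (T a) = \<eta> a"
proof -
  have Tc: "T a \<in> carrier G" if "a \<in> carrier G" for a using that T by (rule hom_in_carrier[rotated])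
  define \<phi> where "\<phi> = (\<lambda>(c::'k, g). (c, T g))"
  have \<phi>: "\<phi> \<in> hom E E"
    by (auto simp: hom_def \<phi>_def carrier_E mult_E inv Tc hom_mult[OF T])
  define \<psi> where "\<psi> = (\<lambda>e. \<phi> e \<otimes>\<^bsub>E\<^esub> inv\<^bsub>E\<^esub> e)"
  have "(\<lambda>e. inv\<^bsub>E\<^esub> e) \<in> hom E E" by (simp add: hom_def E.inv_mult)
  then have "\<psi> \<in> hom E E" unfolding \<psi>_def by (rule E.hom_group_mult[OF \<phi>])
  then interpret \<psi>: group_hom E E \<psi> by unfold_locales
  interpret snd: group_hom E G snd using snd_hom by unfold_locales
  have sub: "subgroup (\<psi> ` carrier E) E" by (rule \<psi>.img_is_subgroup)
  \<comment> \<open>If \<psi>(e) lies over the identity, \<open>T\<close> fixes the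
    \<open>G\<close>-component of \<open>e\<close>. As \<phi> leaves the other component alone, it
    fixes \<open>e\<close>, and \<psi>(e) is the unit of \<open>E\<close>.\<close>
  have triv: "c = 1" if c: "(c, \<one>) \<in> \<psi> ` carrier E" for c
  proof -
    obtain e where e: "e \<in> carrier E" "(c, \<one>) = \<psi> e" using c by blast
    have \<phi>c: "\<phi> e \<in> carrier E" using hom_in_carrier[OF \<phi>] e by blast
    have "\<one> = snd (\<psi> e)" using e(2) by (metis snd_conv)
    also have "\<dots> = T (snd e) \<otimes> inv (snd e)"
      using e \<phi>c by (simp add: \<psi>_def \<phi>_def split_beta)
    finally have "T (snd e) = snd e"
      using e Tc[of "snd e"] by (metis inv_closed inv_equality inv_inv snd.hom_closed)
    then have "\<phi> e = e" by (cases e) (simp add: \<phi>_def)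
    then have "\<psi> e = \<one>\<^bsub>E\<^esub>" using e by (simp add: \<psi>_def)
    then show "c = 1" using e(2) by (simp add: one_E)
  qed
  obtain \<zeta> where \<zeta>: "\<forall>a\<in>carrier G. \<zeta> a \<noteq> 0" "\<zeta> \<one> = 1"
    "\<forall>a\<in>carrier G. \<forall>b\<in>carrier G. \<zeta> (a \<otimes> b) = \<zeta> a * \<zeta> b * S a b"
    "\<forall>c g. (c, g) \<in> \<psi> ` carrier E \<longrightarrow> \<zeta> g = c"
    using ex_trivialization[OF sub triv] by blast
  have "\<zeta> (T a) = \<zeta> a" if a: "a \<in> carrier G" for a
  proof -
    have ac: "(1, a) \<in> carrier E" using a by (simp add: carrier_E)
    obtain c g where cg: "\<psi> (1, a) = (c, g)" by fastforce
    have cgc: "(c, g) \<in> carrier E" using \<psi>.hom_closed[OF ac] cg by simp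
    then have g: "g \<in> carrier G" by (simp add: carrier_E)
    have "(c, g) \<otimes>\<^bsub>E\<^esub> (1, a) = \<phi> (1, a)"
      using ac hom_in_carrier[OF \<phi> ac] by (simp add: cg[symmetric] \<psi>_def E.m_assoc)
    then have "c * S g a = 1" "g \<otimes> a = T a" by (simp_all add: mult_E \<phi>_def)
    moreover have "\<zeta> g = c" using \<zeta>(4) cg ac by (metis image_eqI)
    ultimately have "\<zeta> (T a) = c * \<zeta> a * S g a" using \<zeta>(3) g a by metis
    then show ?thesis using \<open>c * S g a = 1\<close> by (simp add: mult_ac)
  qed
  with \<zeta> show thesis
    by (intro that[of "\<lambda>a. 1 / \<zeta> a"]) (use nonzero in simp_all)
qed

text \<open>Since \<zeta>(a T(a)) = \<zeta>(a) \<zeta>(T a) S(a, T a), the condition \<zeta>(a)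
  \<zeta>(T a) = 1 says that the graph of \<zeta> contains u(a) = (1, a)(1, T a). The hypothesis
  \<open>inv\<close> makes u a homomorphism, and \<open>triv\<close> makes its image meet the units
  trivially.\<close>

lemma anti_invariant_trivialization:
  assumes T: "T \<in> hom G G"
    and inv: "\<And>a b. a \<in> carrier G \<Longrightarrow> b \<in> carrier G \<Longrightarrow> S a b * S (T a) (T b) = 1"
    and triv: "\<And>a. a \<in> carrier G \<Longrightarrow> a \<otimes> T a = \<one> \<Longrightarrow> S a (T a) = 1"
  obtains \<eta> where "\<And>a. a \<in> carrier G \<Longrightarrow> \<eta> a \<noteq> 0" "\<eta> \<one> = 1"
    "\<And>a b. a \<in> carrier G \<Longrightarrow> b \<in> carrier G \<Longrightarrow> S a b = \<eta> a * \<eta> b / \<eta> (a \<otimes> b)"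
    "\<And>a. a \<in> carrier G \<Longrightarrow> \<eta> a * \<eta> (T a) = 1"
proof -
  have Tc: "T a \<in> carrier G" if "a \<in> carrier G" for a using that T by (rule hom_in_carrier[rotated])
  define u where "u = (\<lambda>g. (S g (T g), g \<otimes> T g))"
  have "u \<in> hom G E"
  proof (rule homI)
    fix g assume "g \<in> carrier G" then show "u g \<in> carrier E" using nonzero Tc by (simp add: u_def carrier_E)
  next
    fix g h assume g: "g \<in> carrier G" and h: "h \<in> carrier G"
    have u': "u a = (1, a) \<otimes>\<^bsub>E\<^esub> (1, T a)" for a by (simp add: u_def mult_E)
    have c: "(1, a) \<in> carrier E" if "a \<in> carrier G" for a using that by (simp add: carrier_E)
    \<comment> \<open>After regrouping, the two inner products contribute S(g, h) and S(T g, T h),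
      whose product is 1 by \<open>inv\<close>.\<close>
    have "u g \<otimes>\<^bsub>E\<^esub> u h = ((1, g) \<otimes>\<^bsub>E\<^esub> (1, h)) \<otimes>\<^bsub>E\<^esub> ((1, T g) \<otimes>\<^bsub>E\<^esub> (1, T h))"
      unfolding u' using c[OF g] c[OF h] c[OF Tc[OF g]] c[OF Tc[OF h]] by (simp add: E.m_ac)
    also have "\<dots> = u (g \<otimes> h)"
      using g h inv[OF g h] by (simp add: mult_E u_def hom_mult[OF T])
    finally show "u (g \<otimes> h) = u g \<otimes>\<^bsub>E\<^esub> u h" by simp
  qed
  then interpret u: group_hom G E u by unfold_locales
  have sub: "subgroup (u ` carrier G) E" by (rule u.img_is_subgroup)
  have triv': "c = 1" if "(c, \<one>) \<in> u ` carrier G" for c using that triv by (auto simp: u_def)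
  obtain \<zeta> where \<zeta>: "\<forall>a\<in>carrier G. \<zeta> a \<noteq> 0" "\<zeta> \<one> = 1"
    "\<forall>a\<in>carrier G. \<forall>b\<in>carrier G. \<zeta> (a \<otimes> b) = \<zeta> a * \<zeta> b * S a b"
    "\<forall>c g. (c, g) \<in> u ` carrier G \<longrightarrow> \<zeta> g = c"
    using ex_trivialization[OF sub triv'] by blast
  have "\<zeta> a * \<zeta> (T a) = 1" if a: "a \<in> carrier G" for a
  proof -
    have "\<zeta> (a \<otimes> T a) = S a (T a)" using \<zeta>(4) a by (metis image_eqI u_def)
    then show ?thesis using \<zeta>(3) Tc[OF a] a nonzero[OF a Tc[OF a]] by simp
  qed
  with \<zeta> show thesis
    by (intro that[of "\<lambda>a. 1 / \<zeta> a"]) (use nonzero in simp_all)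
qed

end

section \<open>Actions of a finite cyclic group\<close>

locale cyclic_action = C: group C + G: comm_group G
  for C :: "('c, 'r) monoid_scheme" and G :: "('g, 's) monoid_scheme" (structure) +
  fixes t :: 'c and act :: "'g \<Rightarrow> 'c \<Rightarrow> 'g" and p :: nat and K :: "'k::alg_closed_field monoid"
  assumes K: "K = unit_group"
    and order_C: "Coset.order C = p" and p_pos: "p > 0"
    and t: "t \<in> carrier C" and gen: "carrier C = generate C {t}"
    and finite_G: "finite (carrier G)"
    and action: "right_aut_action C G act"
begin

lemma carrier_K [simp]: "carrier K = UNIV - {0}"
  and mult_K [simp]: "x \<otimes>\<^bsub>K\<^esub> y = x * y"
  and one_K [simp]: "\<one>\<^bsub>K\<^esub> = 1"
  by (simp_all add: K ring_of_type_algebra_def)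

lemma comm_group_K: "comm_group K"
proof (rule comm_groupI)
  fix x assume "x \<in> carrier K"
  then show "\<exists>y\<in>carrier K. y \<otimes>\<^bsub>K\<^esub> x = \<one>\<^bsub>K\<^esub>" by (intro bexI[of _ "inverse x"]) auto
qed auto

sublocale K: comm_group K by (rule comm_group_K)

lemma inv_K [simp]: "x \<noteq> 0 \<Longrightarrow> inv\<^bsub>K\<^esub> x = inverse x"
  by (rule K.inv_equality) auto

lemma finite_C: "finite (carrier C)"
  using order_C p_pos by (metis C.order_gt_0_iff_finite)

lemma C_cyclic: "x \<in> carrier C \<Longrightarrow> \<exists>i. x = t [^]\<^bsub>C\<^esub> (i::nat)"
  using C.generate_pow_on_finite_carrier[OF finite_C t] gen by auto

lemma comm_C: "x \<in> carrier C \<Longrightarrow> y \<in> carrier C \<Longrightarrow> x \<otimes>\<^bsub>C\<^esub> y = y \<otimes>\<^bsub>C\<^esub> x"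
  using C_cyclic[of x] C_cyclic[of y] t by (metis C.nat_pow_mult add.commute)

lemma t_pow_p: "t [^]\<^bsub>C\<^esub> p = \<one>\<^bsub>C\<^esub>"
  using C.pow_order_eq_1[OF t] order_C by simp

lemma t_pow_closed [simp]: "t [^]\<^bsub>C\<^esub> (i::nat) \<in> carrier C"
  using t by simp

lemma ord_t: "C.ord t = p"
  using C.generate_pow_card[OF t] gen order_C by (simp add: Coset.order_def)

lemma t_pow_eq_imp: "t [^]\<^bsub>C\<^esub> i = t [^]\<^bsub>C\<^esub> j \<Longrightarrow> i mod p = j mod p" for i j :: nat
  using C.int_pow_eq[OF t, of "int i" "int j"] ord_t
  by (simp add: int_pow_int mod_eq_dvd_iff[symmetric] flip: of_nat_mod)

text \<open>Functions on \<open>C\<close> are built below as functions of an exponent of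
  \<open>t\<close>. Period p is what makes them depend only on the power of
  \<open>t\<close>.\<close>

lemma periodic_cong:
  fixes f :: "nat \<Rightarrow> 'x"
  assumes period: "\<And>i. f (i + p) = f i" and eq: "t [^]\<^bsub>C\<^esub> i = t [^]\<^bsub>C\<^esub> j"
  shows "f i = f j"
proof -
  have per: "f (i + k * p) = f i" for i k
    by (induction k) (use period in \<open>simp_all add: add.assoc[symmetric] add.commute[of p]\<close>)
  have "f i = f (i mod p)" "f j = f (j mod p)"
    using per[of "i mod p" "i div p"] per[of "j mod p" "j div p"] by simp_all
  then show ?thesis using t_pow_eq_imp[OF eq] by simp
qed

text \<open>The choice of the least exponent gives the identity the exponent 0, so products over
  \<open>j < dlog x\<close> are automatically normalized.\<close>

definition dlog :: "'c \<Rightarrow> nat" where "dlog x = (LEAST i. t [^]\<^bsub>C\<^esub> i = x)"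

lemma t_pow_dlog: "x \<in> carrier C \<Longrightarrow> t [^]\<^bsub>C\<^esub> dlog x = x"
  unfolding dlog_def by (rule LeastI_ex) (metis C_cyclic)

lemma dlog_one: "dlog \<one>\<^bsub>C\<^esub> = 0"
  unfolding dlog_def by (rule Least_equality) auto

lemma act_iso: "x \<in> carrier C \<Longrightarrow> (\<lambda>a. act a x) \<in> iso G G"
  and act_unit: "a \<in> carrier G \<Longrightarrow> act a \<one>\<^bsub>C\<^esub> = a"
  and act_comp: "\<lbrakk>x \<in> carrier C; y \<in> carrier C; a \<in> carrier G\<rbrakk> \<Longrightarrow> act a (x \<otimes>\<^bsub>C\<^esub> y) = act (act a x) y"
  using action unfolding right_aut_action_def by auto

lemma act_hom: "x \<in> carrier C \<Longrightarrow> (\<lambda>a. act a x) \<in> hom G G"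
  using act_iso by (auto simp: iso_def)

lemma act_closed [simp]: "x \<in> carrier C \<Longrightarrow> a \<in> carrier G \<Longrightarrow> act a x \<in> carrier G"
  using hom_in_carrier[OF act_hom] .

lemma act_mult: "\<lbrakk>x \<in> carrier C; a \<in> carrier G; b \<in> carrier G\<rbrakk> \<Longrightarrow> act (a \<otimes> b) x = act a x \<otimes> act b x"
  using hom_mult[OF act_hom] .

lemma act_one [simp]: "x \<in> carrier C \<Longrightarrow> act \<one> x = \<one>"
  using hom_one[OF act_hom] by simp

lemma act_swap: "\<lbrakk>x \<in> carrier C; y \<in> carrier C; a \<in> carrier G\<rbrakk> \<Longrightarrow> act (act a x) y = act (act a y) x"
  using act_comp[of x y a] act_comp[of y x a] comm_C by simp

lemma act_inv_right: "\<lbrakk>x \<in> carrier C; a \<in> carrier G\<rbrakk> \<Longrightarrow> act (act a x) (inv\<^bsub>C\<^esub> x) = a"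
  using act_comp[of x "inv\<^bsub>C\<^esub> x" a] act_unit by simp

lemma act_t_pow_Suc: "a \<in> carrier G \<Longrightarrow> act a (t [^]\<^bsub>C\<^esub> Suc i) = act (act a (t [^]\<^bsub>C\<^esub> i)) t"
  using act_comp[of "t [^]\<^bsub>C\<^esub> i" t a] t by simp

section \<open>Vanishing of the second cohomology of C with values in functions on G\<close>

definition cochain :: "('c \<Rightarrow> 'g \<Rightarrow> 'k) \<Rightarrow> bool" where
  "cochain \<eta> \<longleftrightarrow> (\<forall>x\<in>carrier C. \<forall>a\<in>carrier G. \<eta> x a \<noteq> 0) \<and>
     (\<forall>a\<in>carrier G. \<eta> \<one>\<^bsub>C\<^esub> a = 1) \<and> (\<forall>x\<in>carrier C. \<eta> x \<one> = 1)"

lemma cochain_nz: "cochain \<eta> \<Longrightarrow> x \<in> carrier C \<Longrightarrow> a \<in> carrier G \<Longrightarrow> \<eta> x a \<noteq> 0"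
  by (simp add: cochain_def)

text \<open>Since the \<open>p\<close>-th power map is surjective on the units, every invariant function \<open>m\<close> is the
  norm of an invariant function, namely of a pointwise root of \<open>m\<close>.\<close>

definition rt :: "'k \<Rightarrow> 'k" where
  "rt c = (if c = 1 then 1 else SOME r. r ^ p = c)"

lemma rt_pow: "rt c ^ p = c"
  using someI_ex[OF nth_root_exists[OF p_pos, of c]] by (auto simp: rt_def)

text \<open>The separate clause for 1 in \<open>rt\<close> serves this purpose: roots of normalized
  functions stay normalized.\<close>

lemma rt_one [simp]: "rt 1 = 1" by (simp add: rt_def)

lemma rt_nz: "c \<noteq> 0 \<Longrightarrow> rt c \<noteq> 0"
  using rt_pow[of c] p_pos by (auto simp: zero_power)

text \<open>With \<eta>(t) = r invariant, the equation at (t^i, t) forces \<eta>(t^i) = r^i / P_i,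
  where P_i is the product of F(t^j, t) over j < i. Consistency at t^p = 1 asks for r^p = P_p. The
  pointwise root r = rt(P_p) is invariant because P_p is.\<close>

lemma cochain_cocycle_trivial:
  assumes nz: "\<And>x y a. \<lbrakk>x \<in> carrier C; y \<in> carrier C; a \<in> carrier G\<rbrakk> \<Longrightarrow> F x y a \<noteq> 0"
    and one1: "\<And>y a. \<lbrakk>y \<in> carrier C; a \<in> carrier G\<rbrakk> \<Longrightarrow> F \<one>\<^bsub>C\<^esub> y a = 1"
    and one2: "\<And>x a. \<lbrakk>x \<in> carrier C; a \<in> carrier G\<rbrakk> \<Longrightarrow> F x \<one>\<^bsub>C\<^esub> a = 1"
    and one3: "\<And>x y. \<lbrakk>x \<in> carrier C; y \<in> carrier C\<rbrakk> \<Longrightarrow> F x y \<one> = 1"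
    and coc: "\<And>x y z a. \<lbrakk>x \<in> carrier C; y \<in> carrier C; z \<in> carrier C; a \<in> carrier G\<rbrakk> \<Longrightarrow>
      F y z (act a x) * F x (y \<otimes>\<^bsub>C\<^esub> z) a = F (x \<otimes>\<^bsub>C\<^esub> y) z a * F x y a"
  obtains \<eta> where "cochain \<eta>"
    "\<And>x y a. \<lbrakk>x \<in> carrier C; y \<in> carrier C; a \<in> carrier G\<rbrakk> \<Longrightarrow>
      F x y a = \<eta> y (act a x) * \<eta> x a / \<eta> (x \<otimes>\<^bsub>C\<^esub> y) a"
proof -
  define P where "P i a = (\<Prod>j<i. F (t [^]\<^bsub>C\<^esub> j) t a)" for i :: nat and a
  have Pnz: "P i a \<noteq> 0" if "a \<in> carrier G" for i a using that nz t by (simp add: P_def)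
  have t_Suc: "t [^]\<^bsub>C\<^esub> Suc i = t \<otimes>\<^bsub>C\<^esub> t [^]\<^bsub>C\<^esub> i" for i
    using C.nat_pow_Suc2[OF t] by simp
  have inv: "P p (act a t) = P p a" if a: "a \<in> carrier G" for a
  proof -
    have at: "act a t \<in> carrier G" using a t by simp
    define f where "f j = F t (t [^]\<^bsub>C\<^esub> j) a" for j :: nat
    define h where "h j = F (t [^]\<^bsub>C\<^esub> j) t a" for j :: nat
    have shift: "(\<Prod>j<p. k (Suc j)) = (\<Prod>j<p. k j)" if "k p = k 0" for k :: "nat \<Rightarrow> 'k"
    proof -
      obtain n where n: "p = Suc n" using p_pos gr0_implies_Suc by blast
      show ?thesis using that unfolding n
        by (simp only: prod.lessThan_Suc[of "\<lambda>j. k (Suc j)"] prod.lessThan_Suc_shift[of k] n mult.commute)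
    qed
    \<comment> \<open>The cocycle identity at (t, t^j, t), multiplied over j < p. Passing from j to
      j + 1 permutes the exponents cyclically, so the products of f on the two sides agree and
      cancel.\<close>
    have "P p (act a t) * (\<Prod>j<p. f (Suc j)) = (\<Prod>j<p. h (Suc j)) * (\<Prod>j<p. f j)"
      unfolding P_def prod.distrib[symmetric] f_def h_def
    proof (rule prod.cong)
      fix j
      show "F (t [^]\<^bsub>C\<^esub> j) t (act a t) * F t (t [^]\<^bsub>C\<^esub> Suc j) a =
          F (t [^]\<^bsub>C\<^esub> Suc j) t a * F t (t [^]\<^bsub>C\<^esub> j) a"
        using coc[of t "t [^]\<^bsub>C\<^esub> j" t a] a t t_Suc[of j] by simp
    qed simp
    moreover have "f p = f 0" "h p = h 0" by (simp_all add: f_def h_def t_pow_p)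
    ultimately have "P p (act a t) * (\<Prod>j<p. f j) = (\<Prod>j<p. h j) * (\<Prod>j<p. f j)"
      using shift by simp
    moreover have "(\<Prod>j<p. f j) \<noteq> 0" using nz a t by (simp add: f_def)
    ultimately show ?thesis by (simp add: P_def h_def)
  qed
  define \<psi> where "\<psi> i a = rt (P p a) ^ i / P i a" for i a
  have \<psi>_period: "\<psi> (i + p) a = \<psi> i a" if "a \<in> carrier G" for i a
  proof -
    have "P (i + p) a = P i a * P p a"
    proof (induction i)
      case (Suc i)
      have "t [^]\<^bsub>C\<^esub> (i + p) = t [^]\<^bsub>C\<^esub> i" using t by (simp add: C.nat_pow_mult[symmetric] t_pow_p)
      then show ?case using Suc by (simp add: P_def)
    qed (simp add: P_def)
    then show ?thesis using Pnz[OF that] by (simp add: \<psi>_def power_add rt_pow)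
  qed
  have \<psi>_cong: "\<psi> i a = \<psi> j a" if a: "a \<in> carrier G" and eq: "t [^]\<^bsub>C\<^esub> i = t [^]\<^bsub>C\<^esub> j" for i j a
  proof -
    show ?thesis by (rule periodic_cong[of "\<lambda>i. \<psi> i a"]) (use \<psi>_period[OF a] eq in simp_all)
  qed
  define \<eta> where "\<eta> x a = \<psi> (dlog x) a" for x a
  have \<eta>_pow: "\<eta> (t [^]\<^bsub>C\<^esub> i) a = \<psi> i a" if "a \<in> carrier G" for i a
    unfolding \<eta>_def using that t_pow_dlog by (intro \<psi>_cong) auto
  have \<psi>_Suc: "\<psi> (Suc i) a = \<psi> i a * rt (P p a) / F (t [^]\<^bsub>C\<^esub> i) t a" for i a
    by (simp add: \<psi>_def P_def)
  have \<psi>_nz: "\<psi> i a \<noteq> 0" if "a \<in> carrier G" for i a using that Pnz rt_nz by (simp add: \<psi>_def)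
  show thesis
  proof (rule that[of \<eta>])
    have "\<psi> i \<one> = 1" for i using one3 t by (simp add: \<psi>_def P_def)
    moreover have "\<psi> 0 a = 1" for a by (simp add: \<psi>_def P_def)
    ultimately show "cochain \<eta>" using \<psi>_nz by (simp add: cochain_def \<eta>_def dlog_one)
  next
    \<comment> \<open>The definition of \<psi> settles the pairs (t^i, t); the cocycle identity at
      (t^i, t^j, t) carries the formula from j to j + 1.\<close>
    have "F (t [^]\<^bsub>C\<^esub> i) (t [^]\<^bsub>C\<^esub> j) a = \<psi> j (act a (t [^]\<^bsub>C\<^esub> i)) * \<psi> i a / \<psi> (i + j) a"
      if a: "a \<in> carrier G" for i j a
    proof (induction j)
      case 0
      then show ?case using \<psi>_nz[OF a] one2 a by (simp add: \<psi>_def P_def)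
    next
      case (Suc j)
      define b where "b = act a (t [^]\<^bsub>C\<^esub> i)"
      have b: "b \<in> carrier G" using a by (simp add: b_def)
      \<comment> \<open>P_p is constant on orbits, so the chosen root is the same at
        \<open>a\<close> and at \<open>b\<close>.\<close>
      have Pb: "P p b = P p a" unfolding b_def
      proof (induction i)
        case 0 then show ?case using a act_unit by simp
      next
        case (Suc i) then show ?case using inv[of "act a (t [^]\<^bsub>C\<^esub> i)"] a act_t_pow_Suc[of a i] by simp
      qed
      have "F (t [^]\<^bsub>C\<^esub> j) t b * F (t [^]\<^bsub>C\<^esub> i) (t [^]\<^bsub>C\<^esub> Suc j) a =
          F (t [^]\<^bsub>C\<^esub> (i + j)) t a * F (t [^]\<^bsub>C\<^esub> i) (t [^]\<^bsub>C\<^esub> j) a"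
        using coc[of "t [^]\<^bsub>C\<^esub> i" "t [^]\<^bsub>C\<^esub> j" t a] a t by (simp add: b_def C.nat_pow_mult)
      then have "F (t [^]\<^bsub>C\<^esub> i) (t [^]\<^bsub>C\<^esub> Suc j) a =
          F (t [^]\<^bsub>C\<^esub> (i + j)) t a * (\<psi> j b * \<psi> i a / \<psi> (i + j) a) / F (t [^]\<^bsub>C\<^esub> j) t b"
        using nz[of "t [^]\<^bsub>C\<^esub> j" t b] b t Suc unfolding b_def
        by (metis nonzero_mult_div_cancel_left t_pow_closed)
      also have "\<dots> = \<psi> (Suc j) b * \<psi> i a / \<psi> (i + Suc j) a"
        using nz[of "t [^]\<^bsub>C\<^esub> j" t b] nz[of "t [^]\<^bsub>C\<^esub> (i + j)" t a] a b t \<psi>_nz[OF a] rt_nz[OF Pnz[OF a]]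
        by (simp add: \<psi>_Suc Pb field_simps)
      finally show ?case by (simp only: b_def)
    qed
    then show "F x y a = \<eta> y (act a x) * \<eta> x a / \<eta> (x \<otimes>\<^bsub>C\<^esub> y) a"
      if "x \<in> carrier C" "y \<in> carrier C" "a \<in> carrier G" for x y a
      using that C_cyclic[of x] C_cyclic[of y] t
      by (auto simp: \<eta>_pow C.nat_pow_mult)
  qed
qed

end

section \<open>Cocycles and coboundaries\<close>

lemma mult_eq_mult_interchange:
  fixes a b c d :: "'a::ab_semigroup_mult"
  assumes "a * b = c * d" "a' * b' = c' * d'"
  shows "(a * a') * (b * b') = (c * c') * (d * d')"
proof -
  have "(a * a') * (b * b') = (a * b) * (a' * b')" by (simp add: ac_simps)
  then show ?thesis using assms by (simp add: ac_simps)
qed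

context cyclic_action begin

section \<open>The character group as a module\<close>

lemma subgroup_dual: "subgroup (hom G K \<inter> extensional (carrier G)) (fun_group (carrier G) K)"
proof (rule group.subgroupI)
  show "group (fun_group (carrier G) K)" by (simp add: K.is_group)
  show "hom G K \<inter> extensional (carrier G) \<subseteq> carrier (fun_group (carrier G) K)"
    by (simp add: PiE_def hom_def Pi_iff subset_iff)
  have "(\<lambda>a\<in>carrier G. 1) \<in> hom G K \<inter> extensional (carrier G)" by (auto simp: hom_def)
  then show "hom G K \<inter> extensional (carrier G) \<noteq> {}" by blast
next
  fix f assume f: "f \<in> hom G K \<inter> extensional (carrier G)"
  then have "f \<in> carrier (fun_group (carrier G) K)" by (auto simp: PiE_iff hom_def Pi_iff)
  then have "inv\<^bsub>fun_group (carrier G) K\<^esub> f = (\<lambda>a\<in>carrier G. inv\<^bsub>K\<^esub> f a)" by (simp add: K.is_group)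
  also have "\<dots> \<in> hom G K \<inter> extensional (carrier G)"
    using f by (auto simp: hom_def Pi_iff)
  finally show "inv\<^bsub>fun_group (carrier G) K\<^esub> f \<in> hom G K \<inter> extensional (carrier G)" .
next
  fix f g assume "f \<in> hom G K \<inter> extensional (carrier G)" "g \<in> hom G K \<inter> extensional (carrier G)"
  then show "f \<otimes>\<^bsub>fun_group (carrier G) K\<^esub> g \<in> hom G K \<inter> extensional (carrier G)"
    by (auto simp: hom_def Pi_iff)
qed

lemma dual_iff: "\<chi> \<in> carrier (dual_group G K) \<longleftrightarrow> \<chi> \<in> extensional (carrier G) \<and>
    (\<forall>a\<in>carrier G. \<chi> a \<noteq> 0) \<and> (\<forall>a\<in>carrier G. \<forall>b\<in>carrier G. \<chi> (a \<otimes> b) = \<chi> a * \<chi> b)"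
  by (auto simp: dual_group_def hom_def Pi_iff)

lemma mult_dual: "\<chi> \<otimes>\<^bsub>dual_group G K\<^esub> \<psi> = (\<lambda>a\<in>carrier G. \<chi> a * \<psi> a)"
  and one_dual: "\<one>\<^bsub>dual_group G K\<^esub> = (\<lambda>a\<in>carrier G. 1)"
  by (simp_all add: dual_group_def)

lemma inv_dual: "\<chi> \<in> carrier (dual_group G K) \<Longrightarrow> inv\<^bsub>dual_group G K\<^esub> \<chi> = (\<lambda>a\<in>carrier G. inverse (\<chi> a))"
proof -
  assume \<chi>: "\<chi> \<in> carrier (dual_group G K)"
  then have \<chi>': "\<chi> \<in> hom G K \<inter> extensional (carrier G)" by (simp add: dual_group_def)
  have "inv\<^bsub>dual_group G K\<^esub> \<chi> = inv\<^bsub>fun_group (carrier G) K\<^esub> \<chi>" unfolding dual_group_def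
    using group.m_inv_consistent[OF _ subgroup_dual \<chi>'] by (simp add: K.is_group)
  also have "\<dots> = (\<lambda>a\<in>carrier G. inv\<^bsub>K\<^esub> \<chi> a)"
    using \<chi>' by (subst inv_product_group) (auto simp: PiE_iff hom_def Pi_iff K.is_group)
  also have "\<dots> = (\<lambda>a\<in>carrier G. inverse (\<chi> a))"
    using \<chi> dual_iff by (intro restrict_ext) auto
  finally show ?thesis .
qed

lemma comm_group_dual: "comm_group (dual_group G K)"
  unfolding dual_group_def
  using group.subgroup_of_comm_group[OF _ comm_group_fun_group[OF comm_group_K] subgroup_dual]
  by (simp add: K.is_group)

sublocale dual: group_module C "dual_group G K" "dual_act G act"
proof -
  interpret D: comm_group "dual_group G K" by (rule comm_group_dual)
  show "group_module C (dual_group G K) (dual_act G act)"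
  proof
    show "dual_act G act x \<in> hom (dual_group G K) (dual_group G K)" if "x \<in> carrier C" for x
      using that by (auto simp: hom_def dual_iff mult_dual dual_act_def act_mult intro!: restrict_ext)
  next
    fix x y \<chi> assume "x \<in> carrier C" "y \<in> carrier C" "\<chi> \<in> carrier (dual_group G K)"
    then show "dual_act G act (x \<otimes>\<^bsub>C\<^esub> y) \<chi> = dual_act G act x (dual_act G act y \<chi>)"
      by (auto simp: dual_act_def act_comp intro!: restrict_ext)
  next
    fix \<chi> assume "\<chi> \<in> carrier (dual_group G K)"
    then show "dual_act G act \<one>\<^bsub>C\<^esub> \<chi> = \<chi>"
      by (auto simp: dual_act_def act_unit fun_eq_iff dual_iff extensional_def)
  qed
qed

sublocale mult: group_module G K "\<lambda>_ u. u"
  by unfold_locales (auto simp: hom_def)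

section \<open>Cocycles, fibrewise coboundaries and coboundaries relative to the action\<close>

abbreviation "cells \<equiv> carrier C \<times> carrier G \<times> carrier G"
abbreviation "cochains_c \<equiv> fun_group cells K"
abbreviation "cocycles_c \<equiv> cochains_c\<lparr>carrier := Z2c C G act K\<rparr>"

lemma Z2c_iff: "\<tau> \<in> Z2c C G act K \<longleftrightarrow> \<tau> \<in> extensional cells \<and>
     (\<forall>x\<in>carrier C. \<forall>a\<in>carrier G. \<forall>b\<in>carrier G. \<tau> (x, a, b) \<noteq> 0) \<and>
     (\<forall>a\<in>carrier G. \<forall>b\<in>carrier G. \<tau> (\<one>\<^bsub>C\<^esub>, a, b) = 1) \<and>
     (\<forall>x\<in>carrier C. \<forall>a\<in>carrier G. \<tau> (x, \<one>, a) = 1 \<and> \<tau> (x, a, \<one>) = 1) \<and>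
     (\<forall>x\<in>carrier C. \<forall>a\<in>carrier G. \<forall>b\<in>carrier G. \<forall>c\<in>carrier G.
        \<tau> (x, a, b \<otimes> c) * \<tau> (x, b, c) = \<tau> (x, a \<otimes> b, c) * \<tau> (x, a, b)) \<and>
     (\<forall>x\<in>carrier C. \<forall>y\<in>carrier C. \<forall>a\<in>carrier G. \<forall>b\<in>carrier G.
        \<tau> (x \<otimes>\<^bsub>C\<^esub> y, a, b) = \<tau> (x, a, b) * \<tau> (y, act a x, act b x))"
proof -
  have "\<tau> \<in> carrier cochains_c \<longleftrightarrow> \<tau> \<in> extensional cells \<and>
     (\<forall>x\<in>carrier C. \<forall>a\<in>carrier G. \<forall>b\<in>carrier G. \<tau> (x, a, b) \<noteq> 0)"
    by (simp add: PiE_iff conj_commute)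
  then show ?thesis unfolding Z2c_def mem_Collect_eq mult_K one_K by (simp only: conj_assoc)
qed

lemma inv_cochains_c: "f \<in> carrier cochains_c \<Longrightarrow> inv\<^bsub>cochains_c\<^esub> f = (\<lambda>i\<in>cells. inverse (f i))"
  by (subst inv_product_group) (auto simp: K.is_group PiE_iff Pi_iff intro!: restrict_ext)

lemma
  assumes "\<tau> \<in> Z2c C G act K"
  shows Z2c_ext: "\<tau> \<in> extensional cells"
    and Z2c_nz: "\<lbrakk>x \<in> carrier C; a \<in> carrier G; b \<in> carrier G\<rbrakk> \<Longrightarrow> \<tau> (x, a, b) \<noteq> 0"
    and Z2c_unit: "\<lbrakk>a \<in> carrier G; b \<in> carrier G\<rbrakk> \<Longrightarrow> \<tau> (\<one>\<^bsub>C\<^esub>, a, b) = 1"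
      "\<lbrakk>x \<in> carrier C; a \<in> carrier G\<rbrakk> \<Longrightarrow> \<tau> (x, \<one>, a) = 1"
      "\<lbrakk>x \<in> carrier C; a \<in> carrier G\<rbrakk> \<Longrightarrow> \<tau> (x, a, \<one>) = 1"
    and Z2c_cocycle: "\<lbrakk>x \<in> carrier C; a \<in> carrier G; b \<in> carrier G; c \<in> carrier G\<rbrakk> \<Longrightarrow>
        \<tau> (x, a, b \<otimes> c) * \<tau> (x, b, c) = \<tau> (x, a \<otimes> b, c) * \<tau> (x, a, b)"
    and Z2c_mult: "\<lbrakk>x \<in> carrier C; y \<in> carrier C; a \<in> carrier G; b \<in> carrier G\<rbrakk> \<Longrightarrow>
        \<tau> (x \<otimes>\<^bsub>C\<^esub> y, a, b) = \<tau> (x, a, b) * \<tau> (y, act a x, act b x)"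
  using assms unfolding Z2c_iff by blast+

lemma subgroup_Z2c: "subgroup (Z2c C G act K) cochains_c"
proof (rule group.subgroupI)
  show "group cochains_c" by (simp add: K.is_group)
  show "Z2c C G act K \<subseteq> carrier cochains_c" by (auto simp: Z2c_def)
  have "(\<lambda>i\<in>cells. 1) \<in> Z2c C G act K" by (auto simp: Z2c_iff)
  then show "Z2c C G act K \<noteq> {}" by blast
next
  fix f assume f: "f \<in> Z2c C G act K"
  then have "inv\<^bsub>cochains_c\<^esub> f = (\<lambda>i\<in>cells. inverse (f i))"
    by (intro inv_cochains_c) (simp add: Z2c_def)
  also have "\<dots> \<in> Z2c C G act K"
    unfolding Z2c_iff
  proof (intro conjI ballI)
    fix x a b c assume "x \<in> carrier C" "a \<in> carrier G" "b \<in> carrier G" "c \<in> carrier G"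
    with Z2c_cocycle[OF f this]
    show "(\<lambda>i\<in>cells. inverse (f i)) (x, a, b \<otimes> c) * (\<lambda>i\<in>cells. inverse (f i)) (x, b, c) =
      (\<lambda>i\<in>cells. inverse (f i)) (x, a \<otimes> b, c) * (\<lambda>i\<in>cells. inverse (f i)) (x, a, b)"
      by (simp flip: inverse_mult_distrib)
  qed (simp_all add: Z2c_nz[OF f] Z2c_unit[OF f] Z2c_mult[OF f])
  finally show "inv\<^bsub>cochains_c\<^esub> f \<in> Z2c C G act K" .
next
  fix f g assume f: "f \<in> Z2c C G act K" and g: "g \<in> Z2c C G act K"
  show "f \<otimes>\<^bsub>cochains_c\<^esub> g \<in> Z2c C G act K" unfolding Z2c_iff
  proof (intro conjI ballI)
    fix x a b c assume c: "x \<in> carrier C" "a \<in> carrier G" "b \<in> carrier G" "c \<in> carrier G"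
    show "(f \<otimes>\<^bsub>cochains_c\<^esub> g) (x, a, b \<otimes> c) * (f \<otimes>\<^bsub>cochains_c\<^esub> g) (x, b, c) =
      (f \<otimes>\<^bsub>cochains_c\<^esub> g) (x, a \<otimes> b, c) * (f \<otimes>\<^bsub>cochains_c\<^esub> g) (x, a, b)"
      using c mult_eq_mult_interchange[OF Z2c_cocycle[OF f c] Z2c_cocycle[OF g c]] by simp
  qed (simp_all add: Z2c_nz[OF f] Z2c_unit[OF f] Z2c_mult[OF f] Z2c_nz[OF g] Z2c_unit[OF g] Z2c_mult[OF g])
qed

lemma comm_group_cocycles_c: "comm_group cocycles_c"
  using group.subgroup_of_comm_group[OF _ comm_group_fun_group[OF comm_group_K] subgroup_Z2c]
  by (simp add: K.is_group)

lemma inv_cocycles_c: "f \<in> Z2c C G act K \<Longrightarrow> inv\<^bsub>cocycles_c\<^esub> f = (\<lambda>i\<in>cells. inverse (f i))"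
  using group.m_inv_consistent[OF _ subgroup_Z2c] inv_cochains_c[of f] subgroup.subset[OF subgroup_Z2c]
  by (simp add: K.is_group subset_iff)

definition delta_G :: "('c \<Rightarrow> 'g \<Rightarrow> 'k) \<Rightarrow> 'c \<times> 'g \<times> 'g \<Rightarrow> 'k" where
  "delta_G \<eta> = (\<lambda>(x, a, b)\<in>cells. \<eta> x a * \<eta> x b / \<eta> x (a \<otimes> b))"

lemma delta_G_apply: "\<lbrakk>x \<in> carrier C; a \<in> carrier G; b \<in> carrier G\<rbrakk> \<Longrightarrow>
    delta_G \<eta> (x, a, b) = \<eta> x a * \<eta> x b / \<eta> x (a \<otimes> b)"
  by (simp add: delta_G_def)

lemma delta_G_mult: "delta_G (\<lambda>x a. \<eta> x a * \<eta>' x a) = delta_G \<eta> \<otimes>\<^bsub>cochains_c\<^esub> delta_G \<eta>'"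
  by (auto simp: delta_G_def fun_eq_iff)

lemma delta_G_inverse: "delta_G (\<lambda>x a. inverse (\<eta> x a)) = (\<lambda>i\<in>cells. inverse (delta_G \<eta> i))"
  by (auto simp: delta_G_def fun_eq_iff field_simps)

lemma cochain_mult: "cochain \<eta> \<Longrightarrow> cochain \<eta>' \<Longrightarrow> cochain (\<lambda>x a. \<eta> x a * \<eta>' x a)"
  and cochain_inverse: "cochain \<eta> \<Longrightarrow> cochain (\<lambda>x a. inverse (\<eta> x a))"
  by (simp_all add: cochain_def)

text \<open>The cocycle identity in \<open>G\<close> holds for every delta_G \<eta>; only
  multiplicativity in \<open>C\<close> is a condition.\<close>

lemma delta_G_Z2c:
  assumes \<eta>: "cochain \<eta>"
    and mult: "\<And>x y a b. \<lbrakk>x \<in> carrier C; y \<in> carrier C; a \<in> carrier G; b \<in> carrier G\<rbrakk> \<Longrightarrow>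
      delta_G \<eta> (x \<otimes>\<^bsub>C\<^esub> y, a, b) = delta_G \<eta> (x, a, b) * delta_G \<eta> (y, act a x, act b x)"
  shows "delta_G \<eta> \<in> Z2c C G act K"
  unfolding Z2c_iff
proof (intro conjI ballI)
  show "delta_G \<eta> \<in> extensional cells" by (simp add: delta_G_def)
  fix x a b c assume x: "x \<in> carrier C" and a: "a \<in> carrier G" and b: "b \<in> carrier G" and c: "c \<in> carrier G"
  show "delta_G \<eta> (x, a, b \<otimes> c) * delta_G \<eta> (x, b, c) = delta_G \<eta> (x, a \<otimes> b, c) * delta_G \<eta> (x, a, b)"
    using x a b c cochain_nz[OF \<eta> x] by (simp add: delta_G_apply G.m_assoc)
qed (use \<eta> mult in \<open>auto simp: delta_G_apply cochain_def\<close>)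

text \<open>Cocycles that are coboundaries on \<open>G\<close> separately for each element of
  \<open>C\<close>. The group B^2_c asks for more, namely a primitive that is multiplicative in
  \<open>C\<close>; the quotient of the two groups is H^2(C_p, Hom(G, K^x)).\<close>

definition fibrewise_B2c where "fibrewise_B2c = {\<tau> \<in> Z2c C G act K. \<exists>\<eta>. cochain \<eta> \<and> \<tau> = delta_G \<eta>}"

definition mult_cochain :: "('c \<Rightarrow> 'g \<Rightarrow> 'k) \<Rightarrow> bool" where
  "mult_cochain \<eta> \<longleftrightarrow> (\<forall>x\<in>carrier C. \<forall>y\<in>carrier C. \<forall>a\<in>carrier G. \<eta> (x \<otimes>\<^bsub>C\<^esub> y) a = \<eta> x a * \<eta> y (act a x))"

lemma B2c_iff: "\<tau> \<in> B2c C G act K \<longleftrightarrow> (\<exists>\<eta>. cochain \<eta> \<and> mult_cochain \<eta> \<and> \<tau> = delta_G \<eta>)"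
proof
  assume "\<tau> \<in> B2c C G act K"
  then obtain \<eta> where \<eta>: "\<tau> = (\<lambda>(x, a, b)\<in>cells. \<eta> (x, a) \<otimes>\<^bsub>K\<^esub> \<eta> (x, b) \<otimes>\<^bsub>K\<^esub> inv\<^bsub>K\<^esub> \<eta> (x, a \<otimes> b))"
     "\<forall>x\<in>carrier C. \<forall>a\<in>carrier G. \<eta> (x, a) \<noteq> 0"
     "\<forall>a\<in>carrier G. \<eta> (\<one>\<^bsub>C\<^esub>, a) = 1" "\<forall>x\<in>carrier C. \<eta> (x, \<one>) = 1"
     "\<forall>x\<in>carrier C. \<forall>y\<in>carrier C. \<forall>a\<in>carrier G. \<eta> (x \<otimes>\<^bsub>C\<^esub> y, a) = \<eta> (x, a) * \<eta> (y, act a x)"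
    by (auto simp: B2c_def PiE_iff)
  then have "\<tau> = delta_G (\<lambda>x a. \<eta> (x, a))" by (auto simp: delta_G_def fun_eq_iff divide_inverse)
  moreover have "cochain (\<lambda>x a. \<eta> (x, a))" "mult_cochain (\<lambda>x a. \<eta> (x, a))"
    using \<eta>(2-) by (simp_all add: cochain_def mult_cochain_def)
  ultimately show "\<exists>\<eta>. cochain \<eta> \<and> mult_cochain \<eta> \<and> \<tau> = delta_G \<eta>" by blast
next
  assume "\<exists>\<eta>. cochain \<eta> \<and> mult_cochain \<eta> \<and> \<tau> = delta_G \<eta>"
  then obtain \<eta> where \<eta>: "cochain \<eta>" "mult_cochain \<eta>" "\<tau> = delta_G \<eta>" by blast
  show "\<tau> \<in> B2c C G act K" unfolding B2c_def
  proof (intro CollectI exI[of _ "\<lambda>(x, a)\<in>carrier C \<times> carrier G. \<eta> x a"] conjI)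
    show "\<tau> = (\<lambda>(x, a, b)\<in>cells.
       (\<lambda>(x, a)\<in>carrier C \<times> carrier G. \<eta> x a) (x, a) \<otimes>\<^bsub>K\<^esub> (\<lambda>(x, a)\<in>carrier C \<times> carrier G. \<eta> x a) (x, b) \<otimes>\<^bsub>K\<^esub>
       inv\<^bsub>K\<^esub> (\<lambda>(x, a)\<in>carrier C \<times> carrier G. \<eta> x a) (x, a \<otimes> b))"
      using \<eta> cochain_nz[OF \<eta>(1)] by (auto simp: delta_G_def fun_eq_iff divide_inverse)
  qed (use \<eta> in \<open>auto simp: cochain_def mult_cochain_def\<close>)
qed

lemma B2c_subset_fibrewise: "B2c C G act K \<subseteq> fibrewise_B2c"
proof
  fix \<tau> assume "\<tau> \<in> B2c C G act K"
  then obtain \<eta> where \<eta>: "cochain \<eta>" "mult_cochain \<eta>" "\<tau> = delta_G \<eta>" by (auto simp: B2c_iff)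
  have "delta_G \<eta> \<in> Z2c C G act K"
    using \<eta> by (intro delta_G_Z2c) (simp_all add: delta_G_apply mult_cochain_def act_mult)
  then show "\<tau> \<in> fibrewise_B2c" using \<eta> by (auto simp: fibrewise_B2c_def)
qed

lemma subgroup_fibrewise_B2c: "subgroup fibrewise_B2c cocycles_c"
proof (rule group.subgroupI)
  show "group cocycles_c" using comm_group_cocycles_c by (rule comm_group.axioms(2))
  then interpret Z: group cocycles_c .
  show "fibrewise_B2c \<subseteq> carrier cocycles_c" by (auto simp: fibrewise_B2c_def)
  have "delta_G (\<lambda>x a. 1) \<in> B2c C G act K" unfolding B2c_iff
    by (intro exI[of _ "\<lambda>x a. 1"]) (simp add: cochain_def mult_cochain_def)
  then show "fibrewise_B2c \<noteq> {}" using B2c_subset_fibrewise by blast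
  show "inv\<^bsub>cocycles_c\<^esub> f \<in> fibrewise_B2c" if f: "f \<in> fibrewise_B2c" for f
  proof -
    obtain \<eta> where \<eta>: "f \<in> Z2c C G act K" "cochain \<eta>" "f = delta_G \<eta>" using f by (auto simp: fibrewise_B2c_def)
    have "inv\<^bsub>cocycles_c\<^esub> f = delta_G (\<lambda>x a. inverse (\<eta> x a))"
      using \<eta> inv_cocycles_c[OF \<eta>(1)] by (simp add: delta_G_inverse)
    then show ?thesis using Z.inv_closed[of f] \<eta>(1) cochain_inverse[OF \<eta>(2)] by (auto simp: fibrewise_B2c_def)
  qed
  show "f \<otimes>\<^bsub>cocycles_c\<^esub> g \<in> fibrewise_B2c" if fg: "f \<in> fibrewise_B2c" "g \<in> fibrewise_B2c" for f g
  proof -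
    obtain \<eta> \<eta>' where \<eta>: "cochain \<eta>" "f = delta_G \<eta>" "cochain \<eta>'" "g = delta_G \<eta>'"
      and Z: "f \<in> Z2c C G act K" "g \<in> Z2c C G act K"
      using fg by (auto simp: fibrewise_B2c_def)
    have "f \<otimes>\<^bsub>cocycles_c\<^esub> g = delta_G (\<lambda>x a. \<eta> x a * \<eta>' x a)" using \<eta> delta_G_mult by simp
    moreover have "f \<otimes>\<^bsub>cocycles_c\<^esub> g \<in> Z2c C G act K" using Z.m_closed[of f g] Z by simp
    ultimately show ?thesis using cochain_mult[OF \<eta>(1,3)] unfolding fibrewise_B2c_def by blast
  qed
qed

lemma subgroup_B2c: "subgroup (B2c C G act K) cocycles_c"
proof (rule group.subgroupI)
  show "group cocycles_c" using comm_group_cocycles_c by (rule comm_group.axioms(2))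
  show "B2c C G act K \<subseteq> carrier cocycles_c" using B2c_subset_fibrewise by (auto simp: fibrewise_B2c_def)
  have "delta_G (\<lambda>x a. 1) \<in> B2c C G act K" unfolding B2c_iff
    by (intro exI[of _ "\<lambda>x a. 1"]) (simp add: cochain_def mult_cochain_def)
  then show "B2c C G act K \<noteq> {}" by blast
  show "inv\<^bsub>cocycles_c\<^esub> f \<in> B2c C G act K" if f: "f \<in> B2c C G act K" for f
  proof -
    obtain \<eta> where \<eta>: "cochain \<eta>" "mult_cochain \<eta>" "f = delta_G \<eta>" using f by (auto simp: B2c_iff)
    have "f \<in> Z2c C G act K" using f B2c_subset_fibrewise by (auto simp: fibrewise_B2c_def)
    then have "inv\<^bsub>cocycles_c\<^esub> f = delta_G (\<lambda>x a. inverse (\<eta> x a))" using \<eta> inv_cocycles_c delta_G_inverse by simp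
    moreover have "mult_cochain (\<lambda>x a. inverse (\<eta> x a))" using \<eta> by (simp add: mult_cochain_def)
    ultimately show ?thesis using cochain_inverse[OF \<eta>(1)] by (auto simp: B2c_iff)
  qed
  show "f \<otimes>\<^bsub>cocycles_c\<^esub> g \<in> B2c C G act K" if f: "f \<in> B2c C G act K" "g \<in> B2c C G act K" for f g
  proof -
    obtain \<eta> \<eta>' where \<eta>: "cochain \<eta>" "mult_cochain \<eta>" "f = delta_G \<eta>" "cochain \<eta>'" "mult_cochain \<eta>'" "g = delta_G \<eta>'"
      using f by (auto simp: B2c_iff)
    then have "f \<otimes>\<^bsub>cocycles_c\<^esub> g = delta_G (\<lambda>x a. \<eta> x a * \<eta>' x a)" using delta_G_mult by simp
    moreover have "mult_cochain (\<lambda>x a. \<eta> x a * \<eta>' x a)" using \<eta> by (simp add: mult_cochain_def)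
    ultimately show ?thesis using cochain_mult[OF \<eta>(1) \<eta>(4)] unfolding B2c_iff by blast
  qed
qed

end

section \<open>The connecting homomorphism\<close>

context cyclic_action begin

definition shift :: "'c \<Rightarrow> ('c \<times> 'g \<times> 'g \<Rightarrow> 'k) \<Rightarrow> 'c \<times> 'g \<times> 'g \<Rightarrow> 'k" where
  "shift x \<tau> = (\<lambda>(y, a, b)\<in>cells. \<tau> (y, act a x, act b x))"

definition shift_cochain :: "'c \<Rightarrow> ('c \<Rightarrow> 'g \<Rightarrow> 'k) \<Rightarrow> 'c \<Rightarrow> 'g \<Rightarrow> 'k" where
  "shift_cochain x \<eta> y a = \<eta> y (act a x)"

lemma shift_apply: "\<lbrakk>y \<in> carrier C; a \<in> carrier G; b \<in> carrier G\<rbrakk> \<Longrightarrow>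
    shift x \<tau> (y, a, b) = \<tau> (y, act a x, act b x)"
  by (simp add: shift_def)

lemma shift_Z2c:
  assumes x: "x \<in> carrier C" and \<tau>: "\<tau> \<in> Z2c C G act K"
  shows "shift x \<tau> \<in> Z2c C G act K"
  unfolding Z2c_iff
proof (intro conjI ballI)
  show "shift x \<tau> \<in> extensional cells" by (simp add: shift_def)
  fix y a b c assume "y \<in> carrier C" "a \<in> carrier G" "b \<in> carrier G" "c \<in> carrier G"
  then show "shift x \<tau> (y, a, b \<otimes> c) * shift x \<tau> (y, b, c) = shift x \<tau> (y, a \<otimes> b, c) * shift x \<tau> (y, a, b)"
    using x Z2c_cocycle[OF \<tau>] by (simp add: shift_apply act_mult)
next
  fix y z a b assume "y \<in> carrier C" "z \<in> carrier C" "a \<in> carrier G" "b \<in> carrier G"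
  then show "shift x \<tau> (y \<otimes>\<^bsub>C\<^esub> z, a, b) = shift x \<tau> (y, a, b) * shift x \<tau> (z, act a y, act b y)"
    using x Z2c_mult[OF \<tau>] by (simp add: shift_apply act_swap[of x y])
qed (use x in \<open>simp_all add: shift_apply Z2c_nz[OF \<tau>] Z2c_unit[OF \<tau>]\<close>)

lemma shift_mult: "x \<in> carrier C \<Longrightarrow> shift x (\<sigma> \<otimes>\<^bsub>cocycles_c\<^esub> \<tau>) = shift x \<sigma> \<otimes>\<^bsub>cocycles_c\<^esub> shift x \<tau>"
  by (auto simp: shift_def fun_eq_iff)

lemma shift_delta_G: "x \<in> carrier C \<Longrightarrow> shift x (delta_G \<eta>) = delta_G (shift_cochain x \<eta>)"
  by (auto simp: shift_def delta_G_def shift_cochain_def act_mult fun_eq_iff)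

lemma cochain_shift: "x \<in> carrier C \<Longrightarrow> cochain \<eta> \<Longrightarrow> cochain (shift_cochain x \<eta>)"
  by (simp add: cochain_def shift_cochain_def)

lemma mult_cochain_shift: "x \<in> carrier C \<Longrightarrow> mult_cochain \<eta> \<Longrightarrow> mult_cochain (shift_cochain x \<eta>)"
  by (simp add: mult_cochain_def shift_cochain_def act_swap[of x])

lemma shift_fibrewise_B2c: "x \<in> carrier C \<Longrightarrow> v \<in> fibrewise_B2c \<Longrightarrow> shift x v \<in> fibrewise_B2c"
  unfolding fibrewise_B2c_def using shift_Z2c shift_delta_G cochain_shift by blast

lemma shift_B2c: "x \<in> carrier C \<Longrightarrow> v \<in> B2c C G act K \<Longrightarrow> shift x v \<in> B2c C G act K"
  unfolding B2c_iff using shift_delta_G cochain_shift mult_cochain_shift by blast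

definition delta_C :: "('c \<Rightarrow> 'g \<Rightarrow> 'k) \<Rightarrow> 'c \<times> 'c \<Rightarrow> 'g \<Rightarrow> 'k" where
  "delta_C \<eta> = (\<lambda>(x, y)\<in>carrier C \<times> carrier C. \<lambda>a\<in>carrier G. \<eta> y (act a x) * \<eta> x a / \<eta> (x \<otimes>\<^bsub>C\<^esub> y) a)"

lemma delta_C_apply: "\<lbrakk>x \<in> carrier C; y \<in> carrier C; a \<in> carrier G\<rbrakk> \<Longrightarrow>
    delta_C \<eta> (x, y) a = \<eta> y (act a x) * \<eta> x a / \<eta> (x \<otimes>\<^bsub>C\<^esub> y) a"
  by (simp add: delta_C_def)

lemma delta_C_cong: "(\<And>x a. x \<in> carrier C \<Longrightarrow> a \<in> carrier G \<Longrightarrow> \<eta> x a = \<eta>' x a) \<Longrightarrow> delta_C \<eta> = delta_C \<eta>'"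
  by (auto simp: delta_C_def fun_eq_iff)

lemma delta_C_mult: "delta_C (\<lambda>x a. \<eta> x a * \<eta>' x a) = delta_C \<eta> \<otimes>\<^bsub>dual.cochains2\<^esub> delta_C \<eta>'"
  by (auto simp: delta_C_def fun_eq_iff mult_dual)

definition char_cochain :: "('c \<Rightarrow> 'g \<Rightarrow> 'k) \<Rightarrow> bool" where
  "char_cochain \<eta> \<longleftrightarrow> (\<forall>x\<in>carrier C. \<forall>a\<in>carrier G. \<forall>b\<in>carrier G. \<eta> x (a \<otimes> b) = \<eta> x a * \<eta> x b)"

text \<open>The coboundaries in \<open>C\<close> and in \<open>G\<close> commute: multiplicativity
  of delta_G \<eta> in \<open>C\<close> and multiplicativity of delta_C \<eta> in \<open>G\<close>
  are one relation among the nine values of \<eta> collected in \<open>nz\<close>.\<close>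

lemma delta_C_char:
  assumes \<eta>: "cochain \<eta>" and Z: "delta_G \<eta> \<in> Z2c C G act K" and x: "x \<in> carrier C" and y: "y \<in> carrier C"
  shows "delta_C \<eta> (x, y) \<in> carrier (dual_group G K)"
  unfolding dual_iff
proof (intro conjI ballI)
  show "delta_C \<eta> (x, y) \<in> extensional (carrier G)" using x y by (simp add: delta_C_def)
  show "delta_C \<eta> (x, y) a \<noteq> 0" if "a \<in> carrier G" for a
    using that x y cochain_nz[OF \<eta>] by (simp add: delta_C_apply)
  fix a b assume a: "a \<in> carrier G" and b: "b \<in> carrier G"
  have xy: "x \<otimes>\<^bsub>C\<^esub> y \<in> carrier C" using x y by simp
  have ab: "a \<otimes> b \<in> carrier G" "act a x \<in> carrier G" "act b x \<in> carrier G" "act a x \<otimes> act b x \<in> carrier G"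
    using a b x by simp_all
  note nz = cochain_nz[OF \<eta> x a] cochain_nz[OF \<eta> x b] cochain_nz[OF \<eta> x ab(1)]
    cochain_nz[OF \<eta> xy a] cochain_nz[OF \<eta> xy b] cochain_nz[OF \<eta> xy ab(1)]
    cochain_nz[OF \<eta> y ab(2)] cochain_nz[OF \<eta> y ab(3)] cochain_nz[OF \<eta> y ab(4)]
  show "delta_C \<eta> (x, y) (a \<otimes> b) = delta_C \<eta> (x, y) a * delta_C \<eta> (x, y) b"
    using Z2c_mult[OF Z x y a b] a b x y xy nz by (simp add: delta_G_apply delta_C_apply act_mult field_simps)
qed

text \<open>A cocycle with values in characters is also a cocycle with values in all functions on
  \<open>G\<close>, and there it is a coboundary delta_C \<eta>. That its values are characters then
  says that delta_G \<eta> is multiplicative in \<open>C\<close>.\<close>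

lemma Z2_dual_iff:
  "f \<in> Z2 C (dual_group G K) (dual_act G act) \<longleftrightarrow> (\<exists>\<eta>. cochain \<eta> \<and> delta_G \<eta> \<in> Z2c C G act K \<and> f = delta_C \<eta>)"
  (is "?L \<longleftrightarrow> ?R")
proof
  assume ?R
  then obtain \<eta> where \<eta>: "cochain \<eta>" and Z: "delta_G \<eta> \<in> Z2c C G act K" and f: "f = delta_C \<eta>" by blast
  show ?L unfolding Z2_def
  proof (intro CollectI conjI ballI)
    show "f \<in> carrier dual.cochains2"
      using delta_C_char[OF \<eta> Z] by (simp add: f PiE_iff) (simp add: delta_C_def)
    show "f (\<one>\<^bsub>C\<^esub>, x) = \<one>\<^bsub>dual_group G K\<^esub>" "f (x, \<one>\<^bsub>C\<^esub>) = \<one>\<^bsub>dual_group G K\<^esub>" if "x \<in> carrier C" for x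
      using that \<eta> by (auto simp: f delta_C_def one_dual act_unit cochain_def fun_eq_iff)
    fix x y z assume c: "x \<in> carrier C" "y \<in> carrier C" "z \<in> carrier C"
    show "dual_act G act x (f (y, z)) \<otimes>\<^bsub>dual_group G K\<^esub> f (x, y \<otimes>\<^bsub>C\<^esub> z) =
        f (x \<otimes>\<^bsub>C\<^esub> y, z) \<otimes>\<^bsub>dual_group G K\<^esub> f (x, y)"
    proof (rule ext)
      fix a show "(dual_act G act x (f (y, z)) \<otimes>\<^bsub>dual_group G K\<^esub> f (x, y \<otimes>\<^bsub>C\<^esub> z)) a =
        (f (x \<otimes>\<^bsub>C\<^esub> y, z) \<otimes>\<^bsub>dual_group G K\<^esub> f (x, y)) a"
      proof (cases "a \<in> carrier G")
        case a: True
        have "\<eta> (y \<otimes>\<^bsub>C\<^esub> z) (act a x) \<noteq> 0" "\<eta> (x \<otimes>\<^bsub>C\<^esub> y) a \<noteq> 0" "\<eta> (x \<otimes>\<^bsub>C\<^esub> (y \<otimes>\<^bsub>C\<^esub> z)) a \<noteq> 0"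
          using c a cochain_nz[OF \<eta>] by simp_all
        then show ?thesis using c a
          by (simp add: f mult_dual dual_act_def delta_C_apply act_comp C.m_assoc)
      qed (simp add: mult_dual)
    qed
  qed
next
  assume f: ?L
  define F where "F x y a = f (x, y) a" for x y a
  have char: "f (x, y) \<in> carrier (dual_group G K)" if "x \<in> carrier C" "y \<in> carrier C" for x y
    using f that by (auto simp: Z2_def PiE_iff)
  have nz: "F x y a \<noteq> 0" if "x \<in> carrier C" "y \<in> carrier C" "a \<in> carrier G" for x y a
    using char that by (simp add: F_def dual_iff)
  have mult: "F x y (a \<otimes> b) = F x y a * F x y b"
    if "x \<in> carrier C" "y \<in> carrier C" "a \<in> carrier G" "b \<in> carrier G" for x y a b
    using char[OF that(1,2)] that by (simp add: F_def dual_iff)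
  have one: "F \<one>\<^bsub>C\<^esub> x a = 1" "F x \<one>\<^bsub>C\<^esub> a = 1" if "x \<in> carrier C" "a \<in> carrier G" for x a
    using f that by (simp_all add: F_def Z2_def one_dual)
  have one': "F x y \<one> = 1" if "x \<in> carrier C" "y \<in> carrier C" for x y
    using mult[OF that G.one_closed G.one_closed] nz[OF that G.one_closed] by simp
  have coc: "F y z (act a x) * F x (y \<otimes>\<^bsub>C\<^esub> z) a = F (x \<otimes>\<^bsub>C\<^esub> y) z a * F x y a"
    if "x \<in> carrier C" "y \<in> carrier C" "z \<in> carrier C" "a \<in> carrier G" for x y z a
  proof -
    have "dual_act G act x (f (y, z)) \<otimes>\<^bsub>dual_group G K\<^esub> f (x, y \<otimes>\<^bsub>C\<^esub> z) =
        f (x \<otimes>\<^bsub>C\<^esub> y, z) \<otimes>\<^bsub>dual_group G K\<^esub> f (x, y)" using f that by (simp add: Z2_def)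
    from fun_cong[OF this, of a] show ?thesis using that by (simp add: F_def mult_dual dual_act_def)
  qed
  obtain \<eta> where \<eta>: "cochain \<eta>" and F': "\<forall>x\<in>carrier C. \<forall>y\<in>carrier C. \<forall>a\<in>carrier G.
      F x y a = \<eta> y (act a x) * \<eta> x a / \<eta> (x \<otimes>\<^bsub>C\<^esub> y) a"
    by (rule cochain_cocycle_trivial[of F, OF nz one one' coc]) blast+
  then have F: "F x y a = \<eta> y (act a x) * \<eta> x a / \<eta> (x \<otimes>\<^bsub>C\<^esub> y) a"
    if "x \<in> carrier C" "y \<in> carrier C" "a \<in> carrier G" for x y a
    using that by blast
  have "f = delta_C \<eta>"
  proof (intro ext)
    fix w :: "'c \<times> 'c" and a
    obtain x y where w: "w = (x, y)" by fastforce
    show "f w a = delta_C \<eta> w a"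
    proof (cases "x \<in> carrier C \<and> y \<in> carrier C")
      case True
      then show ?thesis using F[of x y a] char[of x y] unfolding w
        by (cases "a \<in> carrier G") (auto simp: delta_C_def F_def dual_iff extensional_def)
    next
      case False
      moreover have "f \<in> extensional (carrier C \<times> carrier C)" using f by (simp add: Z2_def PiE_iff)
      ultimately show ?thesis unfolding w by (auto simp: delta_C_def extensional_def)
    qed
  qed
  moreover have "delta_G \<eta> \<in> Z2c C G act K"
  proof (rule delta_G_Z2c[OF \<eta>])
    fix x y a b assume x: "x \<in> carrier C" and y: "y \<in> carrier C" and a: "a \<in> carrier G" and b: "b \<in> carrier G"
    have xy: "x \<otimes>\<^bsub>C\<^esub> y \<in> carrier C" using x y by simp
    have ab: "a \<otimes> b \<in> carrier G" "act a x \<in> carrier G" "act b x \<in> carrier G" "act a x \<otimes> act b x \<in> carrier G"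
      using a b x by simp_all
    note nz = cochain_nz[OF \<eta> x a] cochain_nz[OF \<eta> x b] cochain_nz[OF \<eta> x ab(1)]
      cochain_nz[OF \<eta> xy a] cochain_nz[OF \<eta> xy b] cochain_nz[OF \<eta> xy ab(1)]
      cochain_nz[OF \<eta> y ab(2)] cochain_nz[OF \<eta> y ab(3)] cochain_nz[OF \<eta> y ab(4)]
    show "delta_G \<eta> (x \<otimes>\<^bsub>C\<^esub> y, a, b) = delta_G \<eta> (x, a, b) * delta_G \<eta> (y, act a x, act b x)"
      using mult[OF x y a b] a b x y xy ab nz
      by (simp add: delta_G_apply F act_mult field_simps)
  qed
  ultimately show ?R using \<eta> by blast
qed

text \<open>In contrast to \<open>Z2_dual_iff\<close>, each \<eta>(x) is itself a character here.
  The difference between the two conditions is the class in H^2.\<close>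

lemma B2_dual_iff:
  "f \<in> B2 C (dual_group G K) (dual_act G act) \<longleftrightarrow> (\<exists>\<eta>. cochain \<eta> \<and> char_cochain \<eta> \<and> f = delta_C \<eta>)"
  (is "?L \<longleftrightarrow> ?R")
proof
  assume ?L
  then obtain g where g: "f = (\<lambda>(x, y)\<in>carrier C \<times> carrier C.
      dual_act G act x (g y) \<otimes>\<^bsub>dual_group G K\<^esub> g x \<otimes>\<^bsub>dual_group G K\<^esub> inv\<^bsub>dual_group G K\<^esub> g (x \<otimes>\<^bsub>C\<^esub> y))"
    "g \<in> carrier C \<rightarrow>\<^sub>E carrier (dual_group G K)" "g \<one>\<^bsub>C\<^esub> = \<one>\<^bsub>dual_group G K\<^esub>"
    by (auto simp: B2_def)
  then have gc: "g x \<in> carrier (dual_group G K)" if "x \<in> carrier C" for x using that by auto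
  then have gm: "g x (a \<otimes> b) = g x a * g x b" "g x a \<noteq> 0"
    if "x \<in> carrier C" "a \<in> carrier G" "b \<in> carrier G" for x a b
    using that by (simp_all add: dual_iff)
  have "g x \<one> = 1" if "x \<in> carrier C" for x using gm[OF that G.one_closed G.one_closed] by simp
  then have "cochain g" "char_cochain g" using gm g(3) by (auto simp: cochain_def char_cochain_def one_dual)
  moreover have "f = delta_C g"
    using gc by (auto simp: g(1) delta_C_def fun_eq_iff mult_dual inv_dual dual_act_def divide_inverse)
  ultimately show ?R by blast
next
  assume ?R
  then obtain \<eta> where \<eta>: "cochain \<eta>" "char_cochain \<eta>" "f = delta_C \<eta>" by blast
  define g where "g = (\<lambda>x\<in>carrier C. \<lambda>a\<in>carrier G. \<eta> x a)"
  have gc: "g x \<in> carrier (dual_group G K)" if "x \<in> carrier C" for x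
    using that \<eta> by (simp add: dual_iff g_def cochain_def char_cochain_def)
  have gx: "g x = (\<lambda>a\<in>carrier G. \<eta> x a)" if "x \<in> carrier C" for x using that by (simp add: g_def)
  have "f = (\<lambda>(x, y)\<in>carrier C \<times> carrier C.
      dual_act G act x (g y) \<otimes>\<^bsub>dual_group G K\<^esub> g x \<otimes>\<^bsub>dual_group G K\<^esub> inv\<^bsub>dual_group G K\<^esub> g (x \<otimes>\<^bsub>C\<^esub> y))"
    using gc by (auto simp: \<eta> delta_C_def fun_eq_iff mult_dual inv_dual dual_act_def divide_inverse gx)
  moreover have "g \<in> carrier (fun_group (carrier C) (dual_group G K))"
    using gc by (simp add: PiE_iff) (simp add: g_def)
  moreover have "g \<one>\<^bsub>C\<^esub> = \<one>\<^bsub>dual_group G K\<^esub>" using \<eta> by (auto simp: g_def one_dual cochain_def fun_eq_iff)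
  ultimately show ?L unfolding B2_def by blast
qed

text \<open>The connecting map of a long exact sequence: lift \<tau> to a primitive \<eta> and apply
  the other coboundary. Independence of the choice is \<open>connecting_delta_G\<close>.\<close>

definition connecting where "connecting \<tau> = dual.cls (delta_C (SOME \<eta>. cochain \<eta> \<and> \<tau> = delta_G \<eta>))"

lemma delta_G_eqD:
  assumes "cochain \<eta>" "cochain \<eta>'" "delta_G \<eta> = delta_G \<eta>'"
  shows "char_cochain (\<lambda>x a. \<eta>' x a / \<eta> x a)"
  unfolding char_cochain_def
proof (intro ballI)
  fix x a b assume c: "x \<in> carrier C" "a \<in> carrier G" "b \<in> carrier G"
  then have "\<eta> x a * \<eta> x b / \<eta> x (a \<otimes> b) = \<eta>' x a * \<eta>' x b / \<eta>' x (a \<otimes> b)"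
    using fun_cong[OF assms(3), of "(x, a, b)"] by (simp add: delta_G_apply)
  then show "\<eta>' x (a \<otimes> b) / \<eta> x (a \<otimes> b) = \<eta>' x a / \<eta> x a * (\<eta>' x b / \<eta> x b)"
    using c cochain_nz[OF assms(1)] cochain_nz[OF assms(2)] by (simp add: field_simps)
qed

text \<open>Another primitive differs from \<eta> by a cochain g of characters, and delta_C g is a
  coboundary in the character group.\<close>

lemma connecting_delta_G:
  assumes \<eta>: "cochain \<eta>" and Z: "delta_G \<eta> \<in> Z2c C G act K"
  shows "connecting (delta_G \<eta>) = dual.cls (delta_C \<eta>)"
proof -
  define \<eta>' where "\<eta>' = (SOME \<eta>'. cochain \<eta>' \<and> delta_G \<eta> = delta_G \<eta>')"
  have "cochain \<eta>' \<and> delta_G \<eta> = delta_G \<eta>'" unfolding \<eta>'_def by (rule someI[of _ \<eta>]) (simp add: \<eta>)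
  then have \<eta>': "cochain \<eta>'" "delta_G \<eta> = delta_G \<eta>'" by auto
  define g where "g = (\<lambda>x a. \<eta>' x a / \<eta> x a)"
  have g: "cochain g" "char_cochain g"
    using delta_G_eqD[OF \<eta> \<eta>'] \<eta> \<eta>'(1) by (simp_all add: g_def cochain_def)
  interpret H: comm_group "H2 C (dual_group G K) (dual_act G act)" by (rule dual.comm_group_H2)
  have cls_closed: "dual.cls (delta_C \<eta>) \<in> carrier (H2 C (dual_group G K) (dual_act G act))"
    unfolding dual.carrier_H2 using \<eta> Z Z2_dual_iff by blast
  have Bg: "delta_C g \<in> B2 C (dual_group G K) (dual_act G act)" using g B2_dual_iff by blast
  have "delta_C \<eta>' = delta_C (\<lambda>x a. \<eta> x a * g x a)"
    using cochain_nz[OF \<eta>] by (intro delta_C_cong) (simp add: g_def)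
  also have "\<dots> = delta_C \<eta> \<otimes>\<^bsub>dual.cochains2\<^esub> delta_C g" by (rule delta_C_mult)
  finally have "dual.cls (delta_C \<eta>') = dual.cls (delta_C \<eta>) \<otimes>\<^bsub>H2 C (dual_group G K) (dual_act G act)\<^esub> dual.cls (delta_C g)"
    using dual.cls_mult[of "delta_C \<eta>" "delta_C g"] \<eta> Z Z2_dual_iff Bg dual.B2_subset_Z2 by auto
  also have "dual.cls (delta_C g) = \<one>\<^bsub>H2 C (dual_group G K) (dual_act G act)\<^esub>"
    using dual.cls_eq_one_iff[of "delta_C g"] Bg dual.B2_subset_Z2 by blast
  finally have "dual.cls (delta_C \<eta>') = dual.cls (delta_C \<eta>)"
    using H.r_one[OF cls_closed] by simp
  then show ?thesis by (simp add: connecting_def \<eta>'_def)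
qed

lemma connecting_mult:
  assumes "v \<in> fibrewise_B2c" "w \<in> fibrewise_B2c"
  shows "connecting (v \<otimes>\<^bsub>cocycles_c\<^esub> w) = connecting v \<otimes>\<^bsub>H2 C (dual_group G K) (dual_act G act)\<^esub> connecting w"
proof -
  obtain \<eta> \<eta>' where *: "cochain \<eta>" "v = delta_G \<eta>" "cochain \<eta>'" "w = delta_G \<eta>'" and Z: "v \<in> Z2c C G act K" "w \<in> Z2c C G act K"
    using assms by (auto simp: fibrewise_B2c_def)
  have eq: "v \<otimes>\<^bsub>cocycles_c\<^esub> w = delta_G (\<lambda>x a. \<eta> x a * \<eta>' x a)" using * delta_G_mult by simp
  have "delta_G (\<lambda>x a. \<eta> x a * \<eta>' x a) \<in> Z2c C G act K"
    using subgroup.m_closed[OF subgroup_fibrewise_B2c assms] eq by (auto simp: fibrewise_B2c_def)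
  then have "connecting (v \<otimes>\<^bsub>cocycles_c\<^esub> w) = dual.cls (delta_C (\<lambda>x a. \<eta> x a * \<eta>' x a))"
    unfolding eq using * cochain_mult by (intro connecting_delta_G)
  then show ?thesis using * Z dual.cls_mult[of "delta_C \<eta>" "delta_C \<eta>'"] Z2_dual_iff
    by (auto simp: delta_C_mult connecting_delta_G)
qed

lemma connecting_image: "connecting ` fibrewise_B2c = carrier (H2 C (dual_group G K) (dual_act G act))"
proof -
  have "connecting ` fibrewise_B2c = (\<lambda>\<eta>. dual.cls (delta_C \<eta>)) ` {\<eta>. cochain \<eta> \<and> delta_G \<eta> \<in> Z2c C G act K}"
    by (force simp: fibrewise_B2c_def connecting_delta_G image_iff)
  also have "\<dots> = dual.cls ` Z2 C (dual_group G K) (dual_act G act)"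
  proof -
    have "Z2 C (dual_group G K) (dual_act G act) = delta_C ` {\<eta>. cochain \<eta> \<and> delta_G \<eta> \<in> Z2c C G act K}"
      by (auto simp: Z2_dual_iff)
    then show ?thesis by (simp add: image_image)
  qed
  finally show ?thesis by (simp add: dual.carrier_H2)
qed

text \<open>If delta_C \<eta> = delta_C g with g consisting of characters, then \<eta>/g is
  multiplicative in \<open>C\<close> and has the same delta_G. Conversely, a multiplicative
  primitive \<eta>' has trivial delta_C, and \<eta>/\<eta>' consists of characters.\<close>

lemma connecting_eq_one_iff:
  assumes "v \<in> fibrewise_B2c"
  shows "connecting v = \<one>\<^bsub>H2 C (dual_group G K) (dual_act G act)\<^esub> \<longleftrightarrow> v \<in> B2c C G act K"
proof -
  obtain \<eta> where \<eta>: "cochain \<eta>" "v = delta_G \<eta>" and Z: "delta_G \<eta> \<in> Z2c C G act K"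
    using assms by (auto simp: fibrewise_B2c_def)
  have "connecting v = \<one>\<^bsub>H2 C (dual_group G K) (dual_act G act)\<^esub> \<longleftrightarrow> delta_C \<eta> \<in> B2 C (dual_group G K) (dual_act G act)"
    using dual.cls_eq_one_iff[of "delta_C \<eta>"] connecting_delta_G[OF \<eta>(1) Z] \<eta> Z Z2_dual_iff by auto
  also have "\<dots> \<longleftrightarrow> v \<in> B2c C G act K"
  proof
    assume "delta_C \<eta> \<in> B2 C (dual_group G K) (dual_act G act)"
    then obtain g where g: "cochain g" "char_cochain g" "delta_C \<eta> = delta_C g" by (auto simp: B2_dual_iff)
    define \<eta>' where "\<eta>' x a = \<eta> x a / g x a" for x a
    have "cochain \<eta>'" using \<eta> g by (simp add: \<eta>'_def cochain_def)
    moreover have "mult_cochain \<eta>'" unfolding mult_cochain_def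
    proof (intro ballI)
      fix x y a assume c: "x \<in> carrier C" "y \<in> carrier C" "a \<in> carrier G"
      have "\<eta> y (act a x) * \<eta> x a / \<eta> (x \<otimes>\<^bsub>C\<^esub> y) a = g y (act a x) * g x a / g (x \<otimes>\<^bsub>C\<^esub> y) a"
        using c fun_cong[OF fun_cong[OF g(3), of "(x, y)"], of a] by (simp add: delta_C_apply)
      then show "\<eta>' (x \<otimes>\<^bsub>C\<^esub> y) a = \<eta>' x a * \<eta>' y (act a x)"
        using c cochain_nz[OF \<eta>(1)] cochain_nz[OF g(1)] by (simp add: \<eta>'_def field_simps)
    qed
    moreover have "delta_G \<eta> = delta_G \<eta>'"
    proof -
      have "\<eta> x a * \<eta> x b / \<eta> x (a \<otimes> b) = \<eta>' x a * \<eta>' x b / \<eta>' x (a \<otimes> b)"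
        if "x \<in> carrier C" "a \<in> carrier G" "b \<in> carrier G" for x a b
        using that g(2) cochain_nz[OF g(1)] cochain_nz[OF \<eta>(1)]
        by (simp add: \<eta>'_def char_cochain_def field_simps)
      then show ?thesis by (auto simp: delta_G_def fun_eq_iff)
    qed
    ultimately show "v \<in> B2c C G act K" using \<eta> B2c_iff by blast
  next
    assume "v \<in> B2c C G act K"
    then obtain \<eta>' where \<eta>': "cochain \<eta>'" "mult_cochain \<eta>'" "v = delta_G \<eta>'" by (auto simp: B2c_iff)
    define g where "g = (\<lambda>x a. \<eta> x a / \<eta>' x a)"
    have "cochain g" "char_cochain g"
      using delta_G_eqD[OF \<eta>'(1) \<eta>(1)] \<eta> \<eta>' by (simp_all add: g_def cochain_def)
    moreover have "delta_C \<eta> = delta_C g"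
    proof -
      have "\<eta> y (act a x) * \<eta> x a / \<eta> (x \<otimes>\<^bsub>C\<^esub> y) a = g y (act a x) * g x a / g (x \<otimes>\<^bsub>C\<^esub> y) a"
        if "x \<in> carrier C" "y \<in> carrier C" "a \<in> carrier G" for x y a
        using that \<eta>'(2) cochain_nz[OF \<eta>'(1)] cochain_nz[OF \<eta>(1)]
        by (simp add: g_def mult_cochain_def field_simps)
      then show ?thesis by (auto simp: delta_C_def fun_eq_iff)
    qed
    ultimately show "delta_C \<eta> \<in> B2 C (dual_group G K) (dual_act G act)" using B2_dual_iff by blast
  qed
  finally show ?thesis .
qed

lemma connecting_shift:
  assumes x: "x \<in> carrier C" and v: "v \<in> fibrewise_B2c"
  shows "connecting (shift x v) = H2_coeff_act C (dual_act G act) x (connecting v)"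
proof -
  define \<phi> where "\<phi> x f = (\<lambda>(y, z)\<in>carrier C \<times> carrier C. dual_act G act x (f (y, z)))"
    for x and f :: "'c \<times> 'c \<Rightarrow> 'g \<Rightarrow> 'k"
  \<comment> \<open>Commutativity of \<open>C\<close>, through \<open>act_swap\<close>, is what lets
    the action pass through delta_C.\<close>
  have \<phi>_delta_C: "\<phi> x (delta_C \<eta>) = delta_C (shift_cochain x \<eta>)" if "x \<in> carrier C" for x \<eta>
    using that by (auto simp: \<phi>_def delta_C_def dual_act_def shift_cochain_def fun_eq_iff act_swap[of x])
  have char: "char_cochain (shift_cochain x \<eta>)" if "x \<in> carrier C" "char_cochain \<eta>" for x \<eta>
    using that by (simp add: char_cochain_def shift_cochain_def act_mult)
  have B: "\<phi> x f \<in> B2 C (dual_group G K) (dual_act G act)"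
    if "x \<in> carrier C" "f \<in> B2 C (dual_group G K) (dual_act G act)" for x f
    using that \<phi>_delta_C cochain_shift char unfolding B2_dual_iff by blast
  have Z: "\<phi> x f \<in> Z2 C (dual_group G K) (dual_act G act)"
    if x: "x \<in> carrier C" and f: "f \<in> Z2 C (dual_group G K) (dual_act G act)" for x f
  proof -
    obtain \<eta> where "cochain \<eta>" "delta_G \<eta> \<in> Z2c C G act K" "f = delta_C \<eta>" using f Z2_dual_iff by blast
    then show ?thesis unfolding Z2_dual_iff
      using \<phi>_delta_C[OF x] cochain_shift[OF x] shift_delta_G[OF x] shift_Z2c[OF x]
      by (intro exI[of _ "shift_cochain x \<eta>"]) metis
  qed
  have hom: "\<phi> x \<in> hom dual.cocycle_group dual.cocycle_group"
    using x Z by (auto simp: hom_def \<phi>_def fun_eq_iff dual_act_def mult_dual)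
  \<comment> \<open>Acting first with the inverse of x shows that B^2 is reached entirely, which is
    needed for images of cosets to be cosets.\<close>
  have "\<phi> x ` B2 C (dual_group G K) (dual_act G act) = B2 C (dual_group G K) (dual_act G act)"
  proof (intro equalityI subsetI)
    fix f assume f: "f \<in> B2 C (dual_group G K) (dual_act G act)"
    then obtain \<eta> where \<eta>: "cochain \<eta>" "char_cochain \<eta>" "f = delta_C \<eta>" using B2_dual_iff by blast
    have "\<phi> x (\<phi> (inv\<^bsub>C\<^esub> x) f) = f"
      using x by (simp add: \<eta> \<phi>_delta_C) (intro delta_C_cong, simp add: shift_cochain_def act_inv_right)
    then show "f \<in> \<phi> x ` B2 C (dual_group G K) (dual_act G act)" using B f x
      by (metis C.inv_closed image_eqI)
  qed (use B x in blast)
  then have "\<phi> x ` dual.cls f = dual.cls (\<phi> x f)" if "f \<in> Z2 C (dual_group G K) (dual_act G act)" for f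
    using that dual.image_cls[OF hom] by blast
  moreover obtain \<eta> where \<eta>: "cochain \<eta>" "v = delta_G \<eta>" and Zv: "delta_G \<eta> \<in> Z2c C G act K"
    using v by (auto simp: fibrewise_B2c_def)
  moreover have "connecting (delta_G (shift_cochain x \<eta>)) = dual.cls (delta_C (shift_cochain x \<eta>))"
    using shift_Z2c[OF x Zv] cochain_shift[OF x \<eta>(1)] by (intro connecting_delta_G) (simp_all add: shift_delta_G[OF x])
  moreover have "delta_C \<eta> \<in> Z2 C (dual_group G K) (dual_act G act)" using \<eta> Zv Z2_dual_iff by blast
  ultimately show ?thesis
    using x by (simp add: shift_delta_G connecting_delta_G \<phi>_delta_C[symmetric] H2_coeff_act_def coset_act_def \<phi>_def)
qed

end

section \<open>Restriction to the generator\<close>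

context cyclic_action begin

abbreviation "Z2G \<equiv> Z2 G K (\<lambda>_ u. u)"
abbreviation "B2G \<equiv> B2 G K (\<lambda>_ u. u)"
abbreviation "pairs \<equiv> carrier G \<times> carrier G"

lemma Z2G_iff: "s \<in> Z2G \<longleftrightarrow> s \<in> extensional pairs \<and>
    (\<forall>a\<in>carrier G. \<forall>b\<in>carrier G. s (a, b) \<noteq> 0) \<and>
    (\<forall>a\<in>carrier G. s (\<one>, a) = 1 \<and> s (a, \<one>) = 1) \<and>
    (\<forall>a\<in>carrier G. \<forall>b\<in>carrier G. \<forall>c\<in>carrier G. s (b, c) * s (a, b \<otimes> c) = s (a \<otimes> b, c) * s (a, b))"
proof -
  have "s \<in> carrier (fun_group pairs K) \<longleftrightarrow> s \<in> extensional pairs \<and>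
     (\<forall>a\<in>carrier G. \<forall>b\<in>carrier G. s (a, b) \<noteq> 0)"
    by (simp add: PiE_iff conj_commute)
  then show ?thesis unfolding Z2_def mem_Collect_eq mult_K one_K by (simp only: conj_assoc)
qed

lemma Z2GD:
  assumes "s \<in> Z2G"
  shows Z2G_ext: "s \<in> extensional pairs"
    and Z2G_nz: "\<lbrakk>a \<in> carrier G; b \<in> carrier G\<rbrakk> \<Longrightarrow> s (a, b) \<noteq> 0"
    and Z2G_unit: "a \<in> carrier G \<Longrightarrow> s (\<one>, a) = 1" "a \<in> carrier G \<Longrightarrow> s (a, \<one>) = 1"
    and Z2G_cocycle: "\<lbrakk>a \<in> carrier G; b \<in> carrier G; c \<in> carrier G\<rbrakk> \<Longrightarrow>
      s (b, c) * s (a, b \<otimes> c) = s (a \<otimes> b, c) * s (a, b)"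
  using assms unfolding Z2G_iff by blast+

lemma B2G_iff: "s \<in> B2G \<longleftrightarrow> s \<in> extensional pairs \<and> (\<exists>g. (\<forall>a\<in>carrier G. g a \<noteq> 0) \<and> g \<one> = 1 \<and>
    (\<forall>a\<in>carrier G. \<forall>b\<in>carrier G. s (a, b) = g a * g b / g (a \<otimes> b)))" (is "?L \<longleftrightarrow> ?R")
proof
  assume ?L
  then obtain g where g: "s = (\<lambda>(a, b)\<in>pairs. g b \<otimes>\<^bsub>K\<^esub> g a \<otimes>\<^bsub>K\<^esub> inv\<^bsub>K\<^esub> g (a \<otimes> b))"
    "\<forall>a\<in>carrier G. g a \<noteq> 0" "g \<one> = 1"
    by (auto simp: B2_def PiE_iff)
  then show ?R by (intro conjI exI[of _ g]) (auto simp: divide_inverse)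
next
  assume ?R
  then obtain g where s: "s \<in> extensional pairs" and g: "\<forall>a\<in>carrier G. g a \<noteq> 0" "g \<one> = 1"
    "\<forall>a\<in>carrier G. \<forall>b\<in>carrier G. s (a, b) = g a * g b / g (a \<otimes> b)" by blast
  define h where "h = restrict g (carrier G)"
  have "s = (\<lambda>(a, b)\<in>pairs. h b \<otimes>\<^bsub>K\<^esub> h a \<otimes>\<^bsub>K\<^esub> inv\<^bsub>K\<^esub> h (a \<otimes> b))"
  proof (rule ext)
    fix w show "s w = (\<lambda>(a, b)\<in>pairs. h b \<otimes>\<^bsub>K\<^esub> h a \<otimes>\<^bsub>K\<^esub> inv\<^bsub>K\<^esub> h (a \<otimes> b)) w"
      using s g by (cases w) (auto simp: h_def divide_inverse extensional_def)
  qed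
  moreover have "h \<in> carrier (fun_group (carrier G) K)" "h \<one> = \<one>\<^bsub>K\<^esub>"
    using g by (simp_all add: h_def restrict_PiE_iff)
  ultimately show ?L unfolding B2_def by blast
qed

lemma B2G_sym: "s \<in> B2G \<Longrightarrow> a \<in> carrier G \<Longrightarrow> b \<in> carrier G \<Longrightarrow> s (a, b) = s (b, a)"
  by (auto simp: B2G_iff G.m_comm)

lemma symmetric_cocycleI:
  assumes "s \<in> Z2G" "\<And>a b. a \<in> carrier G \<Longrightarrow> b \<in> carrier G \<Longrightarrow> s (a, b) = s (b, a)"
  shows "symmetric_cocycle G (\<lambda>a b. s (a, b))"
  by unfold_locales (use assms(2) finite_G Z2GD[OF assms(1)] in auto)

lemma symmetric_imp_B2G:
  assumes "s \<in> Z2G" "\<And>a b. a \<in> carrier G \<Longrightarrow> b \<in> carrier G \<Longrightarrow> s (a, b) = s (b, a)"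
  shows "s \<in> B2G"
proof -
  interpret symmetric_cocycle G "\<lambda>a b. s (a, b)" using assms by (rule symmetric_cocycleI)
  obtain \<eta> where "\<forall>a\<in>carrier G. \<eta> a \<noteq> 0" "\<eta> \<one> = 1"
    "\<forall>a\<in>carrier G. \<forall>b\<in>carrier G. s (a, b) = \<eta> a * \<eta> b / \<eta> (a \<otimes> b)"
    by (rule trivialization) blast
  then show ?thesis unfolding B2G_iff using Z2G_ext[OF assms(1)] by blast
qed

definition slice :: "('c \<times> 'g \<times> 'g \<Rightarrow> 'k) \<Rightarrow> 'g \<times> 'g \<Rightarrow> 'k" where
  "slice \<tau> = (\<lambda>(a, b)\<in>pairs. \<tau> (t, a, b))"

definition restriction where "restriction \<tau> = mult.cls (slice \<tau>)"

lemma slice_Z2G: "\<tau> \<in> Z2c C G act K \<Longrightarrow> slice \<tau> \<in> Z2G"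
  unfolding Z2G_iff
proof (intro conjI ballI)
  fix a b c assume \<tau>: "\<tau> \<in> Z2c C G act K" and c: "a \<in> carrier G" "b \<in> carrier G" "c \<in> carrier G"
  show "slice \<tau> (b, c) * slice \<tau> (a, b \<otimes> c) = slice \<tau> (a \<otimes> b, c) * slice \<tau> (a, b)"
    using c Z2c_cocycle[OF \<tau> t c] by (simp add: slice_def mult.commute)
qed (use t in \<open>simp_all add: slice_def Z2c_nz Z2c_unit\<close>)

lemma restriction_hom: "restriction \<in> hom cocycles_c (multiplier G K)"
proof (rule homI)
  fix \<sigma> \<tau> assume "\<sigma> \<in> carrier cocycles_c" and "\<tau> \<in> carrier cocycles_c"
  then have Z: "\<sigma> \<in> Z2c C G act K" "\<tau> \<in> Z2c C G act K" by simp_all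
  have "slice (\<sigma> \<otimes>\<^bsub>cocycles_c\<^esub> \<tau>) = slice \<sigma> \<otimes>\<^bsub>mult.cochains2\<^esub> slice \<tau>"
    using t by (auto simp: slice_def fun_eq_iff)
  then show "restriction (\<sigma> \<otimes>\<^bsub>cocycles_c\<^esub> \<tau>) = restriction \<sigma> \<otimes>\<^bsub>multiplier G K\<^esub> restriction \<tau>"
    using Z by (simp only: restriction_def multiplier_def mult.cls_mult[OF slice_Z2G slice_Z2G])
next
  fix \<tau> assume "\<tau> \<in> carrier cocycles_c"
  then have "slice \<tau> \<in> Z2G" by (simp add: slice_Z2G)
  then show "restriction \<tau> \<in> carrier (multiplier G K)" unfolding restriction_def multiplier_def mult.carrier_H2 by blast
qed

text \<open>Multiplicativity in \<open>C\<close> recovers \<tau> from its value at \<open>t\<close>;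
  at exponent p it says that the slice has norm exactly 1.\<close>

lemma Z2c_pow:
  assumes "\<tau> \<in> Z2c C G act K" "a \<in> carrier G" "b \<in> carrier G"
  shows "\<tau> (t [^]\<^bsub>C\<^esub> (i::nat), a, b) = (\<Prod>j<i. \<tau> (t, act a (t [^]\<^bsub>C\<^esub> j), act b (t [^]\<^bsub>C\<^esub> j)))"
  by (induction i) (use assms t in \<open>simp_all add: Z2c_unit Z2c_mult\<close>)

lemma restriction_eq_one_iff:
  assumes \<tau>: "\<tau> \<in> Z2c C G act K"
  shows "restriction \<tau> = \<one>\<^bsub>multiplier G K\<^esub> \<longleftrightarrow> \<tau> \<in> fibrewise_B2c"
proof -
  have "restriction \<tau> = \<one>\<^bsub>multiplier G K\<^esub> \<longleftrightarrow> slice \<tau> \<in> B2G"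
    unfolding restriction_def multiplier_def using mult.cls_eq_one_iff slice_Z2G[OF \<tau>] by blast
  also have "\<dots> \<longleftrightarrow> \<tau> \<in> fibrewise_B2c"
  proof
    assume "slice \<tau> \<in> B2G"
    then obtain g where g: "\<forall>a\<in>carrier G. g a \<noteq> 0" "g \<one> = 1"
      "\<forall>a\<in>carrier G. \<forall>b\<in>carrier G. slice \<tau> (a, b) = g a * g b / g (a \<otimes> b)" by (auto simp: B2G_iff)
    \<comment> \<open>The norm of g may differ from 1, so this product can fail to be multiplicative
      when exponents wrap around p. Therefore it proves membership in \<open>fibrewise_B2c\<close>
      and not in B^2_c.\<close>
    define \<eta> where "\<eta> x a = (\<Prod>j<dlog x. g (act a (t [^]\<^bsub>C\<^esub> j)))" for x a
    have \<eta>: "cochain \<eta>" using g by (simp add: cochain_def \<eta>_def dlog_one)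
    have "\<tau> (x, a, b) = \<eta> x a * \<eta> x b / \<eta> x (a \<otimes> b)"
      if "x \<in> carrier C" "a \<in> carrier G" "b \<in> carrier G" for x a b
    proof -
      have "\<tau> (x, a, b) = (\<Prod>j<dlog x. \<tau> (t, act a (t [^]\<^bsub>C\<^esub> j), act b (t [^]\<^bsub>C\<^esub> j)))"
        using Z2c_pow[OF \<tau> that(2,3), of "dlog x"] t_pow_dlog[OF that(1)] by simp
      also have "\<dots> = (\<Prod>j<dlog x. g (act a (t [^]\<^bsub>C\<^esub> j)) * g (act b (t [^]\<^bsub>C\<^esub> j)) / g (act (a \<otimes> b) (t [^]\<^bsub>C\<^esub> j)))"
        using g(3) that by (intro prod.cong) (simp_all add: slice_def act_mult)
      also have "\<dots> = \<eta> x a * \<eta> x b / \<eta> x (a \<otimes> b)" by (simp add: \<eta>_def prod.distrib prod_dividef)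
      finally show ?thesis .
    qed
    then have "\<tau> w = delta_G \<eta> w" for w
      using Z2c_ext[OF \<tau>] by (cases w) (auto simp: delta_G_def extensional_def)
    then show "\<tau> \<in> fibrewise_B2c" using \<tau> \<eta> by (auto simp: fibrewise_B2c_def fun_eq_iff)
  next
    assume "\<tau> \<in> fibrewise_B2c"
    then obtain \<eta> where "cochain \<eta>" "\<tau> = delta_G \<eta>" by (auto simp: fibrewise_B2c_def)
    then show "slice \<tau> \<in> B2G" unfolding B2G_iff
      using t by (intro conjI exI[of _ "\<eta> t"]) (auto simp: slice_def delta_G_apply cochain_def)
  qed
  finally show ?thesis .
qed

section \<open>Action and norm on the multiplier\<close>

definition shift2 :: "'c \<Rightarrow> ('g \<times> 'g \<Rightarrow> 'k) \<Rightarrow> 'g \<times> 'g \<Rightarrow> 'k" where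
  "shift2 x s = (\<lambda>(a, b)\<in>pairs. s (act a x, act b x))"

lemma shift2_Z2G: "x \<in> carrier C \<Longrightarrow> s \<in> Z2G \<Longrightarrow> shift2 x s \<in> Z2G"
  unfolding Z2G_iff[of "shift2 x s"]
  by (intro conjI ballI) (simp_all add: shift2_def Z2G_nz Z2G_unit Z2G_cocycle act_mult)

lemma multiplier_act_cls:
  assumes x: "x \<in> carrier C" and s: "s \<in> Z2G"
  shows "multiplier_act G act x (mult.cls s) = mult.cls (shift2 x s)"
proof -
  have hom: "shift2 x \<in> hom mult.cocycle_group mult.cocycle_group"
    using x shift2_Z2G by (auto simp: hom_def shift2_def fun_eq_iff)
  have B: "shift2 y r \<in> B2G" if y: "y \<in> carrier C" and r: "r \<in> B2G" for y r
  proof -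
    obtain g where "\<forall>a\<in>carrier G. g a \<noteq> 0" "g \<one> = 1"
      "\<forall>a\<in>carrier G. \<forall>b\<in>carrier G. r (a, b) = g a * g b / g (a \<otimes> b)" using r by (auto simp: B2G_iff)
    then show ?thesis unfolding B2G_iff using y
      by (intro conjI exI[of _ "\<lambda>a. g (act a y)"]) (simp_all add: shift2_def act_mult)
  qed
  have "shift2 x (shift2 (inv\<^bsub>C\<^esub> x) r) = r" if r: "r \<in> B2G" for r
  proof (rule ext)
    fix w show "shift2 x (shift2 (inv\<^bsub>C\<^esub> x) r) w = r w"
      using x r by (cases w) (auto simp: shift2_def act_inv_right B2G_iff extensional_def)
  qed
  then have "r \<in> shift2 x ` B2G" if "r \<in> B2G" for r
    using that B[of "inv\<^bsub>C\<^esub> x" r] x by (intro image_eqI[of _ _ "shift2 (inv\<^bsub>C\<^esub> x) r"]) simp_all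
  then have "shift2 x ` B2G = B2G" using B x by auto
  then have "shift2 x ` mult.cls s = mult.cls (shift2 x s)" using mult.image_cls[OF hom] s by blast
  moreover have "multiplier_act G act x S = shift2 x ` S" for S
    by (simp add: multiplier_act_def coset_act_def shift2_def)
  ultimately show ?thesis by simp
qed

lemma restriction_shift:
  assumes x: "x \<in> carrier C" and \<tau>: "\<tau> \<in> Z2c C G act K"
  shows "restriction (shift x \<tau>) = multiplier_act G act x (restriction \<tau>)"
proof -
  have "slice (shift x \<tau>) = shift2 x (slice \<tau>)"
    using x t by (auto simp: slice_def shift_def shift2_def fun_eq_iff)
  then show ?thesis using multiplier_act_cls[OF x slice_Z2G[OF \<tau>]] by (simp add: restriction_def)
qed

text \<open>The norm on cocycles for n = p; the length n is kept free for the induction in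
  \<open>norm_map_cls\<close>.\<close>

definition pnorm :: "nat \<Rightarrow> ('g \<times> 'g \<Rightarrow> 'k) \<Rightarrow> 'g \<times> 'g \<Rightarrow> 'k" where
  "pnorm n s = (\<lambda>(a, b)\<in>pairs. \<Prod>i<n. s (act a (t [^]\<^bsub>C\<^esub> i), act b (t [^]\<^bsub>C\<^esub> i)))"

lemma norm_map_cls:
  assumes s: "s \<in> Z2G"
  shows "pnorm p s \<in> Z2G"
    "norm_map C t (multiplier G K) (multiplier_act G act) (mult.cls s) = mult.cls (pnorm p s)"
proof -
  interpret M: comm_group "multiplier G K" unfolding multiplier_def by (rule mult.comm_group_H2)
  have cl: "mult.cls r \<in> carrier (multiplier G K)" if "r \<in> Z2G" for r
    unfolding multiplier_def mult.carrier_H2 using that by blast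
  have sh: "shift2 (t [^]\<^bsub>C\<^esub> i) s \<in> Z2G" for i :: nat using s by (simp add: shift2_Z2G)
  have "pnorm n s \<in> Z2G \<and>
    (\<Otimes>\<^bsub>multiplier G K\<^esub>i\<in>{..<n}. mult.cls (shift2 (t [^]\<^bsub>C\<^esub> i) s)) = mult.cls (pnorm n s)" for n
  proof (induction n)
    case 0
    have "pnorm 0 s = \<one>\<^bsub>mult.cocycle_group\<^esub>" by (auto simp: pnorm_def fun_eq_iff)
    moreover have "\<one>\<^bsub>mult.cocycle_group\<^esub> \<in> Z2G"
      using subgroup.one_closed[OF mult.subgroup_Z2] by simp
    moreover have "mult.cls \<one>\<^bsub>mult.cocycle_group\<^esub> = \<one>\<^bsub>multiplier G K\<^esub>" unfolding multiplier_def
      by (rule hom_one[OF mult.cls_hom comm_group.axioms(2)[OF mult.comm_group_cocycles]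
          comm_group.axioms(2)[OF mult.comm_group_H2]])
    ultimately show ?case by (metis M.finprod_empty lessThan_0)
  next
    case (Suc n)
    have eq: "pnorm (Suc n) s = shift2 (t [^]\<^bsub>C\<^esub> n) s \<otimes>\<^bsub>mult.cochains2\<^esub> pnorm n s"
      by (auto simp: pnorm_def shift2_def fun_eq_iff mult.commute)
    have "pnorm (Suc n) s \<in> Z2G" unfolding eq
      using subgroup.m_closed[OF mult.subgroup_Z2 sh] Suc by blast
    moreover have "(\<Otimes>\<^bsub>multiplier G K\<^esub>i\<in>{..<Suc n}. mult.cls (shift2 (t [^]\<^bsub>C\<^esub> i) s)) =
        mult.cls (shift2 (t [^]\<^bsub>C\<^esub> n) s) \<otimes>\<^bsub>multiplier G K\<^esub> mult.cls (pnorm n s)"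
      using cl sh Suc unfolding lessThan_Suc by (subst M.finprod_insert) auto
    ultimately show ?case
      using mult.cls_mult[OF sh conjunct1[OF Suc.IH], of n] unfolding eq multiplier_def
      by (simp only: simp_thms)
  qed
  from this[of p] show "pnorm p s \<in> Z2G"
    "norm_map C t (multiplier G K) (multiplier_act G act) (mult.cls s) = mult.cls (pnorm p s)"
    using multiplier_act_cls s by (simp_all add: norm_map_def order_C)
qed

text \<open>Partial norms of s define \<tau> on the powers of \<open>t\<close>. They have period p
  because the full norm equals 1 as a function, which is more than being a coboundary.\<close>

lemma ex_slice:
  assumes s: "s \<in> Z2G" and norm: "\<And>a b. a \<in> carrier G \<Longrightarrow> b \<in> carrier G \<Longrightarrow> pnorm p s (a, b) = 1"
  shows "\<exists>\<tau>\<in>Z2c C G act K. slice \<tau> = s"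
proof -
  define P where "P i a b = (\<Prod>j<i. s (act a (t [^]\<^bsub>C\<^esub> j), act b (t [^]\<^bsub>C\<^esub> j)))" for i :: nat and a b
  have Pp: "P p a b = 1" if "a \<in> carrier G" "b \<in> carrier G" for a b
    using norm[OF that] that by (simp add: P_def pnorm_def)
  have add: "P (i + k) a b = P i a b * P k (act a (t [^]\<^bsub>C\<^esub> i)) (act b (t [^]\<^bsub>C\<^esub> i))"
    if "a \<in> carrier G" "b \<in> carrier G" for i k a b
  proof (induction k)
    case (Suc k)
    have "act c (t [^]\<^bsub>C\<^esub> (i + k)) = act (act c (t [^]\<^bsub>C\<^esub> i)) (t [^]\<^bsub>C\<^esub> k)" if "c \<in> carrier G" for c
      using act_comp[of "t [^]\<^bsub>C\<^esub> i" "t [^]\<^bsub>C\<^esub> k" c] that t by (simp add: C.nat_pow_mult)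
    then show ?case using Suc that by (simp add: P_def)
  qed (simp add: P_def)
  have cong: "P i a b = P k a b" if "a \<in> carrier G" "b \<in> carrier G" "t [^]\<^bsub>C\<^esub> i = t [^]\<^bsub>C\<^esub> k" for i k a b
  proof (rule periodic_cong[of "\<lambda>i. P i a b", OF _ that(3)])
    show "P (i + p) a b = P i a b" for i using add[OF that(1,2), of i p] Pp that(1,2) by simp
  qed
  define \<tau> where "\<tau> = (\<lambda>(x, a, b)\<in>cells. P (dlog x) a b)"
  have \<tau>_apply: "\<tau> (x, a, b) = P (dlog x) a b" if "x \<in> carrier C" "a \<in> carrier G" "b \<in> carrier G" for x a b
    using that by (simp add: \<tau>_def)
  have "\<tau> \<in> Z2c C G act K" unfolding Z2c_iff
  proof (intro conjI ballI)
    show "\<tau> \<in> extensional cells" by (simp add: \<tau>_def)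
    fix x y a b assume x: "x \<in> carrier C" and y: "y \<in> carrier C" and a: "a \<in> carrier G" and b: "b \<in> carrier G"
    have "t [^]\<^bsub>C\<^esub> dlog (x \<otimes>\<^bsub>C\<^esub> y) = t [^]\<^bsub>C\<^esub> (dlog x + dlog y)"
      using x y t by (simp add: t_pow_dlog C.nat_pow_mult[symmetric])
    then have "P (dlog (x \<otimes>\<^bsub>C\<^esub> y)) a b = P (dlog x + dlog y) a b" by (rule cong[OF a b])
    then show "\<tau> (x \<otimes>\<^bsub>C\<^esub> y, a, b) = \<tau> (x, a, b) * \<tau> (y, act a x, act b x)"
      using x y a b by (simp add: \<tau>_apply add[OF a b] t_pow_dlog)
  next
    fix x a b c assume x: "x \<in> carrier C" and abc: "a \<in> carrier G" "b \<in> carrier G" "c \<in> carrier G"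
    have "P i a (b \<otimes> c) * P i b c = P i (a \<otimes> b) c * P i a b" for i
      unfolding P_def prod.distrib[symmetric]
    proof (rule prod.cong)
      fix j :: nat
      show "s (act a (t [^]\<^bsub>C\<^esub> j), act (b \<otimes> c) (t [^]\<^bsub>C\<^esub> j)) * s (act b (t [^]\<^bsub>C\<^esub> j), act c (t [^]\<^bsub>C\<^esub> j)) =
          s (act (a \<otimes> b) (t [^]\<^bsub>C\<^esub> j), act c (t [^]\<^bsub>C\<^esub> j)) * s (act a (t [^]\<^bsub>C\<^esub> j), act b (t [^]\<^bsub>C\<^esub> j))"
        using Z2G_cocycle[OF s, of "act a (t [^]\<^bsub>C\<^esub> j)" "act b (t [^]\<^bsub>C\<^esub> j)" "act c (t [^]\<^bsub>C\<^esub> j)"] abc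
        by (simp add: act_mult mult.commute)
    qed simp
    then show "\<tau> (x, a, b \<otimes> c) * \<tau> (x, b, c) = \<tau> (x, a \<otimes> b, c) * \<tau> (x, a, b)"
      using x abc by (simp add: \<tau>_apply)
  qed (simp_all add: \<tau>_apply P_def dlog_one Z2G_nz[OF s] Z2G_unit[OF s])
  moreover have "slice \<tau> = s"
  proof (rule ext)
    fix w :: "'g \<times> 'g"
    obtain a b where w: "w = (a, b)" by fastforce
    show "slice \<tau> w = s w"
    proof (cases "a \<in> carrier G \<and> b \<in> carrier G")
      case True
      \<comment> \<open>The passage from \<open>dlog t\<close> to 1 uses periodicity, which also
        covers p = 1, where \<open>dlog t\<close> is 0.\<close>
      then have "\<tau> (t, a, b) = P 1 a b" using t by (simp add: \<tau>_apply) (intro cong, simp_all add: t_pow_dlog)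
      then show ?thesis using True act_unit by (simp add: w slice_def P_def)
    next
      case False then show ?thesis using Z2G_ext[OF s] by (auto simp: w slice_def extensional_def)
    qed
  qed
  ultimately show ?thesis by blast
qed

text \<open>Applying \<open>t\<close> permutes the p factors of the norm cyclically, since t^p =
  1.\<close>

lemma pnorm_invariant:
  assumes s: "s \<in> Z2G" and a: "a \<in> carrier G" and b: "b \<in> carrier G"
  shows "pnorm p s (act a t, act b t) = pnorm p s (a, b)"
proof -
  define f where "f i = s (act a (t [^]\<^bsub>C\<^esub> i), act b (t [^]\<^bsub>C\<^esub> i))" for i :: nat
  obtain n where n: "p = Suc n" using p_pos gr0_implies_Suc by blast
  have "act (act c t) (t [^]\<^bsub>C\<^esub> i) = act c (t [^]\<^bsub>C\<^esub> Suc i)" if "c \<in> carrier G" for c and i :: nat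
    using act_comp[of t "t [^]\<^bsub>C\<^esub> i" c] that t by (simp only: C.nat_pow_Suc2 t_pow_closed)
  then have "pnorm p s (act a t, act b t) = (\<Prod>i<p. f (Suc i))"
    using a b t by (simp add: pnorm_def f_def del: nat_pow_Suc)
  also have "f p = f 0" by (simp add: f_def t_pow_p)
  then have "(\<Prod>i<p. f (Suc i)) = (\<Prod>i<p. f i)"
    by (simp only: prod.lessThan_Suc[of "\<lambda>j. f (Suc j)"] prod.lessThan_Suc_shift[of f] n mult.commute)
  finally show ?thesis using a b by (simp add: pnorm_def f_def)
qed

text \<open>A slice has norm exactly 1, while a class in the norm kernel only has a representative s
  whose norm S is a coboundary. The gap is closed by changing s by a coboundary r of norm 1/S. Such
  an r exists because S is \<open>t\<close>-invariant and therefore has a \<open>t\<close>-invariant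
  primitive.\<close>

lemma carrier_norm_kernel: "carrier (norm_kernel_multiplier C t G act K) = restriction ` carrier cocycles_c"
proof (intro equalityI subsetI)
  fix Y assume "Y \<in> restriction ` carrier cocycles_c"
  then obtain \<tau> where \<tau>: "\<tau> \<in> Z2c C G act K" and Y: "Y = mult.cls (slice \<tau>)" by (auto simp: restriction_def)
  note s = slice_Z2G[OF \<tau>]
  \<comment> \<open>The norm of a slice is the value of \<tau> at t^p = 1.\<close>
  have one: "pnorm p (slice \<tau>) (a, b) = 1" if "a \<in> carrier G" "b \<in> carrier G" for a b
    using Z2c_pow[OF \<tau> that, of p] that by (simp add: pnorm_def slice_def t_pow_p Z2c_unit[OF \<tau>])
  have "pnorm p (slice \<tau>) \<in> B2G" unfolding B2G_iff using one
    by (intro conjI exI[of _ "\<lambda>_. 1"]) (simp_all, simp add: pnorm_def)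
  then have "mult.cls (pnorm p (slice \<tau>)) = \<one>\<^bsub>multiplier G K\<^esub>"
    using mult.cls_eq_one_iff[OF norm_map_cls(1)[OF s]] by (simp add: multiplier_def)
  then have "norm_map C t (multiplier G K) (multiplier_act G act) Y = \<one>\<^bsub>multiplier G K\<^esub>"
    using norm_map_cls(2)[OF s] Y by simp
  moreover have "Y \<in> carrier (multiplier G K)" unfolding Y multiplier_def mult.carrier_H2 using s by blast
  ultimately show "Y \<in> carrier (norm_kernel_multiplier C t G act K)"
    by (simp add: norm_kernel_multiplier_def kernel_def)
next
  fix Y assume "Y \<in> carrier (norm_kernel_multiplier C t G act K)"
  then have Y: "Y \<in> carrier (multiplier G K)"
      "norm_map C t (multiplier G K) (multiplier_act G act) Y = \<one>\<^bsub>multiplier G K\<^esub>"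
    by (simp_all add: norm_kernel_multiplier_def kernel_def)
  then obtain s where s: "s \<in> Z2G" and Ys: "Y = mult.cls s" by (auto simp: multiplier_def mult.carrier_H2)
  define S where "S = pnorm p s"
  have SZ: "S \<in> Z2G" unfolding S_def by (rule norm_map_cls(1)[OF s])
  have "S \<in> B2G" using Y(2) norm_map_cls[OF s] mult.cls_eq_one_iff[OF SZ] by (simp add: Ys S_def multiplier_def)
  then interpret S: symmetric_cocycle G "\<lambda>a b. S (a, b)"
    using symmetric_cocycleI[OF SZ] B2G_sym by blast
  have "S (act a t, act b t) = S (a, b)" if "a \<in> carrier G" "b \<in> carrier G" for a b
    unfolding S_def using pnorm_invariant[OF s that] .
  then obtain \<eta> where \<eta>: "\<forall>a\<in>carrier G. \<eta> a \<noteq> 0" "\<eta> \<one> = 1"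
    "\<forall>a\<in>carrier G. \<forall>b\<in>carrier G. S (a, b) = \<eta> a * \<eta> b / \<eta> (a \<otimes> b)" "\<forall>a\<in>carrier G. \<eta> (act a t) = \<eta> a"
    by (rule S.invariant_trivialization[OF act_hom[OF t]]) blast+
  have \<eta>_pow: "\<eta> (act a (t [^]\<^bsub>C\<^esub> i)) = \<eta> a" if "a \<in> carrier G" for a and i :: nat
  proof (induction i)
    case (Suc i) then show ?case using \<eta>(4) that act_t_pow_Suc[OF that, of i] by simp
  qed (use that act_unit in simp)
  \<comment> \<open>As \<eta> is constant on the orbits of \<open>t\<close>, so is its pointwise
    p-th root, and r is \<open>t\<close>-invariant. Its norm is then r^p, the coboundary of
    1/\<eta>, which is 1/S.\<close>
  define r where "r = (\<lambda>(a, b)\<in>pairs. inverse (rt (\<eta> a)) * inverse (rt (\<eta> b)) / inverse (rt (\<eta> (a \<otimes> b))))"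
  have rB: "r \<in> B2G" unfolding B2G_iff
    using \<eta> rt_nz by (intro conjI exI[of _ "\<lambda>a. inverse (rt (\<eta> a))"]) (simp_all add: r_def)
  then have rZ: "r \<in> Z2G" using mult.B2_subset_Z2 by blast
  define s' where "s' = s \<otimes>\<^bsub>mult.cochains2\<^esub> r"
  have s'Z: "s' \<in> Z2G" unfolding s'_def by (rule subgroup.m_closed[OF mult.subgroup_Z2 s rZ])
  have "pnorm p s' (a, b) = 1" if ab: "a \<in> carrier G" "b \<in> carrier G" for a b
  proof -
    have "pnorm p s' (a, b) = (\<Prod>i<p. s (act a (t [^]\<^bsub>C\<^esub> i), act b (t [^]\<^bsub>C\<^esub> i)) * r (a, b))"
      using ab \<eta>_pow by (simp add: pnorm_def s'_def r_def act_mult[symmetric])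
    also have "\<dots> = S (a, b) * r (a, b) ^ p" using ab by (simp add: S_def pnorm_def prod.distrib)
    also have "r (a, b) ^ p = inverse (\<eta> a) * inverse (\<eta> b) / inverse (\<eta> (a \<otimes> b))"
      using ab by (simp add: r_def power_mult_distrib power_divide rt_pow power_inverse)
    finally show ?thesis using ab \<eta> by (simp add: field_simps)
  qed
  then obtain \<tau> where \<tau>: "\<tau> \<in> Z2c C G act K" "slice \<tau> = s'" using ex_slice[OF s'Z] by blast
  interpret M: comm_group "multiplier G K" unfolding multiplier_def by (rule mult.comm_group_H2)
  have "restriction \<tau> = mult.cls s \<otimes>\<^bsub>multiplier G K\<^esub> mult.cls r"
    unfolding restriction_def \<tau>(2) s'_def multiplier_def by (rule mult.cls_mult[OF s rZ])
  also have "mult.cls r = \<one>\<^bsub>multiplier G K\<^esub>"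
    using mult.cls_eq_one_iff[OF rZ] rB by (simp add: multiplier_def)
  finally have "restriction \<tau> = Y" using Y(1) Ys by simp
  then show "Y \<in> restriction ` carrier cocycles_c" using \<tau>(1) by auto
qed

end

section \<open>Splittings\<close>

lemma set_multI: "h \<in> H \<Longrightarrow> k \<in> L \<Longrightarrow> h \<otimes>\<^bsub>G\<^esub> k \<in> H <#>\<^bsub>G\<^esub> L"
  by (auto simp: set_mult_def)

context cyclic_action begin

text \<open>Restriction to \<open>t\<close> plays the role of \<pi> and \<open>connecting\<close>
  the role of \<open>d\<close> in \<open>module_isomorphic_split\<close>. What remains for each case
  of the theorem is a stable U.\<close>

lemma module_isomorphic_of_complement:
  assumes U: "subgroup U cocycles_c" and UV: "U <#>\<^bsub>cocycles_c\<^esub> fibrewise_B2c = carrier cocycles_c"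
    and int: "U \<inter> fibrewise_B2c = B2c C G act K"
    and stable: "\<And>x u. x \<in> carrier C \<Longrightarrow> u \<in> U \<Longrightarrow> shift x u \<in> U"
  shows "module_isomorphic C (H2c C G act K) (H2c_act C G act)
    (H2 C (dual_group G K) (dual_act G act) \<times>\<times> norm_kernel_multiplier C t G act K)
    (prod_act (H2_coeff_act C (dual_act G act)) (multiplier_act G act))"
proof -
  have "module_isomorphic C (cocycles_c Mod (U \<inter> fibrewise_B2c)) (coset_act shift)
    (H2 C (dual_group G K) (dual_act G act) \<times>\<times> (multiplier G K)\<lparr>carrier := restriction ` carrier cocycles_c\<rparr>)
    (prod_act (H2_coeff_act C (dual_act G act)) (multiplier_act G act))"
  proof (rule module_isomorphic_split[where d = connecting])
    show "comm_group cocycles_c" by (rule comm_group_cocycles_c)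
    show "group (multiplier G K)" unfolding multiplier_def
      using mult.comm_group_H2 by (rule comm_group.axioms(2))
    show "group (H2 C (dual_group G K) (dual_act G act))"
      using dual.comm_group_H2 by (rule comm_group.axioms(2))
    show "subgroup fibrewise_B2c cocycles_c" by (rule subgroup_fibrewise_B2c)
    show "restriction m = \<one>\<^bsub>multiplier G K\<^esub> \<longleftrightarrow> m \<in> fibrewise_B2c" if "m \<in> carrier cocycles_c" for m
      using that restriction_eq_one_iff by simp
    show "connecting v = \<one>\<^bsub>H2 C (dual_group G K) (dual_act G act)\<^esub> \<longleftrightarrow> v \<in> U" if "v \<in> fibrewise_B2c" for v
      using connecting_eq_one_iff[OF that] int that by blast
    show "shift x m \<in> carrier cocycles_c" if "x \<in> carrier C" "m \<in> carrier cocycles_c" for x m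
      using that shift_Z2c by simp
    show "restriction (shift x m) = multiplier_act G act x (restriction m)"
      if "x \<in> carrier C" "m \<in> carrier cocycles_c" for x m
      using that restriction_shift by simp
    show "subgroup U cocycles_c" "U <#>\<^bsub>cocycles_c\<^esub> fibrewise_B2c = carrier cocycles_c" by fact+
    show "restriction \<in> hom cocycles_c (multiplier G K)" by (rule restriction_hom)
    show "connecting (v \<otimes>\<^bsub>cocycles_c\<^esub> w) = connecting v \<otimes>\<^bsub>H2 C (dual_group G K) (dual_act G act)\<^esub> connecting w"
      if "v \<in> fibrewise_B2c" "w \<in> fibrewise_B2c" for v w using that by (rule connecting_mult)
    show "connecting ` fibrewise_B2c = carrier (H2 C (dual_group G K) (dual_act G act))" by (rule connecting_image)
    show "shift x (m \<otimes>\<^bsub>cocycles_c\<^esub> m') = shift x m \<otimes>\<^bsub>cocycles_c\<^esub> shift x m'"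
      if "x \<in> carrier C" for x m m' using that by (rule shift_mult)
    show "shift x u \<in> U" if "x \<in> carrier C" "u \<in> U" for x u using that by (rule stable)
    show "shift x v \<in> fibrewise_B2c" if "x \<in> carrier C" "v \<in> fibrewise_B2c" for x v using that by (rule shift_fibrewise_B2c)
    show "connecting (shift x v) = H2_coeff_act C (dual_act G act) x (connecting v)" if "x \<in> carrier C" "v \<in> fibrewise_B2c" for x v
      using that by (rule connecting_shift)
  qed
  moreover have "(multiplier G K)\<lparr>carrier := restriction ` carrier cocycles_c\<rparr> = norm_kernel_multiplier C t G act K"
    using carrier_norm_kernel by (simp add: norm_kernel_multiplier_def)
  moreover have "coset_act shift = H2c_act C G act" by (simp add: H2c_act_def shift_def[abs_def])
  ultimately show ?thesis by (simp only: int H2c_def)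
qed

section \<open>Odd order: half of the alternating bicharacter\<close>

definition alt :: "('c \<times> 'g \<times> 'g \<Rightarrow> 'k) \<Rightarrow> 'c \<Rightarrow> 'g \<Rightarrow> 'g \<Rightarrow> 'k" where
  "alt \<tau> x a b = \<tau> (x, a, b) / \<tau> (x, b, a)"

text \<open>Three cocycle identities, at (a, b, c), (c, a, b) and (a, c, b), fit together because
  \<open>G\<close> is commutative.\<close>

lemma alt_mult_left:
  assumes \<tau>: "\<tau> \<in> Z2c C G act K" and x: "x \<in> carrier C"
    and c: "a \<in> carrier G" "b \<in> carrier G" "c \<in> carrier G"
  shows "alt \<tau> x (a \<otimes> b) c = alt \<tau> x a c * alt \<tau> x b c"
proof -
  note nz = Z2c_nz[OF \<tau> x]
  have 1: "\<tau> (x, a, b \<otimes> c) * \<tau> (x, b, c) = \<tau> (x, a \<otimes> b, c) * \<tau> (x, a, b)"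
    using Z2c_cocycle[OF \<tau> x] c by blast
  have 2: "\<tau> (x, c, a \<otimes> b) * \<tau> (x, a, b) = \<tau> (x, a \<otimes> c, b) * \<tau> (x, c, a)"
    using Z2c_cocycle[OF \<tau> x, of c a b] c by (simp add: G.m_comm)
  have 3: "\<tau> (x, a, b \<otimes> c) * \<tau> (x, c, b) = \<tau> (x, a \<otimes> c, b) * \<tau> (x, a, c)"
    using Z2c_cocycle[OF \<tau> x, of a c b] c by (simp add: G.m_comm)
  have "\<tau> (x, a \<otimes> b, c) = \<tau> (x, a, b \<otimes> c) * \<tau> (x, b, c) / \<tau> (x, a, b)"
    "\<tau> (x, c, a \<otimes> b) = \<tau> (x, a \<otimes> c, b) * \<tau> (x, c, a) / \<tau> (x, a, b)"
    "\<tau> (x, a, b \<otimes> c) = \<tau> (x, a \<otimes> c, b) * \<tau> (x, a, c) / \<tau> (x, c, b)"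
    using 1 2 3 nz c by (simp_all add: field_simps)
  then show ?thesis using nz c by (simp add: alt_def)
qed

lemma alt_swap: "alt \<tau> x a b = inverse (alt \<tau> x b a)"
  by (simp add: alt_def)

lemma alt_mult_right:
  assumes "\<tau> \<in> Z2c C G act K" "x \<in> carrier C" "a \<in> carrier G" "b \<in> carrier G" "c \<in> carrier G"
  shows "alt \<tau> x a (b \<otimes> c) = alt \<tau> x a b * alt \<tau> x a c"
  using alt_mult_left[of \<tau> x b c a] assms by (simp add: alt_swap[of \<tau> x a])

text \<open>With n the order of \<open>G\<close>, or n = 2 in an elementary abelian 2-group, this
  makes the values of \<open>alt\<close> n-th roots of unity.\<close>

lemma alt_pow:
  assumes \<tau>: "\<tau> \<in> Z2c C G act K" and x: "x \<in> carrier C" and c: "a \<in> carrier G" "b \<in> carrier G"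
  shows "alt \<tau> x a b ^ n = alt \<tau> x (a [^] n) b"
proof (induction n)
  case 0 show ?case using x c by (simp add: alt_def Z2c_unit[OF \<tau>])
next
  case (Suc n) then show ?case using alt_mult_left[OF \<tau> x _ c(1) c(2), of "a [^] n"] c by simp
qed

lemma fibrewise_B2c_symmetric: "v \<in> fibrewise_B2c \<Longrightarrow> x \<in> carrier C \<Longrightarrow> a \<in> carrier G \<Longrightarrow> b \<in> carrier G \<Longrightarrow> v (x, a, b) = v (x, b, a)"
  by (auto simp: fibrewise_B2c_def delta_G_apply G.m_comm)

text \<open>If the order \<open>n\<close> of \<open>G\<close> is odd, \<open>(n + 1) div 2\<close> is a half modulo \<open>n\<close>, so \<open>sqrt_alt \<tau>\<close> is a cocycle
  with the same alternating bicharacter as \<open>\<tau>\<close> and depends only on this bicharacter.\<close>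

definition sqrt_alt :: "('c \<times> 'g \<times> 'g \<Rightarrow> 'k) \<Rightarrow> 'c \<times> 'g \<times> 'g \<Rightarrow> 'k" where
  "sqrt_alt \<tau> = (\<lambda>(x, a, b)\<in>cells. alt \<tau> x a b ^ ((Coset.order G + 1) div 2))"

text \<open>\<open>sqrt_alt\<close> is an idempotent endomorphism that commutes with the action and
  kills V, and \<tau> divided by \<open>sqrt_alt \<tau>\<close> is symmetric at t, hence in V. Its
  image is thus a stable complement of V; multiplying the image by B^2_c makes the intersection with
  V equal to B^2_c.\<close>

lemma odd_complement:
  assumes odd: "odd (Coset.order G)"
  obtains U where "subgroup U cocycles_c" "U <#>\<^bsub>cocycles_c\<^esub> fibrewise_B2c = carrier cocycles_c"
    "U \<inter> fibrewise_B2c = B2c C G act K" "\<And>x u. x \<in> carrier C \<Longrightarrow> u \<in> U \<Longrightarrow> shift x u \<in> U"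
proof -
  define h where "h = (Coset.order G + 1) div 2"
  have h: "h + h = Suc (Coset.order G)" using odd by (auto simp: h_def elim: oddE)
  have apply_h: "sqrt_alt \<tau> (x, a, b) = alt \<tau> x a b ^ h"
    if "x \<in> carrier C" "a \<in> carrier G" "b \<in> carrier G" for \<tau> x a b
    using that by (simp add: sqrt_alt_def h_def)
  \<comment> \<open>The order of a value of \<open>alt\<close> divides the order of
    \<open>G\<close>, so the exponent h + h, which exceeds that order by one, acts as the exponent
    1.\<close>
  have alt_order: "alt \<tau> x a b ^ h * alt \<tau> x a b ^ h = alt \<tau> x a b"
    if "\<tau> \<in> Z2c C G act K" "x \<in> carrier C" "a \<in> carrier G" "b \<in> carrier G" for \<tau> x a b
  proof -
    have "alt \<tau> x a b ^ Coset.order G = 1"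
      using that alt_pow[OF that, of "Coset.order G"] by (simp add: G.pow_order_eq_1 alt_def Z2c_unit)
    then show ?thesis by (simp add: power_add[symmetric] h)
  qed
  interpret Z: comm_group cocycles_c by (rule comm_group_cocycles_c)
  have closed: "sqrt_alt \<tau> \<in> Z2c C G act K" if \<tau>: "\<tau> \<in> Z2c C G act K" for \<tau>
    unfolding Z2c_iff
  proof (intro conjI ballI)
    show "sqrt_alt \<tau> \<in> extensional cells" by (simp add: sqrt_alt_def)
    fix x a b c assume "x \<in> carrier C" "a \<in> carrier G" "b \<in> carrier G" "c \<in> carrier G"
    then show "sqrt_alt \<tau> (x, a, b \<otimes> c) * sqrt_alt \<tau> (x, b, c) = sqrt_alt \<tau> (x, a \<otimes> b, c) * sqrt_alt \<tau> (x, a, b)"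
      by (simp add: apply_h alt_mult_left[OF \<tau>] alt_mult_right[OF \<tau>] power_mult_distrib)
  next
    fix x y a b assume "x \<in> carrier C" "y \<in> carrier C" "a \<in> carrier G" "b \<in> carrier G"
    then show "sqrt_alt \<tau> (x \<otimes>\<^bsub>C\<^esub> y, a, b) = sqrt_alt \<tau> (x, a, b) * sqrt_alt \<tau> (y, act a x, act b x)"
      by (simp add: apply_h alt_def Z2c_mult[OF \<tau>] power_mult_distrib[symmetric])
  qed (simp_all add: apply_h alt_def Z2c_nz[OF \<tau>] Z2c_unit[OF \<tau>])
  have "sqrt_alt \<in> hom cocycles_c cocycles_c"
    using closed
    by (auto simp: hom_def sqrt_alt_def alt_def fun_eq_iff power_mult_distrib power_divide)
  then interpret s: group_hom cocycles_c cocycles_c sqrt_alt by unfold_locales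
  define U where "U = B2c C G act K <#>\<^bsub>cocycles_c\<^esub> sqrt_alt ` carrier cocycles_c"
  have U: "subgroup U cocycles_c" unfolding U_def
    using Z.mult_subgroups[OF subgroup_B2c s.img_is_subgroup] .
  have B_U: "b \<in> U" if "b \<in> B2c C G act K" for b
  proof -
    have "b = b \<otimes>\<^bsub>cocycles_c\<^esub> sqrt_alt \<one>\<^bsub>cocycles_c\<^esub>"
      using subgroup.mem_carrier[OF subgroup_B2c that] by (simp only: s.hom_one Z.r_one)
    also have "\<dots> \<in> U" unfolding U_def using that Z.one_closed by (intro set_multI imageI)
    finally show ?thesis .
  qed
  have s_U: "sqrt_alt \<tau> \<in> U" if "\<tau> \<in> Z2c C G act K" for \<tau>
  proof -
    have "sqrt_alt \<tau> = \<one>\<^bsub>cocycles_c\<^esub> \<otimes>\<^bsub>cocycles_c\<^esub> sqrt_alt \<tau>"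
      using closed[OF that] Z.l_one[of "sqrt_alt \<tau>"] by simp
    also have "\<dots> \<in> U" unfolding U_def
      using that subgroup.one_closed[OF subgroup_B2c] by (intro set_multI) simp_all
    finally show ?thesis .
  qed
  have idem: "sqrt_alt (sqrt_alt \<tau>) = sqrt_alt \<tau>" if \<tau>: "\<tau> \<in> Z2c C G act K" for \<tau>
  proof -
    have "alt (sqrt_alt \<tau>) x a b = alt \<tau> x a b" if "x \<in> carrier C" "a \<in> carrier G" "b \<in> carrier G" for x a b
    proof -
      have "alt (sqrt_alt \<tau>) x a b = alt \<tau> x a b ^ h / alt \<tau> x b a ^ h"
        unfolding alt_def[of "sqrt_alt \<tau>"] using that by (simp add: apply_h)
      also have "\<dots> = alt \<tau> x a b ^ h * alt \<tau> x a b ^ h"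
        by (subst alt_swap[of \<tau> x b a]) (simp add: divide_inverse power_inverse)
      also have "\<dots> = alt \<tau> x a b" using alt_order[OF \<tau> that] .
      finally show ?thesis .
    qed
    then show ?thesis by (auto simp: sqrt_alt_def fun_eq_iff)
  qed
  have sym_one: "sqrt_alt v = \<one>\<^bsub>cocycles_c\<^esub>" if "v \<in> fibrewise_B2c" for v
  proof -
    have nz: "v (x, a, b) \<noteq> 0" if "x \<in> carrier C" "a \<in> carrier G" "b \<in> carrier G" for x a b
      using \<open>v \<in> fibrewise_B2c\<close> that Z2c_nz by (auto simp: fibrewise_B2c_def)
    show ?thesis using fibrewise_B2c_symmetric[OF that] nz by (auto simp: sqrt_alt_def alt_def fun_eq_iff)
  qed
  have "U \<inter> fibrewise_B2c = B2c C G act K"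
  proof (intro equalityI subsetI IntI)
    fix u assume "u \<in> U \<inter> fibrewise_B2c"
    then obtain b \<tau> where b: "b \<in> B2c C G act K" and \<tau>: "\<tau> \<in> Z2c C G act K"
      and u: "u = b \<otimes>\<^bsub>cocycles_c\<^esub> sqrt_alt \<tau>" and uV: "u \<in> fibrewise_B2c"
      by (auto simp: U_def set_mult_def)
    have bc: "b \<in> carrier cocycles_c" using subgroup.mem_carrier[OF subgroup_B2c b] .
    have \<tau>c: "sqrt_alt \<tau> \<in> carrier cocycles_c" using closed[OF \<tau>] by simp
    \<comment> \<open>Apply \<open>sqrt_alt\<close> to u = b \<open>sqrt_alt \<tau>\<close>: the
      elements u and b of V go to 1, and the last factor is fixed. So that factor is 1 and u =
      b.\<close>
    have "\<one>\<^bsub>cocycles_c\<^esub> = sqrt_alt b \<otimes>\<^bsub>cocycles_c\<^esub> sqrt_alt (sqrt_alt \<tau>)"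
      using sym_one[OF uV] unfolding u s.hom_mult[OF bc \<tau>c] by simp
    also have "sqrt_alt b = \<one>\<^bsub>cocycles_c\<^esub>" using b B2c_subset_fibrewise sym_one by blast
    also have "sqrt_alt (sqrt_alt \<tau>) = sqrt_alt \<tau>" using idem[OF \<tau>] .
    finally have "sqrt_alt \<tau> = \<one>\<^bsub>cocycles_c\<^esub>" using Z.l_one[OF \<tau>c] by (simp only:)
    then show "u \<in> B2c C G act K" using b u Z.r_one[OF bc] by (simp only:)
  qed (use B_U B2c_subset_fibrewise in blast)+
  moreover have "U <#>\<^bsub>cocycles_c\<^esub> fibrewise_B2c = carrier cocycles_c"
  proof (intro equalityI subsetI)
    fix \<tau> assume \<tau>c: "\<tau> \<in> carrier cocycles_c"
    then have \<tau>: "\<tau> \<in> Z2c C G act K" by simp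
    have sc: "sqrt_alt \<tau> \<in> carrier cocycles_c" using closed[OF \<tau>] by simp
    define v where "v = inv\<^bsub>cocycles_c\<^esub> sqrt_alt \<tau> \<otimes>\<^bsub>cocycles_c\<^esub> \<tau>"
    have vc: "v \<in> carrier cocycles_c" unfolding v_def by (rule Z.m_closed[OF Z.inv_closed[OF sc] \<tau>c])
    then have vZ: "v \<in> Z2c C G act K" by simp
    have v_apply: "v (x, a, b) = \<tau> (x, a, b) / alt \<tau> x a b ^ h"
      if "x \<in> carrier C" "a \<in> carrier G" "b \<in> carrier G" for x a b
      using that unfolding v_def inv_cocycles_c[OF closed[OF \<tau>]] by (simp add: apply_h divide_inverse)
    \<comment> \<open>With q^2 = \<open>alt \<tau> t a b\<close>, both sides are equal to \<tau>(t,
      b, a) q: the left one arises from dividing \<tau>(t, b, a) q^2 by q, the right one from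
      dividing \<tau>(t, b, a) by 1/q.\<close>
    have "v (t, a, b) = v (t, b, a)" if ab: "a \<in> carrier G" "b \<in> carrier G" for a b
    proof -
      have nz: "\<tau> (t, a, b) \<noteq> 0" "\<tau> (t, b, a) \<noteq> 0" using Z2c_nz[OF \<tau> t] ab by auto
      define q where "q = alt \<tau> t a b ^ h"
      have "alt \<tau> t b a ^ h = inverse q"
        unfolding q_def by (subst alt_swap[of \<tau> t b a]) (simp add: power_inverse)
      moreover have "q \<noteq> 0" using nz by (simp add: q_def alt_def)
      moreover have "\<tau> (t, a, b) = \<tau> (t, b, a) * (q * q)"
        unfolding q_def alt_order[OF \<tau> t ab] using nz by (simp add: alt_def)
      ultimately show ?thesis using ab t by (simp add: v_apply q_def[symmetric] divide_inverse)
    qed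
    then have "slice v \<in> B2G"
      by (intro symmetric_imp_B2G slice_Z2G[OF vZ]) (simp_all add: slice_def)
    then have "restriction v = \<one>\<^bsub>multiplier G K\<^esub>"
      using mult.cls_eq_one_iff[OF slice_Z2G[OF vZ]] by (simp add: restriction_def multiplier_def)
    then have "v \<in> fibrewise_B2c" using restriction_eq_one_iff[OF vZ] by simp
    moreover have "\<tau> = sqrt_alt \<tau> \<otimes>\<^bsub>cocycles_c\<^esub> v"
      unfolding v_def using sc \<tau>c by (simp only: Z.m_assoc[symmetric] Z.inv_closed Z.r_inv Z.l_one)
    ultimately show "\<tau> \<in> U <#>\<^bsub>cocycles_c\<^esub> fibrewise_B2c" using s_U[OF \<tau>] set_multI by metis
  next
    fix \<tau> assume "\<tau> \<in> U <#>\<^bsub>cocycles_c\<^esub> fibrewise_B2c"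
    then show "\<tau> \<in> carrier cocycles_c"
      using subgroup.subset[OF Z.mult_subgroups[OF U subgroup_fibrewise_B2c]] by blast
  qed
  moreover have "shift x u \<in> U" if x: "x \<in> carrier C" and u: "u \<in> U" for x u
  proof -
    obtain b \<tau> where b: "b \<in> B2c C G act K" and \<tau>: "\<tau> \<in> Z2c C G act K"
      and u: "u = b \<otimes>\<^bsub>cocycles_c\<^esub> sqrt_alt \<tau>"
      using u by (auto simp: U_def set_mult_def)
    have "shift x (sqrt_alt \<tau>) = sqrt_alt (shift x \<tau>)"
      using x by (auto simp: sqrt_alt_def shift_def alt_def fun_eq_iff)
    then have "shift x u = shift x b \<otimes>\<^bsub>cocycles_c\<^esub> sqrt_alt (shift x \<tau>)"
      unfolding u shift_mult[OF x] by (simp only:)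
    then show ?thesis
      using subgroup.m_closed[OF U B_U[OF shift_B2c[OF x b]] s_U[OF shift_Z2c[OF x \<tau>]]] by (simp only:)
  qed
  ultimately show thesis using that U by blast
qed

section \<open>The case p = 2\<close>

lemma two_elements:
  assumes "p = 2" "x \<in> carrier C"
  shows "x = \<one>\<^bsub>C\<^esub> \<or> x = t"
proof -
  have tt: "t \<otimes>\<^bsub>C\<^esub> t = \<one>\<^bsub>C\<^esub>" using t_pow_p t by (simp add: assms(1) numeral_2_eq_2)
  have "t [^]\<^bsub>C\<^esub> i = \<one>\<^bsub>C\<^esub> \<or> t [^]\<^bsub>C\<^esub> i = t" for i :: nat
    by (induction i) (use t tt in auto)
  then show ?thesis using C_cyclic[OF assms(2)] by blast
qed

text \<open>Inversion by \<open>t\<close> already holds for cocycles, so every subgroup of Z^2_c is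
  stable and any complement containing B^2_c will do.\<close>

lemma exponent_two_complement:
  assumes p: "p = 2" and sq: "\<And>\<tau>. \<tau> \<in> Z2c C G act K \<Longrightarrow> \<tau> \<otimes>\<^bsub>cocycles_c\<^esub> \<tau> \<in> B2c C G act K"
  obtains U where "subgroup U cocycles_c" "U <#>\<^bsub>cocycles_c\<^esub> fibrewise_B2c = carrier cocycles_c"
    "U \<inter> fibrewise_B2c = B2c C G act K" "\<And>x u. x \<in> carrier C \<Longrightarrow> u \<in> U \<Longrightarrow> shift x u \<in> U"
proof -
  interpret Z: comm_group cocycles_c by (rule comm_group_cocycles_c)
  obtain U where U: "subgroup U cocycles_c" "B2c C G act K \<subseteq> U" "U \<inter> fibrewise_B2c \<subseteq> B2c C G act K"
    "U <#>\<^bsub>cocycles_c\<^esub> fibrewise_B2c = carrier cocycles_c"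
    by (rule Z.exponent_two_complement[OF subgroup_fibrewise_B2c subgroup_B2c]) (use sq in simp_all)
  have tt: "t \<otimes>\<^bsub>C\<^esub> t = \<one>\<^bsub>C\<^esub>" using t_pow_p t by (simp add: p numeral_2_eq_2)
  have "shift x u \<in> U" if x: "x \<in> carrier C" and u: "u \<in> U" for x u
  proof -
    have uZ: "u \<in> Z2c C G act K" using subgroup.mem_carrier[OF U(1) u] by simp
    have "shift \<one>\<^bsub>C\<^esub> u = u"
    proof (rule ext)
      fix w show "shift \<one>\<^bsub>C\<^esub> u w = u w"
        using Z2c_ext[OF uZ] by (cases w) (auto simp: shift_def act_unit extensional_def)
    qed
    moreover have "shift t u = inv\<^bsub>cocycles_c\<^esub> u" unfolding inv_cocycles_c[OF uZ]
    proof (rule ext)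
      fix w :: "'c \<times> 'g \<times> 'g"
      obtain y a b where w: "w = (y, a, b)" by (metis prod.exhaust)
      show "shift t u w = (\<lambda>i\<in>cells. inverse (u i)) w"
      proof (cases "w \<in> cells")
        case True
        then have c: "y \<in> carrier C" "a \<in> carrier G" "b \<in> carrier G" by (simp_all add: w)
        \<comment> \<open>For y = t this is multiplicativity at t t = 1; for y the identity both
          factors are 1.\<close>
        have "u (y, a, b) * u (y, act a t, act b t) = 1"
          using two_elements[OF p c(1)] Z2c_mult[OF uZ t t c(2,3)] c t
          by (auto simp: Z2c_unit[OF uZ] tt)
        then show ?thesis using c by (simp add: w shift_apply inverse_unique)
      qed (auto simp: w shift_def)
    qed
    ultimately show ?thesis
      using two_elements[OF p x] u subgroup.m_inv_closed[OF U(1) u] by auto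
  qed
  moreover have "U \<inter> fibrewise_B2c = B2c C G act K" using U(2,3) B2c_subset_fibrewise by blast
  ultimately show thesis using that U by blast
qed

text \<open>For a trivial action \<tau>(t)^2 = \<tau>(t t) = 1, so the square is trivial already as
  a cocycle.\<close>

lemma square_trivial_action:
  assumes p: "p = 2" and triv: "\<And>x a. x \<in> carrier C \<Longrightarrow> a \<in> carrier G \<Longrightarrow> act a x = a"
    and \<tau>: "\<tau> \<in> Z2c C G act K"
  shows "\<tau> \<otimes>\<^bsub>cocycles_c\<^esub> \<tau> \<in> B2c C G act K"
proof -
  have "t \<otimes>\<^bsub>C\<^esub> t = \<one>\<^bsub>C\<^esub>" using t_pow_p t by (simp add: p numeral_2_eq_2)
  then have "\<tau> (x, a, b) * \<tau> (x, a, b) = 1" if "x \<in> carrier C" "a \<in> carrier G" "b \<in> carrier G" for x a b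
    using two_elements[OF p that(1)] Z2c_mult[OF \<tau> t t that(2,3)] triv t that
    by (auto simp: Z2c_unit[OF \<tau>])
  then have "\<tau> \<otimes>\<^bsub>cocycles_c\<^esub> \<tau> = \<one>\<^bsub>cocycles_c\<^esub>" by (auto simp: fun_eq_iff)
  then show ?thesis using subgroup.one_closed[OF subgroup_B2c] by simp
qed

text \<open>The square S of \<tau>(t) is symmetric because \<open>alt\<close> takes values of square
  1. To land in B^2_c, its primitive \<eta> must satisfy \<eta> (t . \<eta>) = 1, which is
  multiplicativity at t t = 1; this is why the anti-invariant trivialization is used.\<close>

lemma square_elementary:
  assumes p: "p = 2" and elem: "\<And>a. a \<in> carrier G \<Longrightarrow> a \<otimes> a = \<one>"
    and \<tau>: "\<tau> \<in> Z2c C G act K"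
  shows "\<tau> \<otimes>\<^bsub>cocycles_c\<^esub> \<tau> \<in> B2c C G act K"
proof -
  have tt: "t \<otimes>\<^bsub>C\<^esub> t = \<one>\<^bsub>C\<^esub>" using t_pow_p t by (simp add: p numeral_2_eq_2)
  have norm: "\<tau> (t, a, b) * \<tau> (t, act a t, act b t) = 1" if "a \<in> carrier G" "b \<in> carrier G" for a b
    using Z2c_mult[OF \<tau> t t that] that by (simp add: tt Z2c_unit[OF \<tau>])
  define S where "S a b = \<tau> (t, a, b) * \<tau> (t, a, b)" for a b
  interpret S: symmetric_cocycle G S
  proof
    show "finite (carrier G)" by (rule finite_G)
    show "S a b \<noteq> 0" if "a \<in> carrier G" "b \<in> carrier G" for a b
      using that t by (simp add: S_def Z2c_nz[OF \<tau>])
    show "S \<one> a = 1" if "a \<in> carrier G" for a using that t by (simp add: S_def Z2c_unit[OF \<tau>])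
    show "S a b = S b a" if c: "a \<in> carrier G" "b \<in> carrier G" for a b
    proof -
      have "alt \<tau> t a b ^ 2 = alt \<tau> t (a \<otimes> a) b"
        using alt_pow[OF \<tau> t c, of 2] c by (simp add: numeral_2_eq_2)
      also have "\<dots> = 1" using elem c t by (simp add: alt_def Z2c_unit[OF \<tau>])
      finally show ?thesis using Z2c_nz[OF \<tau> t c] Z2c_nz[OF \<tau> t c(2,1)]
        by (simp add: alt_def S_def power2_eq_square)
    qed
    show "S b c * S a (b \<otimes> c) = S (a \<otimes> b) c * S a b"
      if "a \<in> carrier G" "b \<in> carrier G" "c \<in> carrier G" for a b c
      using mult_eq_mult_interchange[OF Z2c_cocycle[OF \<tau> t that] Z2c_cocycle[OF \<tau> t that]]
      by (simp add: S_def mult.commute)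
  qed
  have inv: "S a b * S (act a t) (act b t) = 1" if "a \<in> carrier G" "b \<in> carrier G" for a b
  proof -
    have "S a b * S (act a t) (act b t) =
        (\<tau> (t, a, b) * \<tau> (t, act a t, act b t)) * (\<tau> (t, a, b) * \<tau> (t, act a t, act b t))"
      by (simp add: S_def ac_simps)
    then show ?thesis using norm[OF that] by simp
  qed
  \<comment> \<open>Here a (t a) = 1 = a^2 gives t a = a, and the norm condition turns into
    \<tau>(t, a, a)^2 = 1.\<close>
  have fixed: "S a (act a t) = 1" if a: "a \<in> carrier G" "a \<otimes> act a t = \<one>" for a
  proof -
    have "act a t = a" using a elem[OF a(1)] t by (metis G.l_cancel act_closed)
    then show ?thesis using norm[OF a(1) a(1)] by (simp add: S_def)
  qed
  obtain \<eta> where \<eta>: "\<forall>a\<in>carrier G. \<eta> a \<noteq> 0" "\<eta> \<one> = 1"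
    "\<forall>a\<in>carrier G. \<forall>b\<in>carrier G. S a b = \<eta> a * \<eta> b / \<eta> (a \<otimes> b)" "\<forall>a\<in>carrier G. \<eta> a * \<eta> (act a t) = 1"
    by (rule S.anti_invariant_trivialization[OF act_hom[OF t] inv fixed]) blast+
  define \<eta>' where "\<eta>' x a = (if x = \<one>\<^bsub>C\<^esub> then 1 else \<eta> a)" for x a
  have "cochain \<eta>'" using \<eta> by (simp add: cochain_def \<eta>'_def)
  moreover have "mult_cochain \<eta>'"
    unfolding mult_cochain_def
  proof (intro ballI)
    fix x y a assume "x \<in> carrier C" "y \<in> carrier C" "a \<in> carrier G"
    then show "\<eta>' (x \<otimes>\<^bsub>C\<^esub> y) a = \<eta>' x a * \<eta>' y (act a x)"
      using two_elements[OF p, of x] two_elements[OF p, of y] \<eta>(4) tt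
      by (auto simp: \<eta>'_def act_unit)
  qed
  moreover have "\<tau> \<otimes>\<^bsub>cocycles_c\<^esub> \<tau> = delta_G \<eta>'"
  proof (rule ext)
    fix w :: "'c \<times> 'g \<times> 'g"
    obtain x a b where w: "w = (x, a, b)" by (metis prod.exhaust)
    show "(\<tau> \<otimes>\<^bsub>cocycles_c\<^esub> \<tau>) w = delta_G \<eta>' w"
      using two_elements[OF p, of x] \<eta>(3)
      by (auto simp: w delta_G_def \<eta>'_def Z2c_unit[OF \<tau>] S_def)
  qed
  ultimately show ?thesis using B2c_iff by blast
qed

end

theorem proposition3p6:
  fixes C :: "('c, 'r) monoid_scheme" and t :: 'c
    and G :: "('g, 's) monoid_scheme" and act :: "'g \<Rightarrow> 'c \<Rightarrow> 'g"
    and p :: nat and K :: "'k::{alg_closed_field, field_char_0} monoid"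
  assumes p: "Factorial_Ring.prime p"
    and K: "K = unit_group"
    and C: "group C" "Coset.order C = p" "t \<in> carrier C" "carrier C = generate C {t}"
    and G: "comm_group G" "finite (carrier G)" "\<exists>n. Coset.order G = p ^ n"
    and act: "right_aut_action C G act"
    and cases: "odd p \<or>
      (p = 2 \<and> ((\<forall>x\<in>carrier C. \<forall>a\<in>carrier G. act a x = a) \<or>
                (\<forall>a\<in>carrier G. a [^]\<^bsub>G\<^esub> (2::nat) = \<one>\<^bsub>G\<^esub>)))"
  shows "module_isomorphic C
    (H2c C G act K) (H2c_act C G act)
    (H2 C (dual_group G K) (dual_act G act) \<times>\<times> norm_kernel_multiplier C t G act K)
    (prod_act (H2_coeff_act C (dual_act G act)) (multiplier_act G act))"
proof -
  interpret cyclic_action C G t act p K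
    using p K C G act
    by (simp add: cyclic_action_def cyclic_action_axioms_def prime_gt_0_nat)
  show ?thesis
  proof (cases "odd p")
    case True
    then have "odd (Coset.order G)" using G(3) by auto
    from odd_complement[OF this] show ?thesis using module_isomorphic_of_complement by metis
  next
    case False
    then have "p = 2" using cases by blast
    have sq: "\<tau> \<otimes>\<^bsub>cocycles_c\<^esub> \<tau> \<in> B2c C G act K" if \<tau>: "\<tau> \<in> Z2c C G act K" for \<tau>
    proof (cases "\<forall>x\<in>carrier C. \<forall>a\<in>carrier G. act a x = a")
      case True
      then show ?thesis using square_trivial_action[OF \<open>p = 2\<close> _ \<tau>] by blast
    next
      case False
      then have "a \<otimes>\<^bsub>G\<^esub> a = \<one>\<^bsub>G\<^esub>" if "a \<in> carrier G" for a
        using cases \<open>\<not> odd p\<close> that by (auto simp: numeral_2_eq_2)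
      then show ?thesis using square_elementary[OF \<open>p = 2\<close> _ \<tau>] by blast
    qed
    from exponent_two_complement[OF \<open>p = 2\<close> sq] show ?thesis
      using module_isomorphic_of_complement by metis
  qed
qed

end
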